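(* Suppose $(Q_1,Q_2)$ has a $\mathrm{DMMT}(\boldsymbol{\rho},\boldsymbol{\lambda},\boldsymbol{\alpha},Q_0)$ prior and, given $(Q_1,Q_2)$, we observe two independent groups of i.i.d. samples $\boldsymbol{x}_1=(x_{1,1},\dots,x_{1,n_1})$ from $Q_1$ and $\boldsymbol{x}_2=(x_{2,1},\dots,x_{2,n_2})$ from $Q_2$. Then the posterior law of $(Q_1,Q_2)$ is again a DMMT with the same baseline $Q_0$ (for some initial state probabilities) and with the following parameters: (1) transition probabilities $$\rho_{g,h}(A|\boldsymbol{x}_1,\boldsymbol{x}_2)=\rho_{g,h}(A)\,\frac{Z(A,h,\boldsymbol{x}_1,\boldsymbol{x}_2)}{\Phi(A,g,\boldsymbol{x}_1,\boldsymbol{x}_2)}\quad\text{for all }A\in\mathcal{A}^{(\infty)},\ g,h\in\mathcal{G};$$ (2) direction probabilities $$\lambda_j(A,g|\boldsymbol{x}_1,\boldsymbol{x}_2)=\frac{Z_j(A,g,\boldsymbol{x}_1,\boldsymbol{x}_2)}{Z(A,g,\boldsymbol{x}_1,\boldsymbol{x}_2)}\quad\text{for all }A\in\mathcal{A}^{(\infty)},\ g\in\{d,m\},\ j=1,\dots,p;$$ (3) pseudo-counts, for all $A\in\mathcal{A}^{(\infty)}$, $j=1,\dots,p$, $i\in\{l,r\}$, $t=1,2$, $$\alpha^j_{t,i}(A,d|\boldsymbol{x}_1,\boldsymbol{x}_2)=\alpha^j_{t,i}(A,d)+n_t(A^j_i),\qquad \alpha^j_{t,i}(A,m|\boldsy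mbol{x}_1,\boldsymbol{x}_2)=\alpha^j_{t,i}(A,m)+n_1(A^j_i)+n_2(A^j_i).$$
   Context: **Partitions.** $\Omega=[0,1)^p$. For a rectangle $A=\prod_{i=1}^p[a_i,b_i)$ and $j\in\{1,\dots,p\}$, $A^j_l$ is the half of $A$ whose $j$th coordinate lies in $[a_j,(a_j+b_j)/2)$ and $A^j_r$ the half whose $j$th coordinate lies in $[(a_j+b_j)/2,b_j)$. $\mathcal{A}^k$ is the set of all subsets obtainable from $\Omega$ by $k$ successive splits of this kind ($\mathcal{A}^0=\{\Omega\}$), $\mathcal{A}^{(k)}=\cup_{i=0}^k\mathcal{A}^i$, $\mathcal{A}^{(\infty)}=\cup_{i\ge0}\mathcal{A}^i$. **DMMT.** Let $\mathcal{G}=\{d,m,s\}$ ("divide", "merge", "stop"). The parameters are: a baseline probability measure $Q_0$ on $\Omega$ with density $q_0=dQ_0/d\mu$ with respect to a dominating measure $\mu$ (e.g. Lebesgue); initial state probabilities $(\rho_{0,d},\rho_{0,m},\rho_{0,s})$ (nonnegative, summing to 1); for each $A\in\mathcal{A}^{(\infty)}$, transition probabilities $\rho_{h,g}(A)\ge0$ ($h,g\in\mathcal{G}$) with $\sum_g\rho_{h,g}(A)=1$, $\rho_{s,d}(A)=\rho_{s,m}(A)=0$, $\rho_{s,s}(A)=1$ (all these together form $\boldsymbol{\rho}$); direction probabilities $\lambda_j(A,g)\ge0$, $g\in\{d,m\}$, $\sum_{j=1}^p\lambda_j(A,g)=1$ (forming $\boldsymbol{\lambda}$); positive pseudo-counts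 $\boldsymbol{\alpha}^j_t(A,d)=(\alpha^j_{t,l}(A,d),\alpha^j_{t,r}(A,d))$, $t=1,2$, and $\boldsymbol{\alpha}^j(A,m)=(\alpha^j_l(A,m),\alpha^j_r(A,m))$, with the convention $\alpha^j_{t,i}(A,m)=\alpha^j_i(A,m)$ for $t=1,2$ (forming $\boldsymbol{\alpha}$). The random pair $(Q_1,Q_2)$ is generated by starting at $A=\Omega$ with $Q_1(\Omega)=Q_2(\Omega)=1$, the state $S(\mathrm{parent}(\Omega))$ of the fictitious parent of $\Omega$ being drawn from $(\rho_{0,d},\rho_{0,m},\rho_{0,s})$, and recursively doing the following (all draws independent given the previous ones) on each node $A$ reached: (i) draw the state $S(A)\in\mathcal{G}$ with $\Pr[S(A)=g\mid S(\mathrm{parent}(A))=h]=\rho_{h,g}(A)$; (ii) if $S(A)=s$, set $Q_1(\cdot|A)=Q_2(\cdot|A)=Q_0(\cdot|A)$ and stop on $A$; if $S(A)=g\in\{d,m\}$, draw a direction $J(A)=j$ with probability $\lambda_j(A,g)$ and split $A$ into $A^j_l,A^j_r$; (iii) if $S(A)=d$, draw independent $Y_t(A)\sim\mathrm{Beta}(\boldsymbol{\alpha}^j_t(A,d))$, $t=1,2$; if $S(A)=m$, draw $Y_1(A)=Y_2(A)\sim\mathrm{Beta}(\boldsymbol{\alpha}^j(A,m))$; set $Q_t(A^j_l)=Q_t(A)Y_t(A)$, $Q_t(A^j_r)=Q_t(A)(1-Y_t(A))$, and apply (i)–(iii) to $A^j_l$ and $A^j_r$. Standing assumption on the prior: there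 is $\delta>0$ with $\rho_{g,s}(A)>\delta$ for all $A\in\mathcal{A}^{(\infty)}$, $g\in\mathcal{G}$; then with probability 1 the procedure stops almost everywhere on $\Omega$ and yields a well-defined pair of probability measures absolutely continuous with respect to $Q_0$. The law of the pair is denoted $\mathrm{DMMT}(\boldsymbol{\rho},\boldsymbol{\lambda},\boldsymbol{\alpha},Q_0)$; the same name is used for the law produced by the procedure with other parameters (such as posterior ones) for which it yields such a pair with probability 1. **Likelihoods.** $q_t=dQ_t/d\mu$ (version given by the construction: $q_t(x)=Q_t(B)q_0(x|B)$ if $x$ lies in a stopped node $B$), $q_t(x|A)=q_t(x)/Q_t(A)$ for $x\in A$, $t=0,1,2$. $q(\boldsymbol{x}_1,\boldsymbol{x}_2|A)=\prod_{t=1,2}\prod_{i:\,x_{t,i}\in A}q_t(x_{t,i}|A)$. The posterior is the prior reweighted by $q(\boldsymbol{x}_1,\boldsymbol{x}_2|\Omega)$ and normalized. $n_t(A)=|\{i: x_{t,i}\in A\}|$, $\boldsymbol{n}^j_t(A)=(n_t(A^j_l),n_t(A^j_r))$, $\boldsymbol{x}_1\cup\boldsymbol{x}_2$ is the pooled sample (with multiplicity), $D(w_1,w_2)=\Gamma(w_1)\Gamma(w_2)/\Gamma(w_1+w_2)$. $\Phi(A,g,\boldsymbol{x}_1,\boldsymbol{x}_2)=\int q(\boldsymbol{x}_1,\boldsymbol{x}_2|A)\,\pi(dQ_1,dQ_2|E_1(A),E_{2,g}(A))$, where $\pi$ is the prior, $E_1(A)=\{A$ arises during the random partitioning$\}$,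 $E_{2,g}(A)=\{S(\mathrm{parent}(A))=g\}$; that is, $\Phi$ is the marginal likelihood of the observations in $A$ under the DMMT with root $A$ (the same procedure started at $A$, with the parameters restricted to $A$ and its descendants and baseline $Q_0(\cdot|A)$) and initial state probability $\rho_{0,g}=1$. Further $$Z_j(A,m,\boldsymbol{x}_1,\boldsymbol{x}_2)=\lambda_j(A,m)\frac{D(\boldsymbol{\alpha}^j(A,m)+\boldsymbol{n}^j_1(A)+\boldsymbol{n}^j_2(A))}{D(\boldsymbol{\alpha}^j(A,m))}\prod_{i\in\{l,r\}}\Phi(A^j_i,m,\boldsymbol{x}_1,\boldsymbol{x}_2),$$ $$Z_j(A,d,\boldsymbol{x}_1,\boldsymbol{x}_2)=\lambda_j(A,d)\prod_{t=1,2}\frac{D(\boldsymbol{\alpha}^j_t(A,d)+\boldsymbol{n}^j_t(A))}{D(\boldsymbol{\alpha}^j_t(A,d))}\prod_{i\in\{l,r\}}\Phi(A^j_i,d,\boldsymbol{x}_1,\boldsymbol{x}_2),$$ $Z(A,g,\boldsymbol{x}_1,\boldsymbol{x}_2)=\sum_{j=1}^pZ_j(A,g,\boldsymbol{x}_1,\boldsymbol{x}_2)$ for $g\in\{d,m\}$, and $Z(A,s,\boldsymbol{x}_1,\boldsymbol{x}_2)=\prod_{x\in\boldsymbol{x}_1\cup\boldsymbol{x}_2,\,x\in A}q_0(x|A)$. *)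

theory Defs
  imports "HOL-Probability.Probability"
begin

section \<open>Dyadic rectangles\<close>

text \<open>
  A rectangle is represented by its corners \<open>(a, b)\<close>; \<open>cell\<close> is the corresponding subset
  \<open>[a\<^sub>1,b\<^sub>1) \<times> \<dots> \<times> [a\<^sub>p,b\<^sub>p)\<close>.  On the rectangles obtained from \<open>[0,1)\<^sup>p\<close> by successive
  halving, all nonempty, \<open>cell\<close> is injective, so that indexing parameters by corners is the same
  as indexing them by subsets.
\<close>

type_synonym 'p rect = "(real^'p) \<times> (real^'p)"

datatype side = Lft | Rgt

definition cell :: "'p::finite rect \<Rightarrow> (real^'p) set" where
  "cell A = {x. \<forall>i. fst A $ i \<le> x $ i \<and> x $ i < snd A $ i}"

definition unit_rect :: "'p::finite rect" where
  "unit_rect = ((\<chi> i. 0), (\<chi> i. 1))"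

definition half :: "'p::finite rect \<Rightarrow> 'p \<Rightarrow> side \<Rightarrow> 'p rect" where
  "half A j i =
     (let c = (fst A $ j + snd A $ j) / 2 in
      case i of
        Lft \<Rightarrow> (fst A, (\<chi> k. if k = j then c else snd A $ k))
      | Rgt \<Rightarrow> ((\<chi> k. if k = j then c else fst A $ k), snd A))"

primrec rects_level :: "nat \<Rightarrow> 'p::finite rect set" where
  "rects_level 0 = {unit_rect}"
| "rects_level (Suc k) = {half A j i | A j i. A \<in> rects_level k}"

definition rects :: "'p::finite rect set" where
  "rects = (\<Union>k. rects_level k)"


section \<open>Parameters\<close>

datatype state = Divide | Merge | Stop

datatype grp = Grp1 | Grp2

lemma UNIV_side: "(UNIV :: side set) = {Lft, Rgt}"
  using side.exhaust by auto

lemma UNIV_state: "(UNIV :: state set) = {Divide, Merge, Stop}"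
  using state.exhaust by auto

lemma UNIV_grp: "(UNIV :: grp set) = {Grp1, Grp2}"
  using grp.exhaust by auto

instance side :: finite by standard (simp add: UNIV_side)
instance state :: finite by standard (simp add: UNIV_state)
instance grp :: finite by standard (simp add: UNIV_grp)

text \<open>
  \<open>trprob \<Theta> A h g\<close> is the probability of moving from parent state \<open>h\<close> to state \<open>g\<close> on \<open>A\<close>,
  \<open>dirp \<Theta> A g j\<close> that of splitting \<open>A\<close> in direction \<open>j\<close> when its state is \<open>g \<noteq> Stop\<close>, and
  \<open>pcount \<Theta> A g t j i\<close> the pseudo-count of side \<open>i\<close> for group \<open>t\<close>.  For \<open>g = Stop\<close> the last two
  are never used; for \<open>g = Merge\<close> the pseudo-count does not depend on \<open>t\<close>.
\<close>

record 'p dmmt_params =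
  trprob :: "'p rect \<Rightarrow> state \<Rightarrow> state \<Rightarrow> real"
  dirp :: "'p rect \<Rightarrow> state \<Rightarrow> 'p \<Rightarrow> real"
  pcount :: "'p rect \<Rightarrow> state \<Rightarrow> grp \<Rightarrow> 'p \<Rightarrow> side \<Rightarrow> real"

definition valid_init :: "(state \<Rightarrow> real) \<Rightarrow> bool" where
  "valid_init \<rho>\<^sub>0 \<longleftrightarrow> (\<forall>g. 0 \<le> \<rho>\<^sub>0 g) \<and> (\<Sum>g\<in>UNIV. \<rho>\<^sub>0 g) = 1"

definition valid_params :: "'p::finite dmmt_params \<Rightarrow> bool" where
  "valid_params \<Theta> \<longleftrightarrow> (\<forall>A\<in>rects.
     (\<forall>h g. 0 \<le> trprob \<Theta> A h g) \<and>
     (\<forall>h. (\<Sum>g\<in>UNIV. trprob \<Theta> A h g) = 1) \<and>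
     trprob \<Theta> A Stop Divide = 0 \<and> trprob \<Theta> A Stop Merge = 0 \<and> trprob \<Theta> A Stop Stop = 1 \<and>
     (\<forall>g\<in>{Divide, Merge}.
        (\<forall>j. 0 \<le> dirp \<Theta> A g j) \<and> (\<Sum>j\<in>UNIV. dirp \<Theta> A g j) = 1 \<and>
        (\<forall>t j i. 0 < pcount \<Theta> A g t j i)) \<and>
     (\<forall>j i. pcount \<Theta> A Merge Grp1 j i = pcount \<Theta> A Merge Grp2 j i))"

definition baseline :: "(real^'p::finite) measure \<Rightarrow> (real^'p \<Rightarrow> real) \<Rightarrow> (real^'p) measure" where
  "baseline \<mu> q\<^sub>0 = density \<mu> (\<lambda>x. ennreal (q\<^sub>0 x))"

text \<open>
  The last clause is what makes \<open>Q\<^sub>0(\<cdot>|A)\<close> meaningful for every rectangle \<open>A\<close> of the partition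
  scheme.
\<close>

definition valid_baseline :: "(real^'p::finite) measure \<Rightarrow> (real^'p \<Rightarrow> real) \<Rightarrow> bool" where
  "valid_baseline \<mu> q\<^sub>0 \<longleftrightarrow>
     sigma_finite_measure \<mu> \<and> sets \<mu> = sets borel \<and>
     q\<^sub>0 \<in> borel_measurable borel \<and> (\<forall>x. 0 \<le> q\<^sub>0 x) \<and>
     prob_space (baseline \<mu> q\<^sub>0) \<and> measure (baseline \<mu> q\<^sub>0) (cell unit_rect) = 1 \<and>
     (\<forall>A\<in>rects. 0 < measure (baseline \<mu> q\<^sub>0) (cell A))"


section \<open>The generative process\<close>

definition beta_measure :: "real \<Rightarrow> real \<Rightarrow> real measure" where
  "beta_measure a b = density lborel (\<lambda>y. ennreal
     (if 0 < y \<and> y < 1 then y powr (a - 1) * (1 - y) powr (b - 1) / Beta a b else 0))"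

text \<open>
  The draws made on a node: its state, its direction and the pair \<open>(Y\<^sub>1, Y\<^sub>2)\<close>, the last two being
  irrelevant placeholders on a stopped node.
\<close>

type_synonym 'p draw = "state \<times> 'p \<times> (grp \<Rightarrow> real)"

definition draw_space :: "'p::finite draw measure" where
  "draw_space = count_space UNIV \<Otimes>\<^sub>M (count_space UNIV \<Otimes>\<^sub>M (\<Pi>\<^sub>M t\<in>UNIV. borel))"

definition draw_split :: "'p::finite dmmt_params \<Rightarrow> 'p rect \<Rightarrow> state \<Rightarrow> 'p \<Rightarrow> (grp \<Rightarrow> real) measure" where
  "draw_split \<Theta> A g j =
     (if g = Divide
      then \<Pi>\<^sub>M t\<in>UNIV. beta_measure (pcount \<Theta> A Divide t j Lft) (pcount \<Theta> A Divide t j Rgt)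
      else distr (beta_measure (pcount \<Theta> A Merge Grp1 j Lft) (pcount \<Theta> A Merge Grp1 j Rgt))
             (\<Pi>\<^sub>M t\<in>UNIV. borel) (\<lambda>y t. y))"

definition node_law :: "'p::finite dmmt_params \<Rightarrow> 'p rect \<Rightarrow> state \<Rightarrow> 'p draw measure" where
  "node_law \<Theta> A h = do {
     g \<leftarrow> point_measure UNIV (\<lambda>g. ennreal (trprob \<Theta> A h g));
     if g = Stop then return draw_space (Stop, undefined, undefined)
     else do {
       j \<leftarrow> point_measure UNIV (\<lambda>j. ennreal (dirp \<Theta> A g j));
       y \<leftarrow> draw_split \<Theta> A g j;
       return draw_space (g, j, y)
     }
   }"

text \<open>
  An outcome consists of the state of the fictitious parent of the starting rectangle and, for each
  rectangle \<open>A\<close> and each state \<open>h\<close>, of the draws to be used on \<open>A\<close> if \<open>A\<close> is reached with parent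
  state \<open>h\<close>; all of these are independent.  Since a rectangle is reached at most once in a given run,
  each entry is used at most once, and the draws on a reached node are therefore conditionally
  independent of the previous ones given the state of its parent.
\<close>

type_synonym 'p outcome = "state \<times> ('p rect \<times> state \<Rightarrow> 'p draw)"

definition process :: "(state \<Rightarrow> real) \<Rightarrow> 'p::finite dmmt_params \<Rightarrow> 'p outcome measure" where
  "process \<rho>\<^sub>0 \<Theta> =
     point_measure UNIV (\<lambda>g. ennreal (\<rho>\<^sub>0 g)) \<Otimes>\<^sub>M
     (\<Pi>\<^sub>M (A, h)\<in>rects \<times> UNIV. node_law \<Theta> A h)"

text \<open>
  \<open>reaches \<omega> R A h m\<close>: the run on outcome \<open>\<omega>\<close> started at rectangle \<open>R\<close> reaches \<open>A\<close>, the parent of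
  \<open>A\<close> has state \<open>h\<close>, and \<open>m t\<close> is the mass \<open>Q\<^sub>t(A)\<close>.
\<close>

inductive reaches ::
    "'p::finite outcome \<Rightarrow> 'p rect \<Rightarrow> 'p rect \<Rightarrow> state \<Rightarrow> (grp \<Rightarrow> real) \<Rightarrow> bool"
  for \<omega> R where
  start: "reaches \<omega> R R (fst \<omega>) (\<lambda>t. 1)"
| split: "reaches \<omega> R A h m \<Longrightarrow> snd \<omega> (A, h) = (g, j, y) \<Longrightarrow> g \<noteq> Stop \<Longrightarrow>
    reaches \<omega> R (half A j i) g (\<lambda>t. m t * (case i of Lft \<Rightarrow> y t | Rgt \<Rightarrow> 1 - y t))"

definition stops :: "'p::finite outcome \<Rightarrow> 'p rect \<Rightarrow> 'p rect \<Rightarrow> (grp \<Rightarrow> real) \<Rightarrow> bool" where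
  "stops \<omega> R B m \<longleftrightarrow> (\<exists>h. reaches \<omega> R B h m \<and> fst (snd \<omega> (B, h)) = Stop)"

definition base_cond :: "(real^'p::finite) measure \<Rightarrow> (real^'p \<Rightarrow> real) \<Rightarrow> 'p rect \<Rightarrow> real^'p \<Rightarrow> real" where
  "base_cond \<mu> q\<^sub>0 A x = q\<^sub>0 x / measure (baseline \<mu> q\<^sub>0) (cell A)"

text \<open>
  The density \<open>q\<^sub>t\<close> for the run started at \<open>R\<close> (with baseline \<open>Q\<^sub>0(\<cdot>|R)\<close>, whose conditional on
  \<open>B \<subseteq> R\<close> is \<open>Q\<^sub>0(\<cdot>|B)\<close>).  The stopped nodes of a run are pairwise disjoint, so the value is
  unique.
\<close>

definition dens ::
    "(real^'p::finite) measure \<Rightarrow> (real^'p \<Rightarrow> real) \<Rightarrow> 'p rect \<Rightarrow> 'p outcome \<Rightarrow> grp \<Rightarrow> real^'p \<Rightarrow> real" where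
  "dens \<mu> q\<^sub>0 R \<omega> t x =
     (if \<exists>B m. stops \<omega> R B m \<and> x \<in> cell B
      then THE v. \<exists>B m. stops \<omega> R B m \<and> x \<in> cell B \<and> v = m t * base_cond \<mu> q\<^sub>0 B x
      else 0)"

definition yields_pair ::
    "(real^'p::finite) measure \<Rightarrow> (real^'p \<Rightarrow> real) \<Rightarrow> 'p outcome \<Rightarrow> bool" where
  "yields_pair \<mu> q\<^sub>0 \<omega> \<longleftrightarrow>
     (AE x in \<mu>. x \<in> cell unit_rect \<longrightarrow> (\<exists>B m. stops \<omega> unit_rect B m \<and> x \<in> cell B)) \<and>
     (\<forall>t. prob_space (density \<mu> (\<lambda>x. ennreal (dens \<mu> q\<^sub>0 unit_rect \<omega> t x))))"

text \<open>
  The pair \<open>(Q\<^sub>1, Q\<^sub>2)\<close>, as a function on the two groups; on the null set of outcomes where the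
  procedure fails it is given the arbitrary value \<open>(Q\<^sub>0, Q\<^sub>0)\<close>.
\<close>

definition dmmt_pair ::
    "(real^'p::finite) measure \<Rightarrow> (real^'p \<Rightarrow> real) \<Rightarrow> 'p outcome \<Rightarrow> grp \<Rightarrow> (real^'p) measure" where
  "dmmt_pair \<mu> q\<^sub>0 \<omega> =
     (\<lambda>t. if yields_pair \<mu> q\<^sub>0 \<omega> then density \<mu> (\<lambda>x. ennreal (dens \<mu> q\<^sub>0 unit_rect \<omega> t x))
          else baseline \<mu> q\<^sub>0)"

definition pair_space :: "(grp \<Rightarrow> (real^'p::finite) measure) measure" where
  "pair_space = (\<Pi>\<^sub>M t\<in>UNIV. prob_algebra borel)"

definition DMMT ::
    "(state \<Rightarrow> real) \<Rightarrow> 'p::finite dmmt_params \<Rightarrow> (real^'p) measure \<Rightarrow> (real^'p \<Rightarrow> real) \<Rightarrow>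
     (grp \<Rightarrow> (real^'p) measure) measure" where
  "DMMT \<rho>\<^sub>0 \<Theta> \<mu> q\<^sub>0 = distr (process \<rho>\<^sub>0 \<Theta>) pair_space (dmmt_pair \<mu> q\<^sub>0)"


section \<open>Likelihoods and posterior\<close>

text \<open>Group \<open>t\<close> of the data consists of the observations \<open>x t i\<close> with \<open>i < n t\<close>.\<close>

definition sample_law ::
    "(grp \<Rightarrow> nat) \<Rightarrow> (grp \<Rightarrow> (real^'p::finite) measure) \<Rightarrow> (grp \<Rightarrow> nat \<Rightarrow> real^'p) measure" where
  "sample_law n Q = (\<Pi>\<^sub>M t\<in>UNIV. \<Pi>\<^sub>M i\<in>{..<n t}. Q t)"

definition ncount :: "(grp \<Rightarrow> nat) \<Rightarrow> (grp \<Rightarrow> nat \<Rightarrow> real^'p::finite) \<Rightarrow> grp \<Rightarrow> 'p rect \<Rightarrow> nat" where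
  "ncount n x t A = card {i. i < n t \<and> x t i \<in> cell A}"

definition lik ::
    "(real^'p::finite) measure \<Rightarrow> (real^'p \<Rightarrow> real) \<Rightarrow> (grp \<Rightarrow> nat) \<Rightarrow> (grp \<Rightarrow> nat \<Rightarrow> real^'p) \<Rightarrow>
     'p rect \<Rightarrow> 'p outcome \<Rightarrow> real" where
  "lik \<mu> q\<^sub>0 n x A \<omega> = (\<Prod>t\<in>UNIV. \<Prod>i | i < n t \<and> x t i \<in> cell A. dens \<mu> q\<^sub>0 A \<omega> t (x t i))"

text \<open>
  The reweighting is carried out on the outcome space, where the version \<open>q\<^sub>t\<close> of the densities
  is defined, before passing to the law of the pair.
\<close>

definition posterior ::
    "(state \<Rightarrow> real) \<Rightarrow> 'p::finite dmmt_params \<Rightarrow> (real^'p) measure \<Rightarrow> (real^'p \<Rightarrow> real) \<Rightarrow>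
     (grp \<Rightarrow> nat) \<Rightarrow> (grp \<Rightarrow> nat \<Rightarrow> real^'p) \<Rightarrow> (grp \<Rightarrow> (real^'p) measure) measure" where
  "posterior \<rho>\<^sub>0 \<Theta> \<mu> q\<^sub>0 n x =
     distr
       (density (process \<rho>\<^sub>0 \<Theta>) (\<lambda>\<omega>. ennreal
          (lik \<mu> q\<^sub>0 n x unit_rect \<omega> / (\<integral>\<omega>'. lik \<mu> q\<^sub>0 n x unit_rect \<omega>' \<partial>process \<rho>\<^sub>0 \<Theta>))))
       pair_space (dmmt_pair \<mu> q\<^sub>0)"

definition Phi ::
    "'p::finite dmmt_params \<Rightarrow> (real^'p) measure \<Rightarrow> (real^'p \<Rightarrow> real) \<Rightarrow>
     (grp \<Rightarrow> nat) \<Rightarrow> (grp \<Rightarrow> nat \<Rightarrow> real^'p) \<Rightarrow> 'p rect \<Rightarrow> state \<Rightarrow> real" where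
  "Phi \<Theta> \<mu> q\<^sub>0 n x A g = (\<integral>\<omega>. lik \<mu> q\<^sub>0 n x A \<omega> \<partial>process (\<lambda>h. of_bool (h = g)) \<Theta>)"

definition Zdir ::
    "'p::finite dmmt_params \<Rightarrow> (real^'p) measure \<Rightarrow> (real^'p \<Rightarrow> real) \<Rightarrow>
     (grp \<Rightarrow> nat) \<Rightarrow> (grp \<Rightarrow> nat \<Rightarrow> real^'p) \<Rightarrow> 'p rect \<Rightarrow> state \<Rightarrow> 'p \<Rightarrow> real" where
  "Zdir \<Theta> \<mu> q\<^sub>0 n x A g j =
     (let N = (\<lambda>t i. real (ncount n x t (half A j i))); \<alpha> = pcount \<Theta> A g in
      dirp \<Theta> A g j *
      (if g = Merge
       then Beta (\<alpha> Grp1 j Lft + N Grp1 Lft + N Grp2 Lft) (\<alpha> Grp1 j Rgt + N Grp1 Rgt + N Grp2 Rgt)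
            / Beta (\<alpha> Grp1 j Lft) (\<alpha> Grp1 j Rgt)
       else \<Prod>t\<in>UNIV. Beta (\<alpha> t j Lft + N t Lft) (\<alpha> t j Rgt + N t Rgt)
            / Beta (\<alpha> t j Lft) (\<alpha> t j Rgt)) *
      (\<Prod>i\<in>UNIV. Phi \<Theta> \<mu> q\<^sub>0 n x (half A j i) g))"

definition Z ::
    "'p::finite dmmt_params \<Rightarrow> (real^'p) measure \<Rightarrow> (real^'p \<Rightarrow> real) \<Rightarrow>
     (grp \<Rightarrow> nat) \<Rightarrow> (grp \<Rightarrow> nat \<Rightarrow> real^'p) \<Rightarrow> 'p rect \<Rightarrow> state \<Rightarrow> real" where
  "Z \<Theta> \<mu> q\<^sub>0 n x A g =
     (if g = Stop
      then \<Prod>t\<in>UNIV. \<Prod>i | i < n t \<and> x t i \<in> cell A. base_cond \<mu> q\<^sub>0 A (x t i)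
      else \<Sum>j\<in>UNIV. Zdir \<Theta> \<mu> q\<^sub>0 n x A g j)"

text \<open>
  Data for which every marginal likelihood \<open>\<Phi>\<close> is finite and positive, so that the posterior
  parameters are defined.  At exceptional points \<open>x\<close> the integral may vanish or diverge, as \<open>q\<^sub>t(x)\<close>
  is unbounded in general.
\<close>

definition regular_data ::
    "'p::finite dmmt_params \<Rightarrow> (real^'p) measure \<Rightarrow> (real^'p \<Rightarrow> real) \<Rightarrow>
     (grp \<Rightarrow> nat) \<Rightarrow> (grp \<Rightarrow> nat \<Rightarrow> real^'p) \<Rightarrow> bool" where
  "regular_data \<Theta> \<mu> q\<^sub>0 n x \<longleftrightarrow>
     (\<forall>t. \<forall>i<n t. x t i \<in> cell unit_rect) \<and>
     (\<forall>A\<in>rects. \<forall>g.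
        integrable (process (\<lambda>h. of_bool (h = g)) \<Theta>) (lik \<mu> q\<^sub>0 n x A) \<and>
        0 < Phi \<Theta> \<mu> q\<^sub>0 n x A g)"

end

theory Submission
  imports Defs
begin

text \<open>
  Conditioning on the draw at a rectangle \<open>A\<close>, the likelihood on \<open>A\<close> is either \<open>Z(A,s)\<close> or a monomial in
  the Beta shares times the likelihoods on the two halves, which depend on disjoint sets of independent
  draws.  By Beta conjugacy this gives \<open>\<Phi>(A,h) = \<Sum>\<^sub>g \<rho>\<^sub>h\<^sub>,\<^sub>g(A) Z(A,g)\<close>, so the posterior parameters are
  probabilities, and their node law is the prior node law reweighted by the factor of \<open>A\<close> and the
  values of \<open>\<Phi>\<close> at the halves, divided by \<open>\<Phi>(A,h)\<close>.  Along a run these factors telescope: for every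
  event \<open>F\<close> restricting finitely many visited nodes, the prior integral of \<open>1\<^sub>F\<close> times the likelihood is
  \<open>\<Phi>\<close> times the posterior probability of \<open>F\<close>.  Such events are closed under intersection and generate
  everything a run determines, so the reweighted prior and the posterior process have the same law of
  runs; in particular almost sure termination passes from the prior to the posterior, for which no
  lower bound on the stopping probabilities is available.

  For almost every data set all \<open>\<Phi>\<close> are positive, because stopping at once has positive probability,
  and finite, because the densities integrate to at most one (Tonelli).
\<close>

section \<open>Dyadic rectangles and runs\<close>

text \<open>The two processes to be compared do not agree on the space of outcomes. Conditionally on
  the run, reweighting by the likelihood leaves the unvisited entries with their prior law, whereas
  the posterior process draws every entry from its posterior law. Equality can therefore be expected
  only on the sigma-algebra of what a run visits, coded as \<open>run_space\<close>. A second
  obstacle is that a run may visit infinitely many nodes, so the ratio of the two laws has no usable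
  form as a product over nodes. For this reason the events considered impose nothing below some
  volume: after finitely many halvings the remaining likelihood, however deep the tree goes,
  integrates to \<open>Phi\<close>. Finally, the normalisation of the posterior parameters is itself
  an instance of the one-step identity, so that identity is established before they are known to be
  probabilities.\<close>

declare split_paired_All [simp del] split_paired_Ex [simp del]

section \<open>Geometry of the dyadic rectangles\<close>

lemma unit_rect_in_rects: "unit_rect \<in> rects"
  unfolding rects_def by (auto intro: exI[of _ 0])

lemma half_in_rects: "A \<in> rects \<Longrightarrow> half A j i \<in> rects"
proof -
  assume "A \<in> rects"
  then obtain k where "A \<in> rects_level k" by (auto simp: rects_def)
  then have "half A j i \<in> rects_level (Suc k)"
    unfolding rects_level.simps by (intro CollectI exI[of _ A] exI[of _ j] exI[of _ i]) simp
  then show ?thesis unfolding rects_def by blast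
qed

lemma rects_induct [consumes 1, case_names unit half]:
  assumes "A \<in> rects" "P unit_rect" "\<And>A j i. A \<in> rects \<Longrightarrow> P A \<Longrightarrow> P (half A j i)"
  shows "P A"
proof -
  have "A \<in> rects_level k \<Longrightarrow> P A" for k
  proof (induction k arbitrary: A)
    case (Suc k)
    then obtain B j i where "B \<in> rects_level k" "A = half B j i" by auto
    moreover have "B \<in> rects" using \<open>B \<in> rects_level k\<close> by (auto simp: rects_def)
    ultimately show ?case using Suc.IH assms(3) by blast
  qed (use assms in auto)
  then show ?thesis using assms(1) by (auto simp: rects_def)
qed

lemma countable_rects: "countable (rects :: 'p::finite rect set)"
proof -
  have "finite (rects_level k :: 'p rect set)" for k
  proof (induction k)
    case (Suc k)
    have "rects_level (Suc k) = (\<Union>A\<in>rects_level k. \<Union>j. \<Union>i. {half A j i :: 'p rect})"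
      unfolding rects_level.simps by blast
    then show ?case using Suc by simp
  qed auto
  then show ?thesis unfolding rects_def by (auto intro: countable_finite)
qed

lemma rects_less: "A \<in> rects \<Longrightarrow> fst A $ i < snd A $ i"
proof (induction rule: rects_induct)
  case unit
  then show ?case by (simp add: unit_rect_def)
next
  case (half A j s)
  then have "fst A $ j < snd A $ j \<or> i \<noteq> j" by auto
  then show ?case using half by (cases s) (auto simp: half_def)
qed

lemma cell_half:
  assumes "A \<in> rects"
  shows "cell (half A j i) = {x \<in> cell A. x $ j < (fst A $ j + snd A $ j) / 2 \<longleftrightarrow> i = Lft}"
proof -
  have *: "fst A $ j < snd A $ j" using assms by (rule rects_less)
  show ?thesis
  proof (cases i)
    case Lft
    have "x \<in> cell (half A j Lft) \<longleftrightarrow> x \<in> cell A \<and> x $ j < (fst A $ j + snd A $ j) / 2" for x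
    proof
      assume x: "x \<in> cell (half A j Lft)"
      have a: "fst A $ k \<le> x $ k" "x $ k < (if k = j then (fst A $ j + snd A $ j) / 2 else snd A $ k)" for k
        using x by (auto simp: cell_def half_def)
      have b: "x $ k < snd A $ k" for k using a(2)[of k] * by (cases "k = j") auto
      show "x \<in> cell A \<and> x $ j < (fst A $ j + snd A $ j) / 2"
        using a(1) b a(2)[of j] by (auto simp: cell_def)
    qed (auto simp: cell_def half_def)
    then show ?thesis using Lft by auto
  next
    case Rgt
    have "x \<in> cell (half A j Rgt) \<longleftrightarrow> x \<in> cell A \<and> \<not> x $ j < (fst A $ j + snd A $ j) / 2" for x
    proof
      assume x: "x \<in> cell (half A j Rgt)"
      have a: "x $ k < snd A $ k" "(if k = j then (fst A $ j + snd A $ j) / 2 else fst A $ k) \<le> x $ k" for k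
        using x by (auto simp: cell_def half_def)
      have b: "fst A $ k \<le> x $ k" for k using a(2)[of k] * by (cases "k = j") auto
      show "x \<in> cell A \<and> \<not> x $ j < (fst A $ j + snd A $ j) / 2"
        using a(1) b a(2)[of j] by (auto simp: cell_def)
    qed (auto simp: cell_def half_def)
    then show ?thesis using Rgt by auto
  qed
qed

lemma cell_half_subset: "A \<in> rects \<Longrightarrow> cell (half A j i) \<subseteq> cell A"
  by (auto simp: cell_half)

lemma cell_half_unique:
  "A \<in> rects \<Longrightarrow> x \<in> cell (half A j i) \<Longrightarrow> x \<in> cell (half A j i') \<Longrightarrow> i = i'"
  by (cases i; cases i') (auto simp: cell_half)

lemma cell_half_cases:
  assumes "A \<in> rects" "x \<in> cell A" obtains i where "x \<in> cell (half A j i)"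
  using assms by (cases "x $ j < (fst A $ j + snd A $ j) / 2") (auto simp: cell_half)

lemma fst_in_cell: "A \<in> rects \<Longrightarrow> fst A \<in> cell A"
  by (auto simp: cell_def rects_less)

text \<open>The opposite half is nonempty. This keeps the entries \<open>(A, h)\<close> out of those
  consulted below either half, which makes the root draw independent of both subtrees.\<close>

lemma cell_not_subset_half: "A \<in> rects \<Longrightarrow> \<not> cell A \<subseteq> cell (half A j i)"
proof
  assume A: "A \<in> rects" and sub: "cell A \<subseteq> cell (half A j i)"
  obtain i' where "i' \<noteq> i" by (metis side.distinct(1))
  have "fst (half A j i') \<in> cell (half A j i')" using A by (intro fst_in_cell half_in_rects)
  then show False using sub cell_half_subset[OF A] cell_half_unique[OF A] \<open>i' \<noteq> i\<close> by blast
qed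

lemma cell_measurable [measurable]: "cell A \<in> sets borel"
  unfolding cell_def by measurable

text \<open>Each halving divides it by two, whatever the direction, so on \<open>rects\<close> it
  encodes the depth, and a lower bound on it bounds the number of splits to be examined.\<close>

definition vol :: "'p::finite rect \<Rightarrow> real" where
  "vol A = (\<Prod>i\<in>UNIV. snd A $ i - fst A $ i)"

lemma vol_half: "vol (half A j i) = vol A / 2"
proof -
  have "(\<Prod>k\<in>UNIV. snd (half A j i) $ k - fst (half A j i) $ k) =
    (\<Prod>k\<in>UNIV. (snd A $ k - fst A $ k) * (if k = j then 1/2 else 1))"
    by (rule prod.cong) (cases i; auto simp: half_def Let_def field_simps)+
  also have "\<dots> = vol A / 2" by (simp add: prod.distrib vol_def)
  finally show ?thesis by (simp add: vol_def)
qed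

lemma vol_pos: "A \<in> rects \<Longrightarrow> 0 < vol A"
  by (auto simp: vol_def rects_less intro!: prod_pos)

text \<open>An upper bound for the entries that a run started at \<open>A\<close> can consult. Being
  stated by inclusion of cells instead of reachability, it does not depend on the outcome, and its
  disjointness for the two halves is that of their cells.\<close>

definition nodes_in :: "'p::finite rect \<Rightarrow> ('p rect \<times> state) set" where
  "nodes_in A = {B \<in> rects. cell B \<subseteq> cell A} \<times> UNIV"

abbreviation all_nodes :: "('p::finite rect \<times> state) set" where
  "all_nodes \<equiv> rects \<times> UNIV"

lemma nodes_in_subset: "nodes_in A \<subseteq> all_nodes"
  by (auto simp: nodes_in_def)

lemma nodes_in_half_disjoint:
  "A \<in> rects \<Longrightarrow> nodes_in (half A j Lft) \<inter> nodes_in (half A j Rgt) = {}"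
proof (rule ccontr)
  assume A: "A \<in> rects" and "nodes_in (half A j Lft) \<inter> nodes_in (half A j Rgt) \<noteq> {}"
  then obtain B where B: "B \<in> rects" "cell B \<subseteq> cell (half A j Lft)" "cell B \<subseteq> cell (half A j Rgt)"
    by (auto simp: nodes_in_def)
  then show False using fst_in_cell[OF B(1)] cell_half_unique[OF A, of _ j Lft Rgt] by auto
qed

lemma root_notin_nodes_in_half: "A \<in> rects \<Longrightarrow> (A, h) \<notin> nodes_in (half A j i)"
  using cell_not_subset_half[of A j i] by (auto simp: nodes_in_def)

section \<open>Runs and what they depend on\<close>

definition share :: "(grp \<Rightarrow> real) \<Rightarrow> side \<Rightarrow> grp \<Rightarrow> real" where
  "share y i t = (case i of Lft \<Rightarrow> y t | Rgt \<Rightarrow> 1 - y t)"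

lemma share_simps [simp]: "share y Lft t = y t" "share y Rgt t = 1 - y t"
  by (auto simp: share_def)

lemma reaches_splitI:
  "reaches \<omega> R A h m \<Longrightarrow> snd \<omega> (A, h) = (g, j, y) \<Longrightarrow> g \<noteq> Stop \<Longrightarrow>
    reaches \<omega> R (half A j i) g (\<lambda>t. m t * share y i t)"
  unfolding share_def by (rule reaches.split)

lemma reaches_in_rects: "reaches \<omega> R B h m \<Longrightarrow> R \<in> rects \<Longrightarrow> B \<in> rects"
  by (induction rule: reaches.induct) (auto intro: half_in_rects)

lemma reaches_subset: "reaches \<omega> R B h m \<Longrightarrow> R \<in> rects \<Longrightarrow> cell B \<subseteq> cell R"
proof (induction rule: reaches.induct)
  case (split A h m g j y i)
  then show ?case using cell_half_subset[OF reaches_in_rects[OF split(1,5)], of j i] by simp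
qed simp

lemma reaches_vol: "reaches \<omega> R B h m \<Longrightarrow> R \<in> rects \<Longrightarrow> vol B \<le> vol R"
proof (induction rule: reaches.induct)
  case (split A h m g j y i)
  have "0 < vol A" using vol_pos[OF reaches_in_rects[OF split(1,5)]] .
  with split show ?case by (simp add: vol_half)
qed auto

lemma reaches_in_nodes_in: "reaches \<omega> R B h m \<Longrightarrow> R \<in> rects \<Longrightarrow> (B, h) \<in> nodes_in R"
  using reaches_in_rects[of \<omega> R B h m] reaches_subset[of \<omega> R B h m] by (simp add: nodes_in_def)

lemma reaches_prepend:
  assumes "reaches \<omega>' (half A j i) B h' m" "fst \<omega>' = g" "snd \<omega>' = \<omega>" "\<omega> (A, h) = (g, j, y)" "g \<noteq> Stop"
  shows "reaches (h, \<omega>) A B h' (\<lambda>t. share y i t * m t)"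
  using assms(1)
proof (induction rule: reaches.induct)
  case start
  show ?case using reaches_splitI[OF reaches.start, of "(h, \<omega>)" A g j y i] assms(2-) by simp
next
  case (split A' h' m' g' j' y' i')
  have "reaches (h, \<omega>) A (half A' j' i') g' (\<lambda>t. (share y i t * m' t) * share y' i' t)"
    using split assms by (intro reaches_splitI[of _ _ _ h' _ g' _ y']) auto
  then show ?case by (simp add: share_def mult.assoc)
qed

text \<open>\<open>reaches\<close> extends a path at its far end, whereas the likelihood is peeled
  off from the root; this lemma passes from one form to the other. The masses agree by associativity
  of the product of shares.\<close>

lemma reaches_first_step:
  "reaches (h, \<omega>) A B h' m \<longleftrightarrow>
     B = A \<and> h' = h \<and> m = (\<lambda>t. 1) \<or>
     (\<exists>g j y i m'. \<omega> (A, h) = (g, j, y) \<and> g \<noteq> Stop \<and> reaches (g, \<omega>) (half A j i) B h' m' \<and>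
       m = (\<lambda>t. share y i t * m' t))" (is "?L \<longleftrightarrow> ?R")
proof
  assume ?L
  then show ?R
  proof (induction rule: reaches.induct)
    case start
    then show ?case by simp
  next
    case (split A' h' m g j y i)
    show ?case
    proof (cases "A' = A \<and> h' = h \<and> m = (\<lambda>t. 1)")
      case True
      with split have "\<omega> (A, h) = (g, j, y)" "g \<noteq> Stop" by auto
      moreover have "reaches (g, \<omega>) (half A j i) (half A j i) g (\<lambda>t. 1)"
        using reaches.start[of "(g, \<omega>)"] by simp
      ultimately show ?thesis using True
        by (auto simp: share_def intro!: exI[of _ i] exI[of _ "\<lambda>t. 1"])
    next
      case False
      with split.IH obtain g0 j0 y0 i0 m0 where *: "\<omega> (A, h) = (g0, j0, y0)" "g0 \<noteq> Stop"
        "reaches (g0, \<omega>) (half A j0 i0) A' h' m0" "m = (\<lambda>t. share y0 i0 t * m0 t)" by auto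
      have "reaches (g0, \<omega>) (half A j0 i0) (half A' j i) g (\<lambda>t. m0 t * share y i t)"
        using * split by (intro reaches_splitI[of _ _ _ h']) auto
      then show ?thesis using *
        by (auto simp: share_def mult.assoc intro!: exI[of _ i0] exI[of _ "\<lambda>t. m0 t * share y i t"])
    qed
  qed
next
  assume ?R
  then show ?L
  proof (elim disjE exE conjE)
    assume "B = A" "h' = h" "m = (\<lambda>t. 1)"
    then show ?L using reaches.start[of "(h, \<omega>)" A] by simp
  next
    fix g j y i m'
    assume "\<omega> (A, h) = (g, j, y)" "g \<noteq> Stop" "reaches (g, \<omega>) (half A j i) B h' m'"
      "m = (\<lambda>t. share y i t * m' t)"
    then show ?L using reaches_prepend[of "(g, \<omega>)" A j i B h' m' g \<omega> h y] by simp
  qed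
qed

text \<open>Agreement is asked only at nodes reached by \<open>\<omega>\<close>. It suffices for the
  converse as well: by induction a node reached by \<open>\<omega>'\<close> is also reached by
  \<open>\<omega>\<close>, so its draw is covered.\<close>

lemma reaches_cong:
  assumes "fst \<omega> = fst \<omega>'"
    and "\<And>B h m. reaches \<omega> R B h m \<Longrightarrow> snd \<omega> (B, h) = snd \<omega>' (B, h)"
  shows "reaches \<omega> R B h m \<longleftrightarrow> reaches \<omega>' R B h m"
proof
  assume "reaches \<omega> R B h m"
  then show "reaches \<omega>' R B h m"
  proof (induction rule: reaches.induct)
    case start
    show ?case using reaches.start[of \<omega>' R] assms(1) by simp
  next
    case (split A h m g j y i)
    then show ?case using assms(2) by (intro reaches.split[of _ _ _ h]) auto
  qed
next
  assume "reaches \<omega>' R B h m"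
  then show "reaches \<omega> R B h m"
  proof (induction rule: reaches.induct)
    case start
    show ?case using reaches.start[of \<omega> R] assms(1) by simp
  next
    case (split A h m g j y i)
    then show ?case using assms(2) by (intro reaches.split[of _ _ _ h]) auto
  qed
qed

text \<open>Equality up to unvisited entries. Everything that the procedure outputs is invariant
  under it, which later allows the passage to the sigma-algebra of runs.\<close>

definition same_run :: "'p::finite rect \<Rightarrow> 'p outcome \<Rightarrow> 'p outcome \<Rightarrow> bool" where
  "same_run R \<omega> \<omega>' \<longleftrightarrow> fst \<omega> = fst \<omega>' \<and>
     (\<forall>B h m. reaches \<omega> R B h m \<longrightarrow> snd \<omega> (B, h) = snd \<omega>' (B, h))"

lemma same_run_reaches: "same_run R \<omega> \<omega>' \<Longrightarrow> reaches \<omega> R = reaches \<omega>' R"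
  unfolding same_run_def by (intro ext reaches_cong) auto

lemma same_run_stops: "same_run R \<omega> \<omega>' \<Longrightarrow> stops \<omega> R = stops \<omega>' R"
  using same_run_reaches[of R \<omega> \<omega>'] unfolding stops_def same_run_def
  by (auto simp: fun_eq_iff) metis+

lemma same_run_dens: "same_run R \<omega> \<omega>' \<Longrightarrow> dens \<mu> q\<^sub>0 R \<omega> = dens \<mu> q\<^sub>0 R \<omega>'"
  unfolding dens_def by (simp add: same_run_stops cong: if_cong)

lemma same_run_lik: "same_run R \<omega> \<omega>' \<Longrightarrow> lik \<mu> q\<^sub>0 n x R \<omega> = lik \<mu> q\<^sub>0 n x R \<omega>'"
  unfolding lik_def by (simp add: same_run_dens)

lemma same_run_yields_pair:
  "same_run unit_rect \<omega> \<omega>' \<Longrightarrow> yields_pair \<mu> q\<^sub>0 \<omega> = yields_pair \<mu> q\<^sub>0 \<omega>'"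
  unfolding yields_pair_def by (simp add: same_run_dens same_run_stops)

lemma same_run_dmmt_pair:
  "same_run unit_rect \<omega> \<omega>' \<Longrightarrow> dmmt_pair \<mu> q\<^sub>0 \<omega> = dmmt_pair \<mu> q\<^sub>0 \<omega>'"
  unfolding dmmt_pair_def by (simp add: same_run_dens same_run_yields_pair cong: if_cong)

lemma same_run_nodes_in:
  "R \<in> rects \<Longrightarrow> (\<And>b. b \<in> nodes_in R \<Longrightarrow> \<omega> b = \<omega>' b) \<Longrightarrow> same_run R (h, \<omega>) (h, \<omega>')"
  using reaches_in_nodes_in by (fastforce simp: same_run_def)

text \<open>The first-step form of \<open>stops\<close>, on which one can induct from the root.\<close>

inductive stops_from ::
  "('p::finite rect \<times> state \<Rightarrow> 'p draw) \<Rightarrow> 'p rect \<Rightarrow> state \<Rightarrow> 'p rect \<Rightarrow> (grp \<Rightarrow> real) \<Rightarrow> bool"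
  for \<omega> where
  stop: "fst (\<omega> (A, h)) = Stop \<Longrightarrow> stops_from \<omega> A h A (\<lambda>t. 1)"
| step: "\<omega> (A, h) = (g, j, y) \<Longrightarrow> g \<noteq> Stop \<Longrightarrow> stops_from \<omega> (half A j i) g B m \<Longrightarrow>
    stops_from \<omega> A h B (\<lambda>t. share y i t * m t)"

lemma reaches_stops_from:
  assumes "reaches \<omega>' R B h m" "stops_from (snd \<omega>') B h B' m'"
  shows "stops_from (snd \<omega>') R (fst \<omega>') B' (\<lambda>t. m t * m' t)"
  using assms
proof (induction arbitrary: m' rule: reaches.induct)
  case (split A h m g j y i)
  have "stops_from (snd \<omega>') A h B' (\<lambda>t. share y i t * m' t)"
    using split by (intro stops_from.step) auto
  from split.IH[OF this] show ?case by (simp add: share_def mult.assoc)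
qed auto

lemma stops_iff: "stops (h, \<omega>) R B m \<longleftrightarrow> stops_from \<omega> R h B m"
proof
  assume "stops (h, \<omega>) R B m"
  then obtain h' where "reaches (h, \<omega>) R B h' m" "fst (\<omega> (B, h')) = Stop" by (auto simp: stops_def)
  then show "stops_from \<omega> R h B m"
    using reaches_stops_from[of "(h, \<omega>)" R B h' m B "\<lambda>t. 1"] by (auto intro: stops_from.stop)
next
  assume "stops_from \<omega> R h B m"
  then show "stops (h, \<omega>) R B m"
  proof (induction rule: stops_from.induct)
    case (stop A h)
    then show ?case using reaches.start[of "(h, \<omega>)" A] by (auto simp: stops_def)
  next
    case (step A h g j y i B m)
    then show ?case unfolding stops_def using reaches_prepend[of "(g, \<omega>)" A j i B _ m g \<omega> h y] by auto
  qed
qed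

lemma stops_from_subset: "stops_from \<omega> A h B m \<Longrightarrow> A \<in> rects \<Longrightarrow> B \<in> rects \<and> cell B \<subseteq> cell A"
proof (induction rule: stops_from.induct)
  case (step A h g j y i B m)
  then show ?case using half_in_rects[of A j i] cell_half_subset[of A j i] by auto
qed simp

text \<open>Two paths from the root read the same draw at each common node, so they can part only by
  taking different sides; their end cells then lie in opposite halves and share no point. Hence the
  definite description in \<open>dens\<close> is well defined.\<close>

lemma stops_from_unique:
  assumes "stops_from \<omega> A h B m" "stops_from \<omega> A h B' m'" "A \<in> rects" "x \<in> cell B" "x \<in> cell B'"
  shows "B = B' \<and> m = m'"
  using assms
proof (induction arbitrary: B' m' rule: stops_from.induct)
  case (stop A h)
  from stop(2,1) show ?case by cases auto
next
  case (step A h g j y i B m)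
  from step(5) show ?case
  proof cases
    case stop
    then show ?thesis using step by simp
  next
    case *: (step g' j' y' i' m'')
    have eq: "g' = g" "j' = j" "y' = y" using *(2) step(1) by auto
    have h: "half A j i \<in> rects" "half A j i' \<in> rects" using step by (auto intro: half_in_rects)
    have s': "stops_from \<omega> (half A j i') g B' m''" using *(4) eq by simp
    have "x \<in> cell (half A j i)" "x \<in> cell (half A j i')"
      using stops_from_subset[OF step(3) h(1)] stops_from_subset[OF s' h(2)] step.prems(3,4) by auto
    then have "i = i'" by (rule cell_half_unique[OF step.prems(2)])
    then have "B = B' \<and> m = m''" using step.IH[of B' m''] s' h step.prems(3,4) by simp
    then show ?thesis using *(1) eq \<open>i = i'\<close> by simp
  qed
qed

section \<open>The density at a point and its truncations\<close>

lemma dens_eq: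
  assumes "stops_from \<omega> A h B m" "A \<in> rects" "x \<in> cell B"
  shows "dens \<mu> q\<^sub>0 A (h, \<omega>) t x = m t * base_cond \<mu> q\<^sub>0 B x"
proof -
  have "(THE v. \<exists>B m. stops (h, \<omega>) A B m \<and> x \<in> cell B \<and> v = m t * base_cond \<mu> q\<^sub>0 B x)
     = m t * base_cond \<mu> q\<^sub>0 B x"
    using assms stops_from_unique[OF assms(1) _ assms(2,3)] unfolding stops_iff
    by (intro the_equality) blast+
  then show ?thesis using assms by (auto simp: dens_def stops_iff)
qed

lemma dens_eq_0: "(\<And>B m. stops_from \<omega> A h B m \<Longrightarrow> x \<notin> cell B) \<Longrightarrow> dens \<mu> q\<^sub>0 A (h, \<omega>) t x = 0"
  by (auto simp: dens_def stops_iff)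

lemma dens_stop:
  assumes "A \<in> rects" "x \<in> cell A" "fst (\<omega> (A, h)) = Stop"
  shows "dens \<mu> q\<^sub>0 A (h, \<omega>) t x = base_cond \<mu> q\<^sub>0 A x"
  using dens_eq[OF stops_from.stop[of \<omega> A h] assms(1,2)] assms(3) by simp

text \<open>The path to the stopped node containing \<open>x\<close> runs through the half
  containing \<open>x\<close> and picks up one share there. If no stopped node below that half
  contains \<open>x\<close>, none below \<open>A\<close> does, and both sides vanish.\<close>

lemma dens_split:
  assumes "A \<in> rects" "\<omega> (A, h) = (g, j, y)" "g \<noteq> Stop" "x \<in> cell (half A j i)"
  shows "dens \<mu> q\<^sub>0 A (h, \<omega>) t x = share y i t * dens \<mu> q\<^sub>0 (half A j i) (g, \<omega>) t x"
proof (cases "\<exists>B m. stops_from \<omega> (half A j i) g B m \<and> x \<in> cell B")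
  case True
  then obtain B m where B: "stops_from \<omega> (half A j i) g B m" "x \<in> cell B" by auto
  have "dens \<mu> q\<^sub>0 A (h, \<omega>) t x = (share y i t * m t) * base_cond \<mu> q\<^sub>0 B x"
    using dens_eq[OF stops_from.step[of \<omega> A h g j y i B m] assms(1) B(2)] assms(2,3) B(1) by simp
  also have "\<dots> = share y i t * dens \<mu> q\<^sub>0 (half A j i) (g, \<omega>) t x"
    using dens_eq[OF B(1) half_in_rects[OF assms(1)] B(2)] by simp
  finally show ?thesis .
next
  case False
  have "x \<notin> cell B" if "stops_from \<omega> A h B m" for B m
    using that
  proof cases
    case stop
    then show ?thesis using assms by simp
  next
    case (step g' j' y' i' m')
    then have eq: "g' = g" "j' = j" using assms by auto
    show ?thesis
    proof
      assume x: "x \<in> cell B"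
      have "x \<in> cell (half A j i')"
        using stops_from_subset[OF step(4)] half_in_rects[OF assms(1)] eq x by auto
      then have "i' = i" using assms cell_half_unique by blast
      then show False using False step eq x by auto
    qed
  qed
  then have "dens \<mu> q\<^sub>0 A (h, \<omega>) t x = 0" by (rule dens_eq_0)
  moreover have "dens \<mu> q\<^sub>0 (half A j i) (g, \<omega>) t x = 0" using False by (intro dens_eq_0) auto
  ultimately show ?thesis by simp
qed

text \<open>A finite-depth replacement for the existence of a stopped node containing
  \<open>x\<close>; as a recursion it can be proved measurable level by level. Index
  \<open>k\<close> allows fewer than \<open>k\<close> splits, so \<open>k = 1\<close> inspects the
  root only.\<close>

primrec stopped_by :: "nat \<Rightarrow> 'p::finite rect \<Rightarrow> state \<Rightarrow> ('p rect \<times> state \<Rightarrow> 'p draw) \<Rightarrow> real^'p \<Rightarrow> bool" where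
  "stopped_by 0 A h \<omega> x = False"
| "stopped_by (Suc k) A h \<omega> x = (x \<in> cell A \<and> (fst (\<omega> (A, h)) = Stop \<or>
     (\<exists>i. stopped_by k (half A (fst (snd (\<omega> (A, h)))) i) (fst (\<omega> (A, h))) \<omega> x)))"

lemma stopped_by_mono: "stopped_by k A h \<omega> x \<Longrightarrow> k \<le> l \<Longrightarrow> stopped_by l A h \<omega> x"
proof (induction k arbitrary: A h l)
  case (Suc k)
  then obtain l' where l: "l = Suc l'" "k \<le> l'" by (cases l) auto
  show ?case using Suc.prems Suc.IH[OF _ l(2)] unfolding l(1) stopped_by.simps by blast
qed auto

lemma ex_stops_iff:
  assumes "A \<in> rects"
  shows "(\<exists>B m. stops (h, \<omega>) A B m \<and> x \<in> cell B) \<longleftrightarrow> (\<exists>k. stopped_by k A h \<omega> x)"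
proof (intro iffI; elim exE conjE)
  fix B m assume "stops (h, \<omega>) A B m" "x \<in> cell B"
  then have "stops_from \<omega> A h B m" by (simp add: stops_iff)
  then show "\<exists>k. stopped_by k A h \<omega> x" using assms \<open>x \<in> cell B\<close>
  proof (induction rule: stops_from.induct)
    case (stop A h)
    then show ?case by (intro exI[of _ 1]) auto
  next
    case (step A h g j y i B m)
    have h: "half A j i \<in> rects" using step by (auto intro: half_in_rects)
    have "x \<in> cell A"
      using stops_from_subset[OF step(3) h] cell_half_subset[OF step(5)] step by blast
    moreover obtain k where "stopped_by k (half A j i) g \<omega> x" using step h by auto
    ultimately show ?case using step by (intro exI[of _ "Suc k"]) auto
  qed
next
  fix k assume "stopped_by k A h \<omega> x"
  then have "\<exists>B m. stops_from \<omega> A h B m \<and> x \<in> cell B"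
  proof (induction k arbitrary: A h)
    case (Suc k)
    obtain g j y where z: "\<omega> (A, h) = (g, j, y)" by (cases "\<omega> (A, h)") auto
    show ?case
    proof (cases "g = Stop")
      case True
      then show ?thesis using Suc.prems z stops_from.stop[of \<omega> A h] by auto
    next
      case False
      then obtain i where "stopped_by k (half A j i) g \<omega> x" using Suc.prems z by auto
      then show ?thesis using Suc.IH stops_from.step[of \<omega> A h g j y i] z False by blast
    qed
  qed simp
  then show "\<exists>B m. stops (h, \<omega>) A B m \<and> x \<in> cell B" by (simp add: stops_iff)
qed

text \<open>Only points settled within fewer than \<open>k\<close> splits count, and there the value
  is already the final one. At every point the sequence in \<open>k\<close> is therefore eventually
  constant.\<close>

definition tdens where
  "tdens \<mu> q\<^sub>0 k A h \<omega> t x = (if stopped_by k A h \<omega> x then dens \<mu> q\<^sub>0 A (h, \<omega>) t x else 0)"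

lemma tdens_0: "tdens \<mu> q\<^sub>0 0 A h \<omega> t x = 0"
  by (simp add: tdens_def)

lemma stopped_by_subset: "stopped_by k A h \<omega> x \<Longrightarrow> x \<in> cell A"
  by (cases k) auto

text \<open>At most one side contains \<open>x\<close>, so the sum has at most one nonzero term. As
  a sum it is linear in the truncations below, which suits both measurability and integration over
  \<open>x\<close>.\<close>

lemma tdens_Suc:
  assumes "A \<in> rects"
  shows "tdens \<mu> q\<^sub>0 (Suc k) A h \<omega> t x =
    (case \<omega> (A, h) of (g, j, y) \<Rightarrow>
      if g = Stop then indicator (cell A) x * base_cond \<mu> q\<^sub>0 A x
      else \<Sum>i\<in>UNIV. share y i t * tdens \<mu> q\<^sub>0 k (half A j i) g \<omega> t x)"
proof -
  obtain g j y where z: "\<omega> (A, h) = (g, j, y)" by (cases "\<omega> (A, h)") auto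
  show ?thesis
  proof (cases "g = Stop")
    case True
    then show ?thesis using z dens_stop[OF assms, of x \<omega> h] by (auto simp: tdens_def indicator_def)
  next
    case g: False
    show ?thesis
    proof (cases "x \<in> cell A")
      case False
      then have "x \<notin> cell (half A j i)" for i using cell_half_subset[OF assms] by blast
      then have "tdens \<mu> q\<^sub>0 k (half A j i) g \<omega> t x = 0" for i
        using stopped_by_subset[of k "half A j i" g \<omega> x] by (auto simp: tdens_def)
      then show ?thesis using False z g by (simp add: tdens_def)
    next
      case True
      obtain i where i: "x \<in> cell (half A j i)" using cell_half_cases[OF assms True] .
      have i': "x \<notin> cell (half A j i')" if "i' \<noteq> i" for i' using cell_half_unique[OF assms] i that by blast
      have "tdens \<mu> q\<^sub>0 k (half A j i') g \<omega> t x = 0" if "i' \<noteq> i" for i'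
        using stopped_by_subset[of k "half A j i'" g \<omega> x] i'[OF that] by (auto simp: tdens_def)
      then have "(\<Sum>i\<in>UNIV. share y i t * tdens \<mu> q\<^sub>0 k (half A j i) g \<omega> t x) =
        share y i t * tdens \<mu> q\<^sub>0 k (half A j i) g \<omega> t x"
        by (subst sum.remove[of _ i]) (auto intro!: sum.neutral)
      moreover have "(\<exists>i'. stopped_by k (half A j i') g \<omega> x) \<longleftrightarrow> stopped_by k (half A j i) g \<omega> x"
        using i' stopped_by_subset by metis
      ultimately show ?thesis using z g True dens_split[of A \<omega> h g j y x i, OF assms z g i]
        by (auto simp: tdens_def)
    qed
  qed
qed

lemma tdens_tendsto:
  assumes "A \<in> rects"
  shows "(\<lambda>k. tdens \<mu> q\<^sub>0 k A h \<omega> t x) \<longlonglongrightarrow> dens \<mu> q\<^sub>0 A (h, \<omega>) t x"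
proof (cases "\<exists>k. stopped_by k A h \<omega> x")
  case True
  then obtain k where "stopped_by k A h \<omega> x" by auto
  then have "tdens \<mu> q\<^sub>0 l A h \<omega> t x = dens \<mu> q\<^sub>0 A (h, \<omega>) t x" if "k \<le> l" for l
    using stopped_by_mono[of k A h \<omega> x l] that by (simp add: tdens_def)
  then have "eventually (\<lambda>l. tdens \<mu> q\<^sub>0 l A h \<omega> t x = dens \<mu> q\<^sub>0 A (h, \<omega>) t x) sequentially"
    unfolding eventually_sequentially by blast
  then show ?thesis by (rule tendsto_eventually)
next
  case False
  then have "dens \<mu> q\<^sub>0 A (h, \<omega>) t x = 0"
    using ex_stops_iff[OF assms, of h \<omega> x] by (intro dens_eq_0) (auto simp: stops_iff)
  with False show ?thesis by (simp add: tdens_def)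
qed

lemma lik_stop:
  assumes "A \<in> rects" "fst (\<omega> (A, h)) = Stop"
  shows "lik \<mu> q\<^sub>0 n x A (h, \<omega>) = Z \<Theta> \<mu> q\<^sub>0 n x A Stop"
  using dens_stop[of A _ \<omega> h] assms by (auto simp: lik_def Z_def intro!: prod.cong)

text \<open>The observations in \<open>A\<close> are partitioned by the two halves and each
  contributes exactly one share by \<open>dens_split\<close>; equal shares collect into powers given
  by the counts.\<close>

lemma lik_split:
  assumes "A \<in> rects" "\<omega> (A, h) = (g, j, y)" "g \<noteq> Stop"
  shows "lik \<mu> q\<^sub>0 n x A (h, \<omega>) =
    (\<Prod>t\<in>UNIV. y t ^ ncount n x t (half A j Lft) * (1 - y t) ^ ncount n x t (half A j Rgt)) *
    lik \<mu> q\<^sub>0 n x (half A j Lft) (g, \<omega>) * lik \<mu> q\<^sub>0 n x (half A j Rgt) (g, \<omega>)"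
proof -
  let ?S = "\<lambda>t i. {k. k < n t \<and> x t k \<in> cell (half A j i)}"
  have S: "{k. k < n t \<and> x t k \<in> cell A} = ?S t Lft \<union> ?S t Rgt" for t
    using cell_half_subset[OF assms(1)] cell_half_cases[OF assms(1)]
    by (auto; metis side.exhaust)
  have disj: "?S t Lft \<inter> ?S t Rgt = {}" for t using cell_half_unique[OF assms(1)] by blast
  have half: "(\<Prod>k\<in>?S t i. dens \<mu> q\<^sub>0 A (h, \<omega>) t (x t k)) =
    share y i t ^ ncount n x t (half A j i) * (\<Prod>k\<in>?S t i. dens \<mu> q\<^sub>0 (half A j i) (g, \<omega>) t (x t k))" for t i
  proof -
    have "(\<Prod>k\<in>?S t i. dens \<mu> q\<^sub>0 A (h, \<omega>) t (x t k)) =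
      (\<Prod>k\<in>?S t i. share y i t * dens \<mu> q\<^sub>0 (half A j i) (g, \<omega>) t (x t k))"
      by (rule prod.cong) (use dens_split[of A \<omega> h g j y _ i] assms in auto)
    then show ?thesis by (simp add: prod.distrib ncount_def)
  qed
  have "(\<Prod>k | k < n t \<and> x t k \<in> cell A. dens \<mu> q\<^sub>0 A (h, \<omega>) t (x t k)) =
    (\<Prod>k\<in>?S t Lft. dens \<mu> q\<^sub>0 A (h, \<omega>) t (x t k)) * (\<Prod>k\<in>?S t Rgt. dens \<mu> q\<^sub>0 A (h, \<omega>) t (x t k))" for t
    unfolding S using disj by (intro prod.union_disjoint) auto
  then show ?thesis unfolding lik_def half by (simp add: prod.distrib mult_ac)
qed

section \<open>The law of the draws on a node\<close>

text \<open>Checked on boxes, whose indicator is the product of the coordinate indicators, so that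
  Tonelli factors the integral. Used for independent Beta shares and again for independent
  samples.\<close>

lemma PiM_density:
  fixes M :: "'i \<Rightarrow> 'a measure"
  assumes I: "finite I" and M: "\<And>i. sigma_finite_measure (M i)"
    and D: "\<And>i. sigma_finite_measure (density (M i) (f i))"
    and f: "\<And>i. i \<in> I \<Longrightarrow> f i \<in> borel_measurable (M i)"
  shows "PiM I (\<lambda>i. density (M i) (f i)) = density (PiM I M) (\<lambda>x. \<Prod>i\<in>I. f i (x i))"
proof -
  interpret M: product_sigma_finite M by (rule product_sigma_finite.intro) (rule M)
  interpret D: product_sigma_finite "\<lambda>i. density (M i) (f i)" by (rule product_sigma_finite.intro) (rule D)
  have meas: "(\<lambda>x. \<Prod>i\<in>I. f i (x i)) \<in> borel_measurable (PiM I M)"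
    using f by (auto intro!: borel_measurable_prod measurable_compose[OF measurable_component_singleton])
  show ?thesis
  proof (rule D.PiM_eqI[OF I, symmetric])
    show "sets (density (PiM I M) (\<lambda>x. \<Prod>i\<in>I. f i (x i))) = sets (Pi\<^sub>M I (\<lambda>i. density (M i) (f i)))"
      by (simp cong: sets_PiM_cong)
    fix A assume A: "\<And>i. i \<in> I \<Longrightarrow> A i \<in> sets (density (M i) (f i))"
    then have A': "\<And>i. i \<in> I \<Longrightarrow> A i \<in> sets (M i)" by simp
    have "emeasure (density (PiM I M) (\<lambda>x. \<Prod>i\<in>I. f i (x i))) (Pi\<^sub>E I A) =
      (\<integral>\<^sup>+x. (\<Prod>i\<in>I. f i (x i)) * indicator (Pi\<^sub>E I A) x \<partial>PiM I M)"
      using A' I meas by (intro emeasure_density) (auto intro!: sets_PiM_I_finite)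
    also have "\<dots> = (\<integral>\<^sup>+x. (\<Prod>i\<in>I. f i (x i) * indicator (A i) (x i)) \<partial>PiM I M)"
    proof (rule nn_integral_cong)
      fix x assume x: "x \<in> space (PiM I M)"
      have "indicator (Pi\<^sub>E I A) x = (\<Prod>i\<in>I. indicator (A i) (x i) :: ennreal)"
        using x I by (auto simp: indicator_def space_PiM PiE_iff prod_zero_iff intro!: prod.neutral)
      then show "(\<Prod>i\<in>I. f i (x i)) * indicator (Pi\<^sub>E I A) x = (\<Prod>i\<in>I. f i (x i) * indicator (A i) (x i))"
        by (simp add: prod.distrib)
    qed
    also have "\<dots> = (\<Prod>i\<in>I. \<integral>\<^sup>+x. f i x * indicator (A i) x \<partial>M i)"
      using A' f I by (intro M.product_nn_integral_prod) auto
    also have "\<dots> = (\<Prod>i\<in>I. emeasure (density (M i) (f i)) (A i))"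
      using A' f by (intro prod.cong) (auto simp: emeasure_density)
    finally show "emeasure (density (PiM I M) (\<lambda>x. \<Prod>i\<in>I. f i (x i))) (Pi\<^sub>E I A) =
      (\<Prod>i\<in>I. emeasure (density (M i) (f i)) (A i))" .
  qed
qed

lemma sets_beta_measure [simp, measurable_cong]: "sets (beta_measure a b) = sets borel"
  by (simp add: beta_measure_def)

lemma space_beta_measure [simp]: "space (beta_measure a b) = UNIV"
  by (simp add: beta_measure_def)

lemma Beta_real_pos: "0 < a \<Longrightarrow> 0 < b \<Longrightarrow> 0 < Beta a (b::real)"
  by (simp add: Beta_def Gamma_real_pos)

lemma prob_space_beta_measure:
  assumes "0 < a" "0 < b"
  shows "prob_space (beta_measure a b)"
proof
  have B: "0 < Beta a b" using assms by (rule Beta_real_pos)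
  have "((\<lambda>t. t powr (a - 1) * (1 - t) powr (b - 1)) has_integral Beta a b) {0<..<1}"
    using has_integral_Beta_real[OF assms] by (simp add: has_integral_Icc_iff_Ioo)
  then have int: "((\<lambda>t. t powr (a - 1) * (1 - t) powr (b - 1) / Beta a b) has_integral 1) {0<..<1}"
    using has_integral_divide[of _ "Beta a b" "{0<..<1}" "Beta a b"] B by simp
  have "emeasure (beta_measure a b) (space (beta_measure a b)) =
    (\<integral>\<^sup>+y. ennreal (if 0 < y \<and> y < 1 then y powr (a - 1) * (1 - y) powr (b - 1) / Beta a b else 0) \<partial>lborel)"
    unfolding beta_measure_def by (simp add: emeasure_density)
  also have "\<dots> = (\<integral>\<^sup>+y. ennreal (y powr (a - 1) * (1 - y) powr (b - 1) / Beta a b) * indicator {0<..<1} y \<partial>lborel)"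
    by (rule nn_integral_cong) (auto simp: indicator_def)
  also have "\<dots> = ennreal 1"
    using int B by (intro nn_integral_has_integral_lebesgue') auto
  finally show "emeasure (beta_measure a b) (space (beta_measure a b)) = 1" by simp
qed

lemma AE_beta_measure: "AE y in beta_measure a b. 0 < y \<and> y < 1"
  unfolding beta_measure_def by (subst AE_density) auto

text \<open>The likelihood of \<open>m\<close> left and \<open>n\<close> right moves only raises the
  exponents of the Beta density; the ratio of normalising constants is the factor that
  remains.\<close>

lemma beta_measure_add_counts:
  assumes "0 < a" "0 < b"
  shows "density (beta_measure a b) (\<lambda>y. ennreal (y ^ m * (1 - y) ^ n)) =
    density (beta_measure (a + real m) (b + real n)) (\<lambda>y. ennreal (Beta (a + real m) (b + real n) / Beta a b))"
proof -
  have B: "0 < Beta a b" "0 < Beta (a + real m) (b + real n)"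
    using assms by (auto intro!: Beta_real_pos add_pos_nonneg)
  \<comment> \<open>Merging real and natural powers needs positive bases; outside the open unit
    interval both densities vanish.\<close>
  have pow: "y powr (a - 1) * (1 - y) powr (b - 1) * (y ^ m * (1 - y) ^ n) =
    y powr (a + real m - 1) * (1 - y) powr (b + real n - 1)" if "0 < y" "y < 1" for y :: real
    using that by (simp add: powr_realpow[symmetric] powr_add[symmetric] algebra_simps powr_diff)
  have eq: "ennreal (if 0 < y \<and> y < 1 then y powr (a - 1) * (1 - y) powr (b - 1) / Beta a b else 0) *
      ennreal (y ^ m * (1 - y) ^ n) =
    ennreal (if 0 < y \<and> y < 1 then y powr (a + real m - 1) * (1 - y) powr (b + real n - 1) /
      Beta (a + real m) (b + real n) else 0) * ennreal (Beta (a + real m) (b + real n) / Beta a b)" for y :: real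
  proof (cases "0 < y \<and> y < 1")
    case True
    have "y powr (a - 1) * (1 - y) powr (b - 1) / Beta a b * (y ^ m * (1 - y) ^ n) =
      y powr (a + real m - 1) * (1 - y) powr (b + real n - 1) / Beta a b"
      using pow[of y] True by (simp add: field_simps)
    then show ?thesis using True B
      by (simp add: ennreal_mult''[symmetric])
  qed auto
  show ?thesis
    unfolding beta_measure_def
    by (subst (1 2) density_density_eq) (auto simp: eq)
qed

lemma nn_integral_beta_measure_add_counts:
  assumes "0 < a" "0 < b" "f \<in> borel_measurable borel"
  shows "(\<integral>\<^sup>+y. f y * ennreal (y ^ m * (1 - y) ^ n) \<partial>beta_measure a b) =
    ennreal (Beta (a + real m) (b + real n) / Beta a b) * (\<integral>\<^sup>+y. f y \<partial>beta_measure (a + real m) (b + real n))"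
proof -
  have "(\<integral>\<^sup>+y. f y * ennreal (y ^ m * (1 - y) ^ n) \<partial>beta_measure a b) =
    (\<integral>\<^sup>+y. f y \<partial>density (beta_measure a b) (\<lambda>y. ennreal (y ^ m * (1 - y) ^ n)))"
    using assms by (subst nn_integral_density) (auto simp: mult.commute measurable_cong_sets[OF sets_beta_measure refl])
  also have "\<dots> = ennreal (Beta (a + real m) (b + real n) / Beta a b) * (\<integral>\<^sup>+y. f y \<partial>beta_measure (a + real m) (b + real n))"
    unfolding beta_measure_add_counts[OF assms(1,2)]
    using assms by (subst nn_integral_density) (auto simp: nn_integral_cmult measurable_cong_sets[OF sets_beta_measure refl])
  finally show ?thesis .
qed

abbreviation split_space :: "(grp \<Rightarrow> real) measure" where
  "split_space \<equiv> \<Pi>\<^sub>M t\<in>UNIV. borel"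

lemma sets_draw_split [simp, measurable_cong]: "sets (draw_split \<Theta> A g j) = sets split_space"
  by (auto simp: draw_split_def cong: sets_PiM_cong)

lemma space_split_space [simp]: "space split_space = UNIV"
  by (auto simp: space_PiM)

lemma space_draw_split [simp]: "space (draw_split \<Theta> A g j) = UNIV"
  using sets_eq_imp_space_eq[OF sets_draw_split, of \<Theta> A g j] by simp

lemma measurable_diag: "(\<lambda>y (t::grp). y) \<in> borel \<rightarrow>\<^sub>M split_space"
  by (rule measurable_PiM_single') auto

lemma prob_space_draw_split:
  assumes "g \<noteq> Stop" "\<And>t i. 0 < pcount \<Theta> A g t j i"
  shows "prob_space (draw_split \<Theta> A g j)"
proof (cases g)
  case Divide
  then show ?thesis using assms by (auto simp: draw_split_def intro!: prob_space_PiM prob_space_beta_measure)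
next
  case Merge
  then have "prob_space (beta_measure (pcount \<Theta> A Merge Grp1 j Lft) (pcount \<Theta> A Merge Grp1 j Rgt))"
    using assms by (intro prob_space_beta_measure) auto
  then show ?thesis using Merge
    by (auto simp: draw_split_def measurable_diag measurable_cong_sets[OF sets_beta_measure refl]
        intro!: prob_space.prob_space_distr)
qed (use assms in auto)

text \<open>Since \<open>ennreal\<close> sends negative reals to 0, products of shares may be moved
  through it only where the shares have the right sign, that is, off a null set. The Merge case
  reduces to one Beta variable by the diagonal map.\<close>

lemma AE_draw_split:
  assumes "g \<noteq> Stop" "\<And>t i. 0 < pcount \<Theta> A g t j i"
  shows "AE y in draw_split \<Theta> A g j. \<forall>t. 0 < y t \<and> y t < 1"
proof (cases g)
  case Divide
  let ?B = "\<lambda>t. beta_measure (pcount \<Theta> A Divide t j Lft) (pcount \<Theta> A Divide t j Rgt)"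
  have P: "prob_space (?B t)" for t using assms Divide by (intro prob_space_beta_measure) auto
  have "AE y in PiM UNIV ?B. 0 < y t \<and> y t < 1" for t
    by (intro AE_PiM_component[where P="\<lambda>y. 0 < y \<and> y < 1"] P AE_beta_measure) auto
  then have "AE y in PiM UNIV ?B. \<forall>t. 0 < y t \<and> y t < 1" by (subst AE_all_countable) blast
  moreover have "draw_split \<Theta> A g j = PiM UNIV ?B" using Divide by (simp add: draw_split_def)
  ultimately show ?thesis by (simp only:)
next
  case Merge
  let ?B = "beta_measure (pcount \<Theta> A Merge Grp1 j Lft) (pcount \<Theta> A Merge Grp1 j Rgt)"
  have meas: "{y \<in> space split_space. \<forall>t. 0 < y t \<and> y t < 1} \<in> sets split_space" by measurable
  have "AE y in distr ?B split_space (\<lambda>y t. y). \<forall>t. 0 < y t \<and> y t < 1"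
    using AE_beta_measure[of "pcount \<Theta> A Merge Grp1 j Lft" "pcount \<Theta> A Merge Grp1 j Rgt"]
    meas by (subst AE_distr_iff) (simp_all add: measurable_diag measurable_cong_sets[OF sets_beta_measure refl])
  moreover have "draw_split \<Theta> A g j = distr ?B split_space (\<lambda>y t. y)"
    using Merge by (simp add: draw_split_def)
  ultimately show ?thesis by (simp only:)
qed (use assms in auto)

definition split_lik :: "(grp \<Rightarrow> side \<Rightarrow> nat) \<Rightarrow> (grp \<Rightarrow> real) \<Rightarrow> real" where
  "split_lik N y = (\<Prod>t\<in>UNIV. y t ^ N t Lft * (1 - y t) ^ N t Rgt)"

lemma split_lik_measurable [measurable]: "split_lik N \<in> borel_measurable split_space"
  unfolding split_lik_def by measurable

text \<open>The Beta-binomial marginal of the left/right pattern with the shares integrated out,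
  free of binomial coefficients because the observations are labelled. Under Merge both groups have
  the same share, so their counts are pooled.\<close>

definition beta_ratio :: "'p::finite dmmt_params \<Rightarrow> 'p rect \<Rightarrow> state \<Rightarrow> 'p \<Rightarrow> (grp \<Rightarrow> side \<Rightarrow> nat) \<Rightarrow> real" where
  "beta_ratio \<Theta> A g j N =
     (let \<alpha> = pcount \<Theta> A g in
      if g = Merge
       then Beta (\<alpha> Grp1 j Lft + N Grp1 Lft + N Grp2 Lft) (\<alpha> Grp1 j Rgt + N Grp1 Rgt + N Grp2 Rgt)
            / Beta (\<alpha> Grp1 j Lft) (\<alpha> Grp1 j Rgt)
       else \<Prod>t\<in>UNIV. Beta (\<alpha> t j Lft + N t Lft) (\<alpha> t j Rgt + N t Rgt)
            / Beta (\<alpha> t j Lft) (\<alpha> t j Rgt))"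

lemma beta_ratio_pos:
  assumes "\<And>t i. 0 < pcount \<Theta> A g t j i"
  shows "0 < beta_ratio \<Theta> A g j N"
  using assms unfolding beta_ratio_def Let_def
  by (auto intro!: prod_pos divide_pos_pos Beta_real_pos add_pos_nonneg)

text \<open>Conjugacy for both kinds of split. Under Divide the weight factors over the groups and
  each Beta law absorbs its own factor; under Merge a single Beta law absorbs the factors of both
  groups. The test function \<open>f\<close> lets the identity serve every event on the
  draw.\<close>

lemma nn_integral_draw_split_conjugate:
  assumes g: "g \<noteq> Stop" and pos: "\<And>t i. 0 < pcount \<Theta> A g t j i"
    and div: "\<And>t i. pcount \<Theta>' A Divide t j i = pcount \<Theta> A Divide t j i + real (N t i)"
    and mrg: "\<And>t i. pcount \<Theta>' A Merge t j i = pcount \<Theta> A Merge t j i + real (N Grp1 i) + real (N Grp2 i)"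
    and f [measurable]: "f \<in> borel_measurable split_space"
  shows "(\<integral>\<^sup>+y. f y * ennreal (split_lik N y) \<partial>draw_split \<Theta> A g j) =
    ennreal (beta_ratio \<Theta> A g j N) * (\<integral>\<^sup>+y. f y \<partial>draw_split \<Theta>' A g j)"
proof (cases g)
  case Divide
  let ?a = "\<lambda>t. pcount \<Theta> A Divide t j Lft" and ?b = "\<lambda>t. pcount \<Theta> A Divide t j Rgt"
  let ?B = "\<lambda>t. beta_measure (?a t) (?b t)"
  let ?B' = "\<lambda>t. beta_measure (?a t + real (N t Lft)) (?b t + real (N t Rgt))"
  let ?w = "\<lambda>t y. ennreal (y ^ N t Lft * (1 - y) ^ N t Rgt)"
  let ?c = "\<lambda>t. Beta (?a t + real (N t Lft)) (?b t + real (N t Rgt)) / Beta (?a t) (?b t)"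
  have pos': "0 < ?a t" "0 < ?b t" for t using pos Divide by auto
  have c: "0 < ?c t" for t using pos' by (auto intro!: divide_pos_pos Beta_real_pos add_pos_nonneg)
  have P: "prob_space (?B t)" "prob_space (?B' t)" for t
    using pos' by (auto intro!: prob_space_beta_measure add_pos_nonneg)
  have eq: "density (?B t) (?w t) = density (?B' t) (\<lambda>_. ennreal (?c t))" for t
    by (rule beta_measure_add_counts[OF pos'])
  interpret B': prob_space "?B' t" for t by (rule P)
  \<comment> \<open>The reweighted Beta laws are finite but not normalised, and
    \<open>PiM_density\<close> asks for their sigma-finiteness.\<close>
  have fin: "sigma_finite_measure (density (?B' t) (\<lambda>_. ennreal (?c t)))" for t
    by (intro finite_measure.axioms(1) finite_measureI)
      (simp add: emeasure_density nn_integral_cmult B'.emeasure_space_1[simplified])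
  have P_sf: "sigma_finite_measure (?B t)" "sigma_finite_measure (?B' t)" for t
    using P prob_space_imp_sigma_finite by blast+
  have sB: "sets (PiM UNIV ?B) = sets split_space" "sets (PiM UNIV ?B') = sets split_space"
    by (rule sets_PiM_cong; simp)+
  have [measurable]: "f \<in> borel_measurable (PiM UNIV ?B)" "f \<in> borel_measurable (PiM UNIV ?B')"
    using f by (simp_all only: measurable_cong_sets[OF sB(1) refl] measurable_cong_sets[OF sB(2) refl])
  have w_meas: "?w t \<in> borel_measurable (?B t)" for t
    by (simp add: measurable_cong_sets[OF sets_beta_measure refl])
  have W: "(\<lambda>y. \<Prod>t\<in>UNIV. ?w t (y t)) \<in> borel_measurable (PiM UNIV ?B)"
    unfolding measurable_cong_sets[OF sB(1) refl] by measurable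
  have w: "ennreal (split_lik N y) = (\<Prod>t\<in>UNIV. ?w t (y t))" if "\<forall>t. 0 < y t \<and> y t < 1" for y
  proof -
    have "0 \<le> y t ^ N t Lft * (1 - y t) ^ N t Rgt" for t
      using that[rule_format, of t] by simp
    then show ?thesis unfolding split_lik_def by (intro prod_ennreal[symmetric])
  qed
  \<comment> \<open>Almost surely all shares lie strictly between 0 and 1, which lets
    \<open>ennreal\<close> be distributed over the product of the two groups.\<close>
  have "AE y in draw_split \<Theta> A g j. f y * ennreal (split_lik N y) = f y * (\<Prod>t\<in>UNIV. ?w t (y t))"
    using AE_draw_split[of g \<Theta> A j, OF g pos] by eventually_elim (rule arg_cong[OF w])
  then have "(\<integral>\<^sup>+y. f y * ennreal (split_lik N y) \<partial>draw_split \<Theta> A g j) =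
      (\<integral>\<^sup>+y. f y * (\<Prod>t\<in>UNIV. ?w t (y t)) \<partial>draw_split \<Theta> A g j)"
    by (rule nn_integral_cong_AE)
  also have "\<dots> = (\<integral>\<^sup>+y. f y * (\<Prod>t\<in>UNIV. ?w t (y t)) \<partial>PiM UNIV ?B)"
    using Divide by (simp add: draw_split_def)
  also have "\<dots> = (\<integral>\<^sup>+y. f y \<partial>density (PiM UNIV ?B) (\<lambda>y. \<Prod>t\<in>UNIV. ?w t (y t)))"
    by (subst nn_integral_density[OF W]) (simp_all add: mult.commute)
  also have "density (PiM UNIV ?B) (\<lambda>y. \<Prod>t\<in>UNIV. ?w t (y t)) = PiM UNIV (\<lambda>t. density (?B t) (?w t))"
    by (rule PiM_density[of UNIV ?B ?w, symmetric]) (simp, rule P_sf(1), simp only: eq fin, rule w_meas)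
  also have "\<dots> = density (PiM UNIV ?B') (\<lambda>y. \<Prod>t\<in>UNIV. ennreal (?c t))"
    unfolding eq by (rule PiM_density[of UNIV ?B' "\<lambda>t _. ennreal (?c t)"])
      (use P_sf(2) fin in simp_all)
  also have "(\<integral>\<^sup>+y. f y \<partial>\<dots>) = (\<Prod>t\<in>UNIV. ennreal (?c t)) * (\<integral>\<^sup>+y. f y \<partial>PiM UNIV ?B')"
    by (subst nn_integral_density) (auto simp: nn_integral_cmult)
  also have "(\<Prod>t\<in>UNIV. ennreal (?c t)) = ennreal (beta_ratio \<Theta> A g j N)"
    using Divide c by (simp add: beta_ratio_def Let_def prod_ennreal less_imp_le)
  also have "PiM UNIV ?B' = draw_split \<Theta>' A g j"
    using Divide div by (simp add: draw_split_def)
  finally show ?thesis .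
next
  case Merge
  let ?a = "pcount \<Theta> A Merge Grp1 j Lft" and ?b = "pcount \<Theta> A Merge Grp1 j Rgt"
  have pos': "0 < ?a" "0 < ?b" using pos Merge by auto
  let ?k = "N Grp1 Lft + N Grp2 Lft" and ?l = "N Grp1 Rgt + N Grp2 Rgt"
  have distr: "(\<integral>\<^sup>+y. F y \<partial>distr (beta_measure u v) split_space (\<lambda>y t. y)) =
      (\<integral>\<^sup>+y. F (\<lambda>t. y) \<partial>beta_measure u v)" if "F \<in> borel_measurable split_space" for F u v
    using measurable_diag unfolding measurable_cong_sets[OF sets_beta_measure refl, of u v, symmetric]
    by (rule nn_integral_distr) (simp add: that)
  have law: "draw_split \<Theta> A g j = distr (beta_measure ?a ?b) split_space (\<lambda>y t. y)"
    "draw_split \<Theta>' A g j = distr (beta_measure (?a + real ?k) (?b + real ?l)) split_space (\<lambda>y t. y)"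
    using Merge mrg by (simp_all add: draw_split_def add.assoc)
  have "(\<integral>\<^sup>+y. f y * ennreal (split_lik N y) \<partial>draw_split \<Theta> A g j) =
      (\<integral>\<^sup>+y. f (\<lambda>t. y) * ennreal (split_lik N (\<lambda>t. y)) \<partial>beta_measure ?a ?b)"
  proof -
    have F: "(\<lambda>y. f y * ennreal (split_lik N y)) \<in> borel_measurable split_space"
      by (intro borel_measurable_times_ennreal f measurable_compose[OF split_lik_measurable measurable_ennreal])
    show ?thesis unfolding law(1) by (rule distr[OF F])
  qed
  \<comment> \<open>On the diagonal the powers of the two groups have a common base, so their
    exponents add up to the pooled counts.\<close>
  also have "\<dots> = (\<integral>\<^sup>+y. f (\<lambda>t. y) * ennreal (y ^ ?k * (1 - y) ^ ?l) \<partial>beta_measure ?a ?b)"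
    by (intro nn_integral_cong) (simp add: split_lik_def UNIV_grp power_add mult.assoc mult.left_commute)
  also have "\<dots> = ennreal (Beta (?a + real ?k) (?b + real ?l) / Beta ?a ?b) *
    (\<integral>\<^sup>+y. f (\<lambda>t. y) \<partial>beta_measure (?a + real ?k) (?b + real ?l))"
    by (rule nn_integral_beta_measure_add_counts[OF pos', of "\<lambda>y. f (\<lambda>t. y)"])
      (rule measurable_compose[OF measurable_diag f])
  also have "(\<integral>\<^sup>+y. f (\<lambda>t. y) \<partial>beta_measure (?a + real ?k) (?b + real ?l)) = (\<integral>\<^sup>+y. f y \<partial>draw_split \<Theta>' A g j)"
    unfolding law(2) by (rule distr[OF f, symmetric])
  also have "Beta (?a + real ?k) (?b + real ?l) / Beta ?a ?b = beta_ratio \<Theta> A g j N"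
    using Merge by (simp add: beta_ratio_def Let_def add.assoc)
  finally show ?thesis .
qed (use g in auto)

section \<open>The node law as a finite mixture\<close>

lemma space_draw_space: "space draw_space = UNIV"
  by (auto simp: draw_space_def space_pair_measure)

lemma measurable_draw_Pair [measurable]: "(\<lambda>y. (g, j, y)) \<in> split_space \<rightarrow>\<^sub>M draw_space"
  unfolding draw_space_def by measurable

definition valid_node :: "'p::finite dmmt_params \<Rightarrow> 'p rect \<Rightarrow> bool" where
  "valid_node \<Theta> A \<longleftrightarrow>
     (\<forall>h g. 0 \<le> trprob \<Theta> A h g) \<and>
     (\<forall>h. (\<Sum>g\<in>UNIV. trprob \<Theta> A h g) = 1) \<and>
     (\<forall>g\<in>{Divide, Merge}.
        (\<forall>j. 0 \<le> dirp \<Theta> A g j) \<and> (\<Sum>j\<in>UNIV. dirp \<Theta> A g j) = 1 \<and>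
        (\<forall>t j i. 0 < pcount \<Theta> A g t j i))"

lemma valid_params_node: "valid_params \<Theta> \<Longrightarrow> A \<in> rects \<Longrightarrow> valid_node \<Theta> A"
  by (auto simp: valid_params_def valid_node_def)

lemma prob_space_point_measure:
  assumes "\<And>a::'a::finite. 0 \<le> f a" "(\<Sum>a\<in>UNIV. f a) = 1"
  shows "prob_space (point_measure UNIV (\<lambda>a. ennreal (f a)))"
  using assms by (intro prob_spaceI) (simp add: emeasure_point_measure_finite space_point_measure)

lemma valid_node_kernels:
  assumes "valid_node \<Theta> A"
  shows "point_measure UNIV (\<lambda>g. ennreal (trprob \<Theta> A h g)) \<in> space (prob_algebra (count_space UNIV))"
    and "g \<noteq> Stop \<Longrightarrow> point_measure UNIV (\<lambda>j. ennreal (dirp \<Theta> A g j)) \<in> space (prob_algebra (count_space UNIV))"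
    and "g \<noteq> Stop \<Longrightarrow> draw_split \<Theta> A g j \<in> space (prob_algebra split_space)"
proof -
  have "g \<noteq> Stop \<Longrightarrow> g \<in> {Divide, Merge}" using state.exhaust by auto
  then show "point_measure UNIV (\<lambda>g. ennreal (trprob \<Theta> A h g)) \<in> space (prob_algebra (count_space UNIV))"
    "g \<noteq> Stop \<Longrightarrow> point_measure UNIV (\<lambda>j. ennreal (dirp \<Theta> A g j)) \<in> space (prob_algebra (count_space UNIV))"
    "g \<noteq> Stop \<Longrightarrow> draw_split \<Theta> A g j \<in> space (prob_algebra split_space)"
    using assms unfolding space_prob_algebra valid_node_def
    by (auto intro!: prob_space_point_measure prob_space_draw_split simp: sets_point_measure)
qed

definition dir_law :: "'p::finite dmmt_params \<Rightarrow> 'p rect \<Rightarrow> state \<Rightarrow> 'p draw measure" where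
  "dir_law \<Theta> A g = do {
     j \<leftarrow> point_measure UNIV (\<lambda>j. ennreal (dirp \<Theta> A g j));
     y \<leftarrow> draw_split \<Theta> A g j;
     return draw_space (g, j, y)
   }"

lemma dir_law_kernel:
  assumes "valid_node \<Theta> A" "g \<noteq> Stop"
  shows "(\<lambda>j. draw_split \<Theta> A g j \<bind> (\<lambda>y. return draw_space (g, j, y))) \<in>
      count_space UNIV \<rightarrow>\<^sub>M prob_algebra draw_space"
    and "dir_law \<Theta> A g \<in> space (prob_algebra draw_space)"
proof -
  have ret: "(\<lambda>y. return draw_space (g, j, y)) \<in> split_space \<rightarrow>\<^sub>M prob_algebra draw_space" for j
    by (rule measurable_compose[OF measurable_draw_Pair measurable_return_prob_space])
  have "draw_split \<Theta> A g j \<bind> (\<lambda>y. return draw_space (g, j, y)) \<in> space (prob_algebra draw_space)" for j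
    using prob_space_bind'[OF valid_node_kernels(3)[OF assms, of j] ret]
      sets_bind'[OF valid_node_kernels(3)[OF assms, of j] ret]
    by (simp add: space_prob_algebra)
  then show k: "(\<lambda>j. draw_split \<Theta> A g j \<bind> (\<lambda>y. return draw_space (g, j, y))) \<in>
      count_space UNIV \<rightarrow>\<^sub>M prob_algebra draw_space" by auto
  show "dir_law \<Theta> A g \<in> space (prob_algebra draw_space)"
    using prob_space_bind'[OF valid_node_kernels(2)[OF assms] k] sets_bind'[OF valid_node_kernels(2)[OF assms] k]
    by (simp add: space_prob_algebra dir_law_def)
qed

lemma node_law_alt:
  "node_law \<Theta> A h = point_measure UNIV (\<lambda>g. ennreal (trprob \<Theta> A h g)) \<bind>
     (\<lambda>g. if g = Stop then return draw_space (Stop, undefined, undefined) else dir_law \<Theta> A g)"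
  unfolding node_law_def dir_law_def ..

lemma node_law_kernel:
  assumes "valid_node \<Theta> A"
  shows "(\<lambda>g. if g = Stop then return draw_space (Stop, undefined, undefined) else dir_law \<Theta> A g) \<in>
      count_space UNIV \<rightarrow>\<^sub>M prob_algebra draw_space"
    and "node_law \<Theta> A h \<in> space (prob_algebra draw_space)"
proof -
  have "return draw_space (Stop, undefined, undefined) \<in> space (prob_algebra (draw_space :: 'a draw measure))"
    by (auto simp: space_prob_algebra space_draw_space intro!: prob_space_return)
  then show k: "(\<lambda>g. if g = Stop then return draw_space (Stop, undefined, undefined) else dir_law \<Theta> A g) \<in>
      count_space UNIV \<rightarrow>\<^sub>M prob_algebra draw_space"
    using dir_law_kernel(2)[OF assms] by auto
  show "node_law \<Theta> A h \<in> space (prob_algebra draw_space)"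
    using prob_space_bind'[OF valid_node_kernels(1)[OF assms] k] sets_bind'[OF valid_node_kernels(1)[OF assms] k]
    by (simp add: space_prob_algebra node_law_alt)
qed

lemma prob_space_node_law: "valid_node \<Theta> A \<Longrightarrow> prob_space (node_law \<Theta> A h)"
  and sets_node_law: "valid_node \<Theta> A \<Longrightarrow> sets (node_law \<Theta> A h) = sets draw_space"
  using node_law_kernel(2)[of \<Theta> A h] by (simp_all add: space_prob_algebra)

text \<open>State and direction range over finite sets, so the iterated bind becomes a finite sum
  and only the law of the shares remains an integral.\<close>

lemma nn_integral_node_law:
  assumes v: "valid_node \<Theta> A" and f [measurable]: "f \<in> borel_measurable draw_space"
  shows "(\<integral>\<^sup>+z. f z \<partial>node_law \<Theta> A h) =
    ennreal (trprob \<Theta> A h Stop) * f (Stop, undefined, undefined) +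
    (\<Sum>g\<in>{Divide, Merge}. \<Sum>j\<in>UNIV. ennreal (trprob \<Theta> A h g * dirp \<Theta> A g j) *
      (\<integral>\<^sup>+y. f (g, j, y) \<partial>draw_split \<Theta> A g j))"
proof -
  have 1: "(\<integral>\<^sup>+z. f z \<partial>(draw_split \<Theta> A g j \<bind> (\<lambda>y. return draw_space (g, j, y)))) =
    (\<integral>\<^sup>+y. f (g, j, y) \<partial>draw_split \<Theta> A g j)" for g j
    by (subst nn_integral_bind[OF f])
      (auto simp: nn_integral_return space_draw_space measurable_cong_sets[OF sets_draw_split refl]
        intro!: measurable_compose[OF measurable_draw_Pair return_measurable])
  have 2: "(\<integral>\<^sup>+z. f z \<partial>dir_law \<Theta> A g) = (\<Sum>j\<in>UNIV. ennreal (dirp \<Theta> A g j) * (\<integral>\<^sup>+y. f (g, j, y) \<partial>draw_split \<Theta> A g j))"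
    if "g \<noteq> Stop" for g
    unfolding dir_law_def using measurable_prob_algebraD[OF dir_law_kernel(1)[OF v that]]
    by (subst nn_integral_bind[OF f]) (auto simp: nn_integral_point_measure_finite 1)
  have "(\<integral>\<^sup>+z. f z \<partial>node_law \<Theta> A h) = (\<Sum>g\<in>UNIV. ennreal (trprob \<Theta> A h g) *
    (\<integral>\<^sup>+z. f z \<partial>(if g = Stop then return draw_space (Stop, undefined, undefined) else dir_law \<Theta> A g)))"
    unfolding node_law_alt using measurable_prob_algebraD[OF node_law_kernel(1)[OF v]]
    by (subst nn_integral_bind[OF f]) (auto simp: nn_integral_point_measure_finite)
  also have "\<dots> = ennreal (trprob \<Theta> A h Stop) * f (Stop, undefined, undefined) +
    (\<Sum>g\<in>{Divide, Merge}. ennreal (trprob \<Theta> A h g) * (\<Sum>j\<in>UNIV. ennreal (dirp \<Theta> A g j) * (\<integral>\<^sup>+y. f (g, j, y) \<partial>draw_split \<Theta> A g j)))"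
    by (simp add: UNIV_state 2 nn_integral_return space_draw_space add_ac)
  finally show ?thesis using v
    by (simp add: sum_distrib_left ennreal_mult valid_node_def mult.assoc)
qed

section \<open>Independence and measurability\<close>

abbreviation node_space :: "('p::finite rect \<times> state \<Rightarrow> 'p draw) measure" where
  "node_space \<equiv> \<Pi>\<^sub>M b\<in>all_nodes. draw_space"

definition draws :: "'p::finite dmmt_params \<Rightarrow> ('p rect \<times> state \<Rightarrow> 'p draw) measure" where
  "draws \<Theta> = (\<Pi>\<^sub>M (A, h)\<in>all_nodes. node_law \<Theta> A h)"

lemma sets_draws:
  assumes "valid_params \<Theta>"
  shows "sets (draws \<Theta>) = sets node_space"
  unfolding draws_def using assms
  by (intro sets_PiM_cong) (auto simp: sets_node_law valid_params_node)

lemma space_draws: "valid_params \<Theta> \<Longrightarrow> space (draws \<Theta>) = space node_space"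
  by (rule sets_eq_imp_space_eq[OF sets_draws])

lemma measurable_draws_iff: "valid_params \<Theta> \<Longrightarrow> measurable (draws \<Theta>) N = measurable node_space N"
  by (rule measurable_cong_sets[OF sets_draws refl])

lemma prob_space_draws: "valid_params \<Theta> \<Longrightarrow> prob_space (draws \<Theta>)"
  unfolding draws_def by (rule prob_space_PiM) (auto intro: prob_space_node_law valid_params_node)

lemma measurable_node_coord:
  "b \<in> all_nodes \<Longrightarrow> (\<lambda>\<omega>. \<omega> b) \<in> node_space \<rightarrow>\<^sub>M draw_space"
  by (rule measurable_component_singleton)

lemma distr_draws_coord:
  assumes v: "valid_params \<Theta>" and A: "A \<in> rects"
  shows "distr (draws \<Theta>) draw_space (\<lambda>\<omega>. \<omega> (A, h)) = node_law \<Theta> A h"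
proof -
  have "distr (draws \<Theta>) (node_law \<Theta> A h) (\<lambda>\<omega>. \<omega> (A, h)) = node_law \<Theta> A h"
    unfolding draws_def using distr_PiM_component[of all_nodes "\<lambda>(A, h). node_law \<Theta> A h" "(A, h)"] A v
    by (auto intro: prob_space_node_law valid_params_node)
  moreover have "distr (draws \<Theta>) draw_space (\<lambda>\<omega>. \<omega> (A, h)) = distr (draws \<Theta>) (node_law \<Theta> A h) (\<lambda>\<omega>. \<omega> (A, h))"
    using A v by (intro distr_cong) (auto simp: sets_node_law valid_params_node)
  ultimately show ?thesis by simp
qed

text \<open>Independence of the coordinates amounts to the joint law being the product of the
  marginals, and here the joint law is such a product by construction.\<close>

lemma indep_draws_coords:
  fixes \<Theta> :: "'p::finite dmmt_params"
  assumes v: "valid_params \<Theta>"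
  shows "prob_space.indep_vars (draws \<Theta>) (\<lambda>_. draw_space) (\<lambda>b \<omega>. \<omega> b) all_nodes"
proof -
  interpret prob_space "draws \<Theta>" by (rule prob_space_draws[OF v])
  have ne: "(all_nodes :: ('p rect \<times> state) set) \<noteq> {}" using unit_rect_in_rects by auto
  have "distr (draws \<Theta>) node_space (\<lambda>\<omega>. \<lambda>b\<in>all_nodes. \<omega> b) = distr (draws \<Theta>) (draws \<Theta>) (\<lambda>\<omega>. \<omega>)"
    using sets_draws[OF v] by (intro distr_cong) (auto simp: space_draws[OF v] space_PiM)
  also have "\<dots> = draws \<Theta>" by (rule distr_id)
  also have "\<dots> = (\<Pi>\<^sub>M b\<in>all_nodes. distr (draws \<Theta>) draw_space (\<lambda>\<omega>. \<omega> b))"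
    by (subst draws_def, rule PiM_cong) (auto simp: distr_draws_coord[OF v])
  finally show ?thesis
    using ne measurable_node_coord
    by (subst indep_vars_iff_distr_eq_PiM') (auto simp: measurable_draws_iff[OF v])
qed

text \<open>The root entry and the entries below the two halves form three disjoint blocks of
  independent draws, so the expectation of a product of functions of the separate blocks
  factors.\<close>

lemma nn_integral_draws_first_step:
  fixes \<Theta> :: "'p::finite dmmt_params"
  assumes v: "valid_params \<Theta>" and A: "A \<in> rects" and f [measurable]: "f \<in> borel_measurable draw_space"
    and G: "\<And>i. G i \<in> borel_measurable node_space"
    and dep: "\<And>i \<omega> \<omega>'. (\<And>b. b \<in> nodes_in (half A j i) \<Longrightarrow> \<omega> b = \<omega>' b) \<Longrightarrow> G i \<omega> = G i \<omega>'"
  shows "(\<integral>\<^sup>+\<omega>. f (\<omega> (A, h)) * (\<Prod>i\<in>UNIV. G i \<omega>) \<partial>draws \<Theta>) =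
    (\<integral>\<^sup>+z. f z \<partial>node_law \<Theta> A h) * (\<Prod>i\<in>UNIV. \<integral>\<^sup>+\<omega>. G i \<omega> \<partial>draws \<Theta>)"
proof -
  interpret prob_space "draws \<Theta>" by (rule prob_space_draws[OF v])
  \<comment> \<open>\<open>None\<close> indexes the root entry, \<open>Some i\<close> the block
    below side \<open>i\<close>.\<close>
  define K where "K = (\<lambda>s. case s of None \<Rightarrow> {(A, h)} | Some i \<Rightarrow> nodes_in (half A j i))"
  \<comment> \<open>Outside the block \<open>ext\<close> fills in a stopped placeholder. By
    \<open>dep\<close> the value of \<open>G i\<close> is unaffected by the filling, so
    \<open>G i\<close> becomes a measurable function of its block alone.\<close>
  define ext where "ext = (\<lambda>J (\<rho> :: 'p rect \<times> state \<Rightarrow> 'p draw). \<lambda>b\<in>all_nodes. if b \<in> J then \<rho> b else (Stop, undefined, undefined))"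
  define Y where "Y = (\<lambda>s. case s of None \<Rightarrow> (\<lambda>\<rho>. f (\<rho> (A, h))) | Some i \<Rightarrow> (\<lambda>\<rho>. G i (ext (nodes_in (half A j i)) \<rho>)))"
  have K: "K s \<subseteq> all_nodes" for s
    using A by (cases s) (auto simp: K_def nodes_in_def)
  have disj: "disjoint_family_on K UNIV"
  proof -
    have d: "nodes_in (half A j i) \<inter> nodes_in (half A j i') = {}" if "i \<noteq> i'" for i i'
      using nodes_in_half_disjoint[OF A, of j] that by (cases i; cases i') auto
    have "(A, h) \<notin> nodes_in (half A j i)" for i by (rule root_notin_nodes_in_half[OF A])
    then show ?thesis using d by (auto simp: disjoint_family_on_def K_def split: option.splits)
  qed
  have ext: "ext J \<in> PiM J (\<lambda>_. draw_space) \<rightarrow>\<^sub>M node_space" for J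
    unfolding ext_def
  proof (rule measurable_restrict)
    fix b :: "'p rect \<times> state"
    show "(\<lambda>\<rho>. if b \<in> J then \<rho> b else (Stop, undefined, undefined)) \<in> PiM J (\<lambda>_. draw_space) \<rightarrow>\<^sub>M draw_space"
      by (cases "b \<in> J") (simp_all add: space_draw_space measurable_component_singleton)
  qed
  have Y: "Y s \<in> borel_measurable (PiM (K s) (\<lambda>_. draw_space))" for s
  proof (cases s)
    case None
    have "(\<lambda>\<rho>. \<rho> (A, h)) \<in> PiM {(A, h)} (\<lambda>_. draw_space) \<rightarrow>\<^sub>M draw_space"
      by (rule measurable_component_singleton) simp
    from measurable_compose[OF this f] None show ?thesis by (simp add: Y_def K_def)
  next
    case (Some i)
    from measurable_compose[OF ext G[of i], of "nodes_in (half A j i)"] Some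
    show ?thesis by (simp only: Y_def K_def option.case)
  qed
  have "indep_vars (\<lambda>s. PiM (K s) (\<lambda>_. draw_space)) (\<lambda>s \<omega>. restrict (\<lambda>b. \<omega> b) (K s)) UNIV"
    by (rule indep_vars_restrict[OF indep_draws_coords[OF v] K disj])
  then have ind: "indep_vars (\<lambda>_. borel) (\<lambda>s \<omega>. Y s (restrict \<omega> (K s))) UNIV"
    by (rule indep_vars_compose2) (rule Y)
  have YN: "Y None (restrict \<omega> (K None)) = f (\<omega> (A, h))" for \<omega>
    by (simp add: Y_def K_def)
  have YS: "Y (Some i) (restrict \<omega> (K (Some i))) = G i \<omega>" for i \<omega>
  proof -
    have "G i (ext (nodes_in (half A j i)) (restrict \<omega> (nodes_in (half A j i)))) = G i \<omega>"
      using nodes_in_subset[of "half A j i"] by (intro dep) (auto simp: ext_def)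
    then show ?thesis by (simp add: Y_def K_def)
  qed
  have U: "(UNIV :: side option set) = insert None (Some ` UNIV)"
    by (auto intro: option.exhaust)
  have prodU: "(\<Prod>s\<in>UNIV. H s) = H None * (\<Prod>i\<in>UNIV. H (Some i))" for H :: "side option \<Rightarrow> ennreal"
    unfolding U by (subst prod.insert) (auto simp: prod.reindex)
  have "(\<integral>\<^sup>+\<omega>. f (\<omega> (A, h)) * (\<Prod>i\<in>UNIV. G i \<omega>) \<partial>draws \<Theta>) =
      (\<integral>\<^sup>+\<omega>. (\<Prod>s\<in>UNIV. Y s (restrict \<omega> (K s))) \<partial>draws \<Theta>)"
    unfolding prodU YN YS ..
  also have "\<dots> = (\<Prod>s\<in>UNIV. \<integral>\<^sup>+\<omega>. Y s (restrict \<omega> (K s)) \<partial>draws \<Theta>)"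
    using ind by (intro indep_vars_nn_integral) auto
  also have "\<dots> = (\<integral>\<^sup>+\<omega>. f (\<omega> (A, h)) \<partial>draws \<Theta>) * (\<Prod>i\<in>UNIV. \<integral>\<^sup>+\<omega>. G i \<omega> \<partial>draws \<Theta>)"
    unfolding prodU YN YS ..
  also have "(\<integral>\<^sup>+\<omega>. f (\<omega> (A, h)) \<partial>draws \<Theta>) = (\<integral>\<^sup>+z. f z \<partial>node_law \<Theta> A h)"
    unfolding distr_draws_coord[OF v A, symmetric] using A
    by (subst nn_integral_distr) (auto simp: measurable_draws_iff[OF v] intro!: measurable_node_coord)
  finally show ?thesis .
qed

section \<open>Joint measurability in draws and points\<close>

lemma measurable_draw_fst [measurable]: "fst \<in> draw_space \<rightarrow>\<^sub>M count_space UNIV"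
  and measurable_draw_dir [measurable]: "(\<lambda>z. fst (snd z)) \<in> draw_space \<rightarrow>\<^sub>M count_space UNIV"
  and measurable_draw_value: "(\<lambda>z. snd (snd z) t) \<in> borel_measurable draw_space"
proof -
  show "fst \<in> draw_space \<rightarrow>\<^sub>M count_space UNIV" "(\<lambda>z. fst (snd z)) \<in> draw_space \<rightarrow>\<^sub>M count_space UNIV"
    unfolding draw_space_def by measurable
  have "(\<lambda>z. snd (snd z)) \<in> draw_space \<rightarrow>\<^sub>M split_space" unfolding draw_space_def by measurable
  from measurable_compose[OF this measurable_component_singleton[of t UNIV]]
  show "(\<lambda>z. snd (snd z) t) \<in> borel_measurable draw_space" by simp
qed

text \<open>State and direction take finitely many values, so it suffices to check measurability
  with both frozen. This handles every recursion that branches on a draw.\<close>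

lemma measurable_at_draw:
  fixes F :: "state \<Rightarrow> 'p::finite \<Rightarrow> 'a \<Rightarrow> 'b" and c :: "'a \<Rightarrow> 'p draw"
  assumes c: "c \<in> N \<rightarrow>\<^sub>M draw_space"
    and F: "\<And>g j. F g j \<in> N \<rightarrow>\<^sub>M L"
  shows "(\<lambda>v. F (fst (c v)) (fst (snd (c v))) v) \<in> N \<rightarrow>\<^sub>M L"
proof -
  have "(\<lambda>v. F g (fst (snd (c v))) v) \<in> N \<rightarrow>\<^sub>M L" for g
    by (rule measurable_compose_countable'[where I=UNIV, OF F measurable_compose[OF c measurable_draw_dir]])
      (auto intro: countable_finite)
  then show ?thesis
    by (rule measurable_compose_countable'[where I=UNIV, OF _ measurable_compose[OF c measurable_draw_fst]])
      (auto intro: countable_finite)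
qed

lemma measurable_node_fst:
  "A \<in> rects \<Longrightarrow> (\<lambda>p. fst p (A, h)) \<in> node_space \<Otimes>\<^sub>M X \<rightarrow>\<^sub>M draw_space"
  by (rule measurable_compose[OF measurable_fst measurable_node_coord]) auto

text \<open>Joint in draws and point, because integrals over the point and over the draws are
  interchanged later.\<close>

lemma measurable_stopped_by:
  assumes "A \<in> rects"
  shows "Measurable.pred (node_space \<Otimes>\<^sub>M borel) (\<lambda>p. stopped_by k A h (fst p) (snd p))"
  using assms
proof (induction k arbitrary: A h)
  case (Suc k)
  have in_cell: "Measurable.pred (node_space \<Otimes>\<^sub>M borel) (\<lambda>p. snd p \<in> cell A)" by measurable
  have IH: "Measurable.pred (node_space \<Otimes>\<^sub>M borel) (\<lambda>p. \<exists>i\<in>UNIV. stopped_by k (half A j i) g (fst p) (snd p))" for g j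
    using Suc.IH[OF half_in_rects[OF Suc.prems]] by (intro pred_intros_finite) auto
  have "Measurable.pred (node_space \<Otimes>\<^sub>M borel) (\<lambda>p. (\<lambda>g j p. snd p \<in> cell A \<and>
     (g = Stop \<or> (\<exists>i\<in>UNIV. stopped_by k (half A j i) g (fst p) (snd p))))
       (fst (fst p (A, h))) (fst (snd (fst p (A, h)))) p)"
    by (rule measurable_at_draw[OF measurable_node_fst[OF Suc.prems]]) (use IH in_cell in measurable)
  then show ?case by simp
qed simp

lemma measurable_base_cond: "q\<^sub>0 \<in> borel_measurable borel \<Longrightarrow> base_cond \<mu> q\<^sub>0 A \<in> borel_measurable borel"
  unfolding base_cond_def[abs_def] by (intro borel_measurable_divide borel_measurable_const)

lemma measurable_tdens:
  assumes "A \<in> rects" and q: "q\<^sub>0 \<in> borel_measurable borel"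
  shows "(\<lambda>p. tdens \<mu> q\<^sub>0 k A h (fst p) t (snd p)) \<in> borel_measurable (node_space \<Otimes>\<^sub>M borel)"
  using assms(1)
proof (induction k arbitrary: A h)
  case 0
  then show ?case by (simp add: tdens_0)
next
  case (Suc k)
  note b [measurable] = measurable_base_cond[OF q, of \<mu> A]
  have y: "(\<lambda>p. snd (snd (fst p (A, h))) t) \<in> borel_measurable (node_space \<Otimes>\<^sub>M borel)"
    by (rule measurable_compose[OF measurable_node_fst[OF Suc.prems] measurable_draw_value])
  have sh: "(\<lambda>p. share (snd (snd (fst p (A, h)))) i t) \<in> borel_measurable (node_space \<Otimes>\<^sub>M borel)" for i
    using y borel_measurable_diff[OF borel_measurable_const y, of 1] by (cases i) simp_all
  have "(\<lambda>p. (\<lambda>g j p. if g = Stop then indicator (cell A) (snd p) * base_cond \<mu> q\<^sub>0 A (snd p)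
      else \<Sum>i\<in>UNIV. share (snd (snd (fst p (A, h)))) i t * tdens \<mu> q\<^sub>0 k (half A j i) g (fst p) t (snd p))
      (fst (fst p (A, h))) (fst (snd (fst p (A, h)))) p) \<in> borel_measurable (node_space \<Otimes>\<^sub>M borel)"
  proof (rule measurable_at_draw[OF measurable_node_fst[OF Suc.prems]])
    fix g :: state and j
    note [measurable] = Suc.IH[OF half_in_rects[OF Suc.prems], of j _ g] sh
    show "(\<lambda>p. if g = Stop then indicator (cell A) (snd p) * base_cond \<mu> q\<^sub>0 A (snd p)
      else \<Sum>i\<in>UNIV. share (snd (snd (fst p (A, h)))) i t * tdens \<mu> q\<^sub>0 k (half A j i) g (fst p) t (snd p))
      \<in> borel_measurable (node_space \<Otimes>\<^sub>M borel)"
      by measurable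
  qed
  then show ?case unfolding tdens_Suc[OF Suc.prems] by (simp add: case_prod_beta)
qed

text \<open>\<open>dens\<close> is a definite description over an inductive predicate and offers no
  direct handle; its measurability comes from the pointwise limit of the recursive
  truncations.\<close>

lemma measurable_dens:
  assumes "A \<in> rects" and q: "q\<^sub>0 \<in> borel_measurable borel"
  shows "(\<lambda>p. dens \<mu> q\<^sub>0 A (h, fst p) t (snd p)) \<in> borel_measurable (node_space \<Otimes>\<^sub>M borel)"
  by (rule borel_measurable_LIMSEQ_metric[OF measurable_tdens[OF assms] tdens_tendsto[OF assms(1)]])

abbreviation data_space :: "(grp \<Rightarrow> nat) \<Rightarrow> (grp \<Rightarrow> nat \<Rightarrow> real^'p::finite) measure" where
  "data_space n \<equiv> \<Pi>\<^sub>M t\<in>UNIV. \<Pi>\<^sub>M i\<in>{..<n t}. borel"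

lemma measurable_datum: "i < n t \<Longrightarrow> (\<lambda>x. x t i) \<in> data_space n \<rightarrow>\<^sub>M borel"
  by (rule measurable_compose[OF measurable_component_singleton[of t UNIV] measurable_component_singleton]) auto

text \<open>The index set of \<open>lik\<close> depends on the data. Padding with 1 makes it fixed,
  as needed when the data are integrated coordinate by coordinate.\<close>

lemma lik_alt:
  "lik \<mu> q\<^sub>0 n x A \<omega> = (\<Prod>t\<in>UNIV. \<Prod>i<n t. if x t i \<in> cell A then dens \<mu> q\<^sub>0 A \<omega> t (x t i) else 1)"
proof -
  have "(\<Prod>i | i < n t \<and> x t i \<in> cell A. dens \<mu> q\<^sub>0 A \<omega> t (x t i)) =
    (\<Prod>i<n t. if x t i \<in> cell A then dens \<mu> q\<^sub>0 A \<omega> t (x t i) else 1)" for t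
    using prod.inter_filter[of "{..<n t}" "\<lambda>i. dens \<mu> q\<^sub>0 A \<omega> t (x t i)" "\<lambda>i. x t i \<in> cell A"] by simp
  then show ?thesis by (simp only: lik_def)
qed

lemma measurable_dens_fixed:
  assumes "A \<in> rects" and q: "q\<^sub>0 \<in> borel_measurable borel"
  shows "(\<lambda>\<omega>. dens \<mu> q\<^sub>0 A (h, \<omega>) t x) \<in> borel_measurable node_space"
  using measurable_Pair1[OF measurable_dens[OF assms, of \<mu> h t], of x] by simp

lemma measurable_lik_fixed:
  assumes "A \<in> rects" and q: "q\<^sub>0 \<in> borel_measurable borel"
  shows "(\<lambda>\<omega>. lik \<mu> q\<^sub>0 n x A (h, \<omega>)) \<in> borel_measurable node_space"
  unfolding lik_def by (rule borel_measurable_prod)+ (rule measurable_dens_fixed[OF assms])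

section \<open>Conditioning on the first draw\<close>

text \<open>Extends the factorisation to continuations chosen by the drawn state and direction.
  Independence is applied for each fixed pair \<open>(g, j)\<close>, since under a random direction
  the blocks themselves would be random.\<close>

lemma nn_integral_draws_split:
  fixes \<Theta> :: "'p::finite dmmt_params"
  assumes v: "valid_params \<Theta>" and A: "A \<in> rects" and f: "f \<in> borel_measurable draw_space"
    and G: "\<And>g j i. G g j i \<in> borel_measurable node_space"
    and dep: "\<And>g j i \<omega> \<omega>'. (\<And>b. b \<in> nodes_in (half A j i) \<Longrightarrow> \<omega> b = \<omega>' b) \<Longrightarrow> G g j i \<omega> = G g j i \<omega>'"
  shows "(\<integral>\<^sup>+\<omega>. f (\<omega> (A, h)) * (if fst (\<omega> (A, h)) = Stop then 1
        else \<Prod>i\<in>UNIV. G (fst (\<omega> (A, h))) (fst (snd (\<omega> (A, h)))) i \<omega>) \<partial>draws \<Theta>) =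
    ennreal (trprob \<Theta> A h Stop) * f (Stop, undefined, undefined) +
    (\<Sum>g\<in>{Divide, Merge}. \<Sum>j\<in>UNIV. ennreal (trprob \<Theta> A h g * dirp \<Theta> A g j) *
      (\<integral>\<^sup>+y. f (g, j, y) \<partial>draw_split \<Theta> A g j) * (\<Prod>i\<in>UNIV. \<integral>\<^sup>+\<omega>. G g j i \<omega> \<partial>draws \<Theta>))"
proof -
  note vn = valid_params_node[OF v A]
  \<comment> \<open>\<open>f0\<close> and \<open>f1 g j\<close> cut \<open>f\<close> along the
    discrete part of the root draw, so that on each piece the continuation is a fixed
    function.\<close>
  define f0 where "f0 = (\<lambda>z. f z * indicator {Stop} (fst z))"
  define f1 where "f1 = (\<lambda>g j z. f z * indicator {(g, j)} (fst z, fst (snd z)))"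
  have f0 [measurable]: "f0 \<in> borel_measurable draw_space"
    unfolding f0_def using f
    by (intro borel_measurable_times_ennreal measurable_compose[OF measurable_draw_fst]) auto
  have f1 [measurable]: "f1 g j \<in> borel_measurable draw_space" for g j
  proof -
    have "(\<lambda>z. (\<lambda>g' j' z. indicator {(g, j)} (g', j') :: ennreal) (fst z) (fst (snd z)) z) \<in> borel_measurable draw_space"
      by (rule measurable_at_draw[of "\<lambda>z. z"]) auto
    then show ?thesis unfolding f1_def using f by (intro borel_measurable_times_ennreal) auto
  qed
  have c: "(\<lambda>\<omega>. \<omega> (A, h)) \<in> draws \<Theta> \<rightarrow>\<^sub>M draw_space"
    using A by (simp add: measurable_draws_iff[OF v] measurable_node_coord)
  have G': "(\<lambda>\<omega>. \<Prod>i\<in>UNIV. G g j i \<omega>) \<in> borel_measurable (draws \<Theta>)" for g j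
    unfolding measurable_draws_iff[OF v] by (intro borel_measurable_prod_ennreal G)
  have split: "f z * (if fst z = Stop then 1 else \<Prod>i\<in>UNIV. G (fst z) (fst (snd z)) i \<omega>) =
    f0 z + (\<Sum>g\<in>{Divide, Merge}. \<Sum>j\<in>UNIV. f1 g j z * (\<Prod>i\<in>UNIV. G g j i \<omega>))" for z \<omega>
  proof (cases "fst z")
    case Stop
    then show ?thesis by (simp add: f0_def f1_def)
  next
    case Divide
    have "(\<Sum>j\<in>UNIV. f1 Divide j z * (\<Prod>i\<in>UNIV. G Divide j i \<omega>)) =
      (\<Sum>j\<in>UNIV. if j = fst (snd z) then f z * (\<Prod>i\<in>UNIV. G Divide j i \<omega>) else 0)"
      using Divide by (intro sum.cong) (auto simp: f1_def)
    then show ?thesis using Divide by (simp add: f0_def f1_def)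
  next
    case Merge
    have "(\<Sum>j\<in>UNIV. f1 Merge j z * (\<Prod>i\<in>UNIV. G Merge j i \<omega>)) =
      (\<Sum>j\<in>UNIV. if j = fst (snd z) then f z * (\<Prod>i\<in>UNIV. G Merge j i \<omega>) else 0)"
      using Merge by (intro sum.cong) (auto simp: f1_def)
    then show ?thesis using Merge by (simp add: f0_def f1_def)
  qed
  have int0: "(\<integral>\<^sup>+\<omega>. f0 (\<omega> (A, h)) \<partial>draws \<Theta>) = ennreal (trprob \<Theta> A h Stop) * f (Stop, undefined, undefined)"
  proof -
    have "(\<integral>\<^sup>+\<omega>. f0 (\<omega> (A, h)) \<partial>draws \<Theta>) = (\<integral>\<^sup>+z. f0 z \<partial>node_law \<Theta> A h)"
      unfolding distr_draws_coord[OF v A, symmetric] using c by (simp add: nn_integral_distr)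
    also have "\<dots> = ennreal (trprob \<Theta> A h Stop) * f (Stop, undefined, undefined)"
      unfolding nn_integral_node_law[OF vn f0] by (simp add: f0_def)
    finally show ?thesis .
  qed
  have int1: "(\<integral>\<^sup>+\<omega>. f1 g j (\<omega> (A, h)) * (\<Prod>i\<in>UNIV. G g j i \<omega>) \<partial>draws \<Theta>) =
      ennreal (trprob \<Theta> A h g * dirp \<Theta> A g j) * (\<integral>\<^sup>+y. f (g, j, y) \<partial>draw_split \<Theta> A g j) *
      (\<Prod>i\<in>UNIV. \<integral>\<^sup>+\<omega>. G g j i \<omega> \<partial>draws \<Theta>)" if g: "g \<in> {Divide, Merge}" for g j
  proof -
    have *: "(\<integral>\<^sup>+y. f1 g j (g', j', y) \<partial>draw_split \<Theta> A g' j') =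
      (if g' = g then if j' = j then (\<integral>\<^sup>+y. f (g, j, y) \<partial>draw_split \<Theta> A g j) else 0 else 0)" for g' j'
      by (cases "g' = g"; cases "j' = j") (simp_all add: f1_def)
    have m: "a * (if P then u else 0) = (if P then a * u else 0)" for a u :: ennreal and P
      by simp
    have "f1 g j (Stop, undefined, undefined) = 0" using g by (auto simp: f1_def)
    then have "(\<integral>\<^sup>+z. f1 g j z \<partial>node_law \<Theta> A h) =
      ennreal (trprob \<Theta> A h g * dirp \<Theta> A g j) * (\<integral>\<^sup>+y. f (g, j, y) \<partial>draw_split \<Theta> A g j)"
      unfolding nn_integral_node_law[OF vn f1] * m using g by auto
    then show ?thesis
      by (subst nn_integral_draws_first_step[OF v A f1 G dep]) simp_all
  qed
  have "(\<integral>\<^sup>+\<omega>. f (\<omega> (A, h)) * (if fst (\<omega> (A, h)) = Stop then 1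
        else \<Prod>i\<in>UNIV. G (fst (\<omega> (A, h))) (fst (snd (\<omega> (A, h)))) i \<omega>) \<partial>draws \<Theta>) =
    (\<integral>\<^sup>+\<omega>. f0 (\<omega> (A, h)) \<partial>draws \<Theta>) +
    (\<Sum>g\<in>{Divide, Merge}. \<Sum>j\<in>UNIV. \<integral>\<^sup>+\<omega>. f1 g j (\<omega> (A, h)) * (\<Prod>i\<in>UNIV. G g j i \<omega>) \<partial>draws \<Theta>)"
    unfolding split
    using measurable_compose[OF c f0] measurable_compose[OF c f1] G'
    by (simp add: nn_integral_add nn_integral_sum)
  then show ?thesis unfolding int0 by (simp add: int1)
qed

text \<open>The type of draws admits arbitrary real shares, and the signs of densities and
  likelihoods are controlled only where the shares lie in the unit interval. Stopped entries are
  exempt, as they hold placeholders.\<close>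

definition proper :: "('p::finite rect \<times> state \<Rightarrow> 'p draw) \<Rightarrow> bool" where
  "proper \<omega> \<longleftrightarrow> (\<forall>b\<in>all_nodes. fst (\<omega> b) \<noteq> Stop \<longrightarrow> (\<forall>t. 0 \<le> snd (snd (\<omega> b)) t \<and> snd (snd (\<omega> b)) t \<le> 1))"

lemma AE_proper:
  assumes v: "valid_params \<Theta>"
  shows "AE \<omega> in draws \<Theta>. proper \<omega>"
proof -
  let ?P = "\<lambda>z. fst z \<noteq> Stop \<longrightarrow> (\<forall>t. 0 \<le> snd (snd z) t \<and> snd (snd z) t \<le> 1)"
  have node: "AE z in node_law \<Theta> A h. ?P z" if A: "A \<in> rects" for A h
  proof -
    note vn = valid_params_node[OF v A]
    note [measurable] = measurable_draw_value
    have s: "{z \<in> space draw_space. \<not> ?P z} \<in> sets draw_space" by measurable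
    have "(\<integral>\<^sup>+y. indicator {z \<in> space draw_space. \<not> ?P z} (g, j, y) \<partial>draw_split \<Theta> A g j) = 0" if "g \<in> {Divide, Merge}" for g j
    proof -
      have "AE y in draw_split \<Theta> A g j. \<forall>t. 0 < y t \<and> y t < 1"
        using that vn by (intro AE_draw_split) (auto simp: valid_node_def)
      then have "AE y in draw_split \<Theta> A g j. indicator {z \<in> space draw_space. \<not> ?P z} (g, j, y) = (0 :: ennreal)"
        by eventually_elim (auto simp: indicator_def less_imp_le)
      then show ?thesis by (simp add: nn_integral_cong_AE)
    qed
    then have "(\<integral>\<^sup>+z. indicator {z \<in> space draw_space. \<not> ?P z} z \<partial>node_law \<Theta> A h) = 0"
      using s by (subst nn_integral_node_law[OF vn]) auto
    moreover have sp: "space (node_law \<Theta> A h) = space draw_space"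
      by (rule sets_eq_imp_space_eq[OF sets_node_law[OF vn]])
    ultimately show ?thesis
      using s sets_node_law[OF vn, of h]
      by (subst AE_iff_measurable[of "{z \<in> space draw_space. \<not> ?P z}"]) auto
  qed
  have "AE \<omega> in draws \<Theta>. ?P (\<omega> b)" if "b \<in> all_nodes" for b
    unfolding draws_def
    using that node v by (intro AE_PiM_component[where P="?P"]) (auto intro: prob_space_node_law valid_params_node)
  moreover have "countable (all_nodes :: ('a rect \<times> state) set)"
    using countable_rects by (auto intro: countable_finite)
  ultimately show ?thesis unfolding proper_def by (subst AE_ball_countable) auto
qed

lemma base_cond_nonneg: "(\<And>x. 0 \<le> q\<^sub>0 x) \<Longrightarrow> 0 \<le> base_cond \<mu> q\<^sub>0 A x"
  by (simp add: base_cond_def)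

lemma share_bounds:
  "proper \<omega> \<Longrightarrow> A \<in> rects \<Longrightarrow> \<omega> (A, h) = (g, j, y) \<Longrightarrow> g \<noteq> Stop \<Longrightarrow> 0 \<le> share y i t \<and> share y i t \<le> 1"
proof -
  assume *: "proper \<omega>" "A \<in> rects" "\<omega> (A, h) = (g, j, y)" "g \<noteq> Stop"
  have "\<forall>t. 0 \<le> y t \<and> y t \<le> 1"
    using bspec[OF *(1)[unfolded proper_def], of "(A, h)"] *(2-) by simp
  then show ?thesis by (cases i) auto
qed

lemma tdens_nonneg:
  assumes "proper \<omega>" "A \<in> rects" "\<And>x. 0 \<le> q\<^sub>0 x"
  shows "0 \<le> tdens \<mu> q\<^sub>0 k A h \<omega> t x"
  using assms(2)
proof (induction k arbitrary: A h)
  case (Suc k)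
  obtain g j y where z: "\<omega> (A, h) = (g, j, y)" by (cases "\<omega> (A, h)") auto
  show ?case
    using Suc.IH[OF half_in_rects[OF Suc.prems]] share_bounds[OF assms(1) Suc.prems z]
    by (auto simp: tdens_Suc[OF Suc.prems] z base_cond_nonneg assms(3) intro!: sum_nonneg mult_nonneg_nonneg)
qed (simp add: tdens_0)

lemma dens_nonneg:
  assumes "proper \<omega>" "A \<in> rects" "\<And>x. 0 \<le> q\<^sub>0 x"
  shows "0 \<le> dens \<mu> q\<^sub>0 A (h, \<omega>) t x"
  using tdens_nonneg[OF assms] by (intro LIMSEQ_le_const[OF tdens_tendsto[OF assms(2)]]) auto

lemma lik_nonneg:
  assumes "proper \<omega>" "A \<in> rects" "\<And>x. 0 \<le> q\<^sub>0 x"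
  shows "0 \<le> lik \<mu> q\<^sub>0 n x A (h, \<omega>)"
  unfolding lik_def using dens_nonneg[of \<omega> A q\<^sub>0, OF assms] by (simp add: prod_nonneg)

section \<open>The process as a mixture over the initial state\<close>

abbreviation outcome_space :: "'p::finite outcome measure" where
  "outcome_space \<equiv> count_space UNIV \<Otimes>\<^sub>M node_space"

lemma process_alt: "process \<rho>\<^sub>0 \<Theta> = point_measure UNIV (\<lambda>g. ennreal (\<rho>\<^sub>0 g)) \<Otimes>\<^sub>M draws \<Theta>"
  by (simp add: process_def draws_def)

lemma sets_process: "valid_params \<Theta> \<Longrightarrow> sets (process \<rho>\<^sub>0 \<Theta>) = sets outcome_space"
  unfolding process_alt using sets_draws[of \<Theta>] by (intro sets_pair_measure_cong) (simp_all add: sets_point_measure)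

lemma measurable_process_iff: "valid_params \<Theta> \<Longrightarrow> measurable (process \<rho>\<^sub>0 \<Theta>) N = measurable outcome_space N"
  by (rule measurable_cong_sets[OF sets_process refl])

lemma nn_integral_process:
  assumes v: "valid_params \<Theta>" and f: "f \<in> borel_measurable outcome_space"
  shows "(\<integral>\<^sup>+w. f w \<partial>process \<rho>\<^sub>0 \<Theta>) = (\<Sum>g\<in>UNIV. ennreal (\<rho>\<^sub>0 g) * (\<integral>\<^sup>+\<omega>. f (g, \<omega>) \<partial>draws \<Theta>))"
proof -
  interpret prob_space "draws \<Theta>" by (rule prob_space_draws[OF v])
  have "f \<in> borel_measurable (process \<rho>\<^sub>0 \<Theta>)" using f by (simp add: measurable_process_iff[OF v])
  then show ?thesis
    unfolding process_alt by (subst nn_integral_fst[symmetric]) (simp_all add: nn_integral_point_measure_finite)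
qed

lemma prob_space_process:
  assumes v: "valid_params \<Theta>" and i: "valid_init \<rho>\<^sub>0"
  shows "prob_space (process \<rho>\<^sub>0 \<Theta>)"
proof
  have "emeasure (process \<rho>\<^sub>0 \<Theta>) (space (process \<rho>\<^sub>0 \<Theta>)) = (\<integral>\<^sup>+w. 1 \<partial>process \<rho>\<^sub>0 \<Theta>)" by simp
  also have "\<dots> = (\<Sum>g\<in>UNIV. ennreal (\<rho>\<^sub>0 g))"
    using prob_space.emeasure_space_1[OF prob_space_draws[OF v]] by (subst nn_integral_process[OF v]) auto
  also have "\<dots> = 1" using i by (simp add: valid_init_def)
  finally show "emeasure (process \<rho>\<^sub>0 \<Theta>) (space (process \<rho>\<^sub>0 \<Theta>)) = 1" .
qed

lemma AE_process_draws:
  assumes v: "valid_params \<Theta>" and P: "AE \<omega> in draws \<Theta>. P \<omega>"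
  shows "AE w in process \<rho>\<^sub>0 \<Theta>. P (snd w)"
proof -
  interpret prob_space "draws \<Theta>" by (rule prob_space_draws[OF v])
  obtain N where N: "{\<omega> \<in> space (draws \<Theta>). \<not> P \<omega>} \<subseteq> N" "emeasure (draws \<Theta>) N = 0" "N \<in> sets (draws \<Theta>)"
    by (rule AE_E[OF P])
  have "UNIV \<times> N \<in> null_sets (process \<rho>\<^sub>0 \<Theta>)"
  proof (rule null_setsI)
    show s: "UNIV \<times> N \<in> sets (process \<rho>\<^sub>0 \<Theta>)"
      unfolding process_alt by (intro pair_measureI N(3)) (simp add: sets_point_measure)
    show "emeasure (process \<rho>\<^sub>0 \<Theta>) (UNIV \<times> N) = 0"
      unfolding process_alt by (subst emeasure_pair_measure_Times) (simp_all add: sets_point_measure N(2,3))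
  qed
  moreover have "{w \<in> space (process \<rho>\<^sub>0 \<Theta>). \<not> P (snd w)} \<subseteq> UNIV \<times> N"
    using N(1) by (auto simp: process_alt space_pair_measure)
  ultimately show ?thesis by (rule AE_I')
qed

lemma measurable_outcome:
  assumes "\<And>g. (\<lambda>\<omega>. f (g, \<omega>)) \<in> node_space \<rightarrow>\<^sub>M N"
  shows "f \<in> outcome_space \<rightarrow>\<^sub>M N"
proof -
  have "(\<lambda>w. (\<lambda>g w. f (g, snd w)) (fst w) w) \<in> outcome_space \<rightarrow>\<^sub>M N"
    by (rule measurable_compose_countable'[where I=UNIV,
          OF measurable_compose[OF measurable_snd assms] measurable_fst]) (rule countable_finite, simp)
  then show ?thesis by simp
qed

text \<open>\<open>Phi\<close> is a Bochner integral, meaningful only for integrable functions. The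
  integrability in \<open>regular_data\<close> and almost sure nonnegativity identify it with the
  integral in \<open>ennreal\<close>, where the recursion is carried out.\<close>

lemma nn_integral_lik_Phi:
  assumes v: "valid_params \<Theta>" and b: "valid_baseline \<mu> q\<^sub>0" and r: "regular_data \<Theta> \<mu> q\<^sub>0 n x" and A: "A \<in> rects"
  shows "(\<integral>\<^sup>+\<omega>. ennreal (lik \<mu> q\<^sub>0 n x A (h, \<omega>)) \<partial>draws \<Theta>) = ennreal (Phi \<Theta> \<mu> q\<^sub>0 n x A h)"
proof -
  let ?\<rho> = "\<lambda>h'. of_bool (h' = h) :: real"
  have q: "q\<^sub>0 \<in> borel_measurable borel" "\<And>x. 0 \<le> q\<^sub>0 x" using b by (auto simp: valid_baseline_def)
  have nn: "0 \<le> lik \<mu> q\<^sub>0 n x A w" if "proper (snd w)" for w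
    using lik_nonneg[of "snd w" A q\<^sub>0 \<mu> n x "fst w", OF that A q(2)] by simp
  have "AE w in process ?\<rho> \<Theta>. 0 \<le> lik \<mu> q\<^sub>0 n x A w"
    using AE_process_draws[OF v AE_proper[OF v], of ?\<rho>] by eventually_elim (rule nn)
  moreover have "integrable (process ?\<rho> \<Theta>) (lik \<mu> q\<^sub>0 n x A)" using r A by (auto simp: regular_data_def)
  ultimately have "(\<integral>\<^sup>+w. ennreal (lik \<mu> q\<^sub>0 n x A w) \<partial>process ?\<rho> \<Theta>) = ennreal (Phi \<Theta> \<mu> q\<^sub>0 n x A h)"
    unfolding Phi_def by (intro nn_integral_eq_integral)
  moreover have "(\<integral>\<^sup>+w. ennreal (lik \<mu> q\<^sub>0 n x A w) \<partial>process ?\<rho> \<Theta>) =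
     (\<Sum>g\<in>UNIV. ennreal (?\<rho> g) * (\<integral>\<^sup>+\<omega>. ennreal (lik \<mu> q\<^sub>0 n x A (g, \<omega>)) \<partial>draws \<Theta>))"
    by (rule nn_integral_process[OF v], rule measurable_outcome)
      (rule measurable_compose[OF measurable_lik_fixed[OF A q(1)] measurable_ennreal])
  moreover have "\<dots> = (\<Sum>g\<in>UNIV. if g = h then (\<integral>\<^sup>+\<omega>. ennreal (lik \<mu> q\<^sub>0 n x A (g, \<omega>)) \<partial>draws \<Theta>) else 0)"
    by (intro sum.cong) auto
  ultimately show ?thesis by simp
qed

text \<open>The contribution of the draw at \<open>A\<close> alone to the likelihood on
  \<open>A\<close>: all of it if the run stops there, otherwise the powers of the shares at the
  split.\<close>

definition node_weight where
  "node_weight \<Theta> \<mu> q\<^sub>0 n x A z = (if fst z = Stop then Z \<Theta> \<mu> q\<^sub>0 n x A Stop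
     else split_lik (\<lambda>t i. ncount n x t (half A (fst (snd z)) i)) (snd (snd z)))"

lemma measurable_node_weight: "node_weight \<Theta> \<mu> q\<^sub>0 n x A \<in> borel_measurable draw_space"
proof -
  have s: "(\<lambda>z. snd (snd z)) \<in> draw_space \<rightarrow>\<^sub>M split_space" unfolding draw_space_def by measurable
  have "(\<lambda>z. (\<lambda>g j z. if g = Stop then Z \<Theta> \<mu> q\<^sub>0 n x A Stop
     else split_lik (\<lambda>t i. ncount n x t (half A j i)) (snd (snd z))) (fst z) (fst (snd z)) z) \<in> borel_measurable draw_space"
  proof (rule measurable_at_draw[of "\<lambda>z. z"])
    fix g :: state and j :: 'a
    show "(\<lambda>z. if g = Stop then Z \<Theta> \<mu> q\<^sub>0 n x A Stop
     else split_lik (\<lambda>t i. ncount n x t (half A j i)) (snd (snd z))) \<in> borel_measurable draw_space"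
      using measurable_compose[OF s split_lik_measurable[of "\<lambda>t i. ncount n x t (half A j i)"]]
      by (cases "g = Stop") simp_all
  qed simp
  then show ?thesis by (simp add: node_weight_def[abs_def])
qed

lemma ennreal_lik_step:
  assumes "proper \<omega>" "A \<in> rects" "\<And>x. 0 \<le> q\<^sub>0 x"
  shows "ennreal (lik \<mu> q\<^sub>0 n x A (h, \<omega>)) = ennreal (node_weight \<Theta> \<mu> q\<^sub>0 n x A (\<omega> (A, h))) *
    (if fst (\<omega> (A, h)) = Stop then 1
     else \<Prod>i\<in>UNIV. ennreal (lik \<mu> q\<^sub>0 n x (half A (fst (snd (\<omega> (A, h)))) i) (fst (\<omega> (A, h)), \<omega>)))"
proof -
  obtain g j y where z: "\<omega> (A, h) = (g, j, y)" by (cases "\<omega> (A, h)") auto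
  show ?thesis
  proof (cases "g = Stop")
    case True
    then show ?thesis using lik_stop[OF assms(2), of \<omega> h] z by (simp add: node_weight_def)
  next
    case False
    have y: "0 \<le> y t" "0 \<le> 1 - y t" for t
      using share_bounds[OF assms(1,2) z False, of Lft t] by simp_all
    have "0 \<le> split_lik N y" for N unfolding split_lik_def using y by (intro prod_nonneg) auto
    moreover have "lik \<mu> q\<^sub>0 n x A (h, \<omega>) = split_lik (\<lambda>t i. ncount n x t (half A j i)) y *
      (lik \<mu> q\<^sub>0 n x (half A j Lft) (g, \<omega>) * lik \<mu> q\<^sub>0 n x (half A j Rgt) (g, \<omega>))"
      using lik_split[OF assms(2), of \<omega> h g j y \<mu> q\<^sub>0 n x] z False by (simp add: split_lik_def)
    moreover have "0 \<le> lik \<mu> q\<^sub>0 n x (half A j i) (g, \<omega>)" for i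
      by (rule lik_nonneg[of \<omega> "half A j i" q\<^sub>0, OF assms(1) half_in_rects[OF assms(2)] assms(3)])
    ultimately show ?thesis
      using z False by (simp add: node_weight_def UNIV_side ennreal_mult)
  qed
qed

definition posterior_params ::
    "'p::finite dmmt_params \<Rightarrow> (real^'p) measure \<Rightarrow> (real^'p \<Rightarrow> real) \<Rightarrow>
     (grp \<Rightarrow> nat) \<Rightarrow> (grp \<Rightarrow> nat \<Rightarrow> real^'p) \<Rightarrow> 'p dmmt_params" where
  "posterior_params \<Theta> \<mu> q\<^sub>0 n x =
     \<lparr>trprob = \<lambda>A g h. trprob \<Theta> A g h * (Z \<Theta> \<mu> q\<^sub>0 n x A h / Phi \<Theta> \<mu> q\<^sub>0 n x A g),
      dirp = \<lambda>A g j. Zdir \<Theta> \<mu> q\<^sub>0 n x A g j / Z \<Theta> \<mu> q\<^sub>0 n x A g,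
      pcount = \<lambda>A g t j i. if g = Divide
        then pcount \<Theta> A Divide t j i + real (ncount n x t (half A j i))
        else pcount \<Theta> A g t j i
          + real (ncount n x Grp1 (half A j i)) + real (ncount n x Grp2 (half A j i))\<rparr>"

lemma Zdir_alt:
  "Zdir \<Theta> \<mu> q\<^sub>0 n x A g j = dirp \<Theta> A g j * beta_ratio \<Theta> A g j (\<lambda>t i. ncount n x t (half A j i)) *
     (\<Prod>i\<in>UNIV. Phi \<Theta> \<mu> q\<^sub>0 n x (half A j i) g)"
  unfolding Zdir_def beta_ratio_def Let_def by simp

text \<open>The single computation behind both the recursion for \<open>Phi\<close> and the
  telescoping of event probabilities. \<open>c g j i\<close> is what remains of \<open>G\<close>
  below a half once \<open>Phi\<close> is factored out; these \<open>Phi\<close> combine with the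
  Beta ratio into \<open>Zdir\<close>. The posterior parameters enter only through the law of the
  shares, so their normalisation is not presupposed and can be derived from this lemma.\<close>

lemma weighted_step:
  assumes v: "valid_params \<Theta>" and b: "valid_baseline \<mu> q\<^sub>0" and r: "regular_data \<Theta> \<mu> q\<^sub>0 n x" and A: "A \<in> rects"
    and E: "E \<in> sets draw_space"
    and G: "\<And>g j i. G g j i \<in> borel_measurable node_space"
    and dep: "\<And>g j i \<omega> \<omega>'. (\<And>b. b \<in> nodes_in (half A j i) \<Longrightarrow> \<omega> b = \<omega>' b) \<Longrightarrow> G g j i \<omega> = G g j i \<omega>'"
    and c: "\<And>g j i. (\<integral>\<^sup>+\<omega>. G g j i \<omega> * ennreal (lik \<mu> q\<^sub>0 n x (half A j i) (g, \<omega>)) \<partial>draws \<Theta>) =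
      ennreal (Phi \<Theta> \<mu> q\<^sub>0 n x (half A j i) g) * c g j i"
  shows "(\<integral>\<^sup>+\<omega>. indicator E (\<omega> (A, h)) * (if fst (\<omega> (A, h)) = Stop then 1
        else \<Prod>i\<in>UNIV. G (fst (\<omega> (A, h))) (fst (snd (\<omega> (A, h)))) i \<omega>) *
        ennreal (lik \<mu> q\<^sub>0 n x A (h, \<omega>)) \<partial>draws \<Theta>) =
    ennreal (trprob \<Theta> A h Stop * Z \<Theta> \<mu> q\<^sub>0 n x A Stop) * indicator E (Stop, undefined, undefined) +
    (\<Sum>g\<in>{Divide, Merge}. \<Sum>j\<in>UNIV. ennreal (trprob \<Theta> A h g * Zdir \<Theta> \<mu> q\<^sub>0 n x A g j) *
      (\<integral>\<^sup>+y. indicator E (g, j, y) \<partial>draw_split (posterior_params \<Theta> \<mu> q\<^sub>0 n x) A g j) * (\<Prod>i\<in>UNIV. c g j i))"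
proof -
  have q: "q\<^sub>0 \<in> borel_measurable borel" "\<And>x. 0 \<le> q\<^sub>0 x" using b by (auto simp: valid_baseline_def)
  note vn = valid_params_node[OF v A]
  let ?w = "node_weight \<Theta> \<mu> q\<^sub>0 n x A"
  let ?lik = "\<lambda>A h \<omega>. ennreal (lik \<mu> q\<^sub>0 n x A (h, \<omega>))"
  have "(\<integral>\<^sup>+\<omega>. indicator E (\<omega> (A, h)) * (if fst (\<omega> (A, h)) = Stop then 1
        else \<Prod>i\<in>UNIV. G (fst (\<omega> (A, h))) (fst (snd (\<omega> (A, h)))) i \<omega>) * ?lik A h \<omega> \<partial>draws \<Theta>) =
     (\<integral>\<^sup>+\<omega>. (\<lambda>z. indicator E z * ennreal (?w z)) (\<omega> (A, h)) * (if fst (\<omega> (A, h)) = Stop then 1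
        else \<Prod>i\<in>UNIV. (\<lambda>g j i \<omega>. G g j i \<omega> * ?lik (half A j i) g \<omega>) (fst (\<omega> (A, h))) (fst (snd (\<omega> (A, h)))) i \<omega>) \<partial>draws \<Theta>)"
    by (rule nn_integral_cong_AE, rule AE_mp[OF AE_proper[OF v]], rule AE_I2)
      (simp add: ennreal_lik_step[where q\<^sub>0=q\<^sub>0 and A=A and \<Theta>=\<Theta>, OF _ A q(2)] prod.distrib mult_ac)
  also have "\<dots> = ennreal (trprob \<Theta> A h Stop) * (indicator E (Stop, undefined, undefined) * ennreal (?w (Stop, undefined, undefined))) +
    (\<Sum>g\<in>{Divide, Merge}. \<Sum>j\<in>UNIV. ennreal (trprob \<Theta> A h g * dirp \<Theta> A g j) *
      (\<integral>\<^sup>+y. indicator E (g, j, y) * ennreal (?w (g, j, y)) \<partial>draw_split \<Theta> A g j) *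
      (\<Prod>i\<in>UNIV. \<integral>\<^sup>+\<omega>. G g j i \<omega> * ?lik (half A j i) g \<omega> \<partial>draws \<Theta>))"
  proof (rule nn_integral_draws_split[OF v A])
    show "(\<lambda>z. indicator E z * ennreal (?w z)) \<in> borel_measurable draw_space"
      using E measurable_node_weight[of \<Theta> \<mu> q\<^sub>0 n x A] by measurable
    show "(\<lambda>\<omega>. G g j i \<omega> * ?lik (half A j i) g \<omega>) \<in> borel_measurable node_space" for g j i
      by (intro borel_measurable_times_ennreal G measurable_compose[OF measurable_lik_fixed[OF half_in_rects[OF A] q(1)] measurable_ennreal])
    show "G g j i \<omega> * ?lik (half A j i) g \<omega> = G g j i \<omega>' * ?lik (half A j i) g \<omega>'"
      if "\<And>b. b \<in> nodes_in (half A j i) \<Longrightarrow> \<omega> b = \<omega>' b" for g j i \<omega> \<omega>'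
      using dep[OF that] same_run_lik[OF same_run_nodes_in[OF half_in_rects[OF A] that]] by simp
  qed
  also have "\<dots> = ennreal (trprob \<Theta> A h Stop * Z \<Theta> \<mu> q\<^sub>0 n x A Stop) * indicator E (Stop, undefined, undefined) +
    (\<Sum>g\<in>{Divide, Merge}. \<Sum>j\<in>UNIV. ennreal (trprob \<Theta> A h g * Zdir \<Theta> \<mu> q\<^sub>0 n x A g j) *
      (\<integral>\<^sup>+y. indicator E (g, j, y) \<partial>draw_split (posterior_params \<Theta> \<mu> q\<^sub>0 n x) A g j) * (\<Prod>i\<in>UNIV. c g j i))"
  proof (intro arg_cong2[where f="(+)"] sum.cong refl)
    show "ennreal (trprob \<Theta> A h Stop) * (indicator E (Stop, undefined, undefined) * ennreal (?w (Stop, undefined, undefined))) =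
      ennreal (trprob \<Theta> A h Stop * Z \<Theta> \<mu> q\<^sub>0 n x A Stop) * indicator E (Stop, undefined, undefined)"
      using vn by (simp add: node_weight_def valid_node_def ennreal_mult' mult_ac)
    fix g j assume g: "g \<in> {Divide, Merge}"
    let ?N = "\<lambda>t i. ncount n x t (half A j i)"
    have pos: "0 < pcount \<Theta> A g t j i" for t i using vn g by (auto simp: valid_node_def)
    have Phi: "0 < Phi \<Theta> \<mu> q\<^sub>0 n x (half A j i) g" for i using r half_in_rects[OF A] by (auto simp: regular_data_def)
    have nn: "0 \<le> trprob \<Theta> A h g" "0 \<le> dirp \<Theta> A g j" using vn g by (auto simp: valid_node_def)
    have "(\<integral>\<^sup>+y. indicator E (g, j, y) * ennreal (?w (g, j, y)) \<partial>draw_split \<Theta> A g j) =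
      (\<integral>\<^sup>+y. indicator E (g, j, y) * ennreal (split_lik ?N y) \<partial>draw_split \<Theta> A g j)"
      using g by (intro nn_integral_cong) (auto simp: node_weight_def)
    also have "\<dots> = ennreal (beta_ratio \<Theta> A g j ?N) *
        (\<integral>\<^sup>+y. indicator E (g, j, y) \<partial>draw_split (posterior_params \<Theta> \<mu> q\<^sub>0 n x) A g j)"
      using g pos E by (intro nn_integral_draw_split_conjugate)
        (auto simp: posterior_params_def intro!: measurable_compose[OF measurable_draw_Pair borel_measurable_indicator])
    finally show "ennreal (trprob \<Theta> A h g * dirp \<Theta> A g j) *
      (\<integral>\<^sup>+y. indicator E (g, j, y) * ennreal (?w (g, j, y)) \<partial>draw_split \<Theta> A g j) *
      (\<Prod>i\<in>UNIV. \<integral>\<^sup>+\<omega>. G g j i \<omega> * ?lik (half A j i) g \<omega> \<partial>draws \<Theta>) =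
      ennreal (trprob \<Theta> A h g * Zdir \<Theta> \<mu> q\<^sub>0 n x A g j) *
      (\<integral>\<^sup>+y. indicator E (g, j, y) \<partial>draw_split (posterior_params \<Theta> \<mu> q\<^sub>0 n x) A g j) * (\<Prod>i\<in>UNIV. c g j i)"
      using nn Phi beta_ratio_pos[of \<Theta> A g j ?N, OF pos]
      by (simp add: c prod.distrib Zdir_alt ennreal_mult prod_ennreal prod_nonneg less_imp_le mult_ac)
  qed
  finally show ?thesis .
qed

section \<open>Posterior parameters\<close>

lemma Z_nonneg_Stop: "(\<And>x. 0 \<le> q\<^sub>0 x) \<Longrightarrow> 0 \<le> Z \<Theta> \<mu> q\<^sub>0 n x A Stop"
  by (simp add: Z_def base_cond_nonneg prod_nonneg)

lemma regular_Phi_pos: "regular_data \<Theta> \<mu> q\<^sub>0 n x \<Longrightarrow> A \<in> rects \<Longrightarrow> 0 < Phi \<Theta> \<mu> q\<^sub>0 n x A g"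
  by (simp add: regular_data_def)

lemma Zdir_nonneg:
  assumes v: "valid_params \<Theta>" and r: "regular_data \<Theta> \<mu> q\<^sub>0 n x" and A: "A \<in> rects" and g: "g \<in> {Divide, Merge}"
  shows "0 \<le> Zdir \<Theta> \<mu> q\<^sub>0 n x A g j"
proof -
  have vn: "0 \<le> dirp \<Theta> A g j" "\<And>t i. 0 < pcount \<Theta> A g t j i"
    using valid_params_node[OF v A] g by (auto simp: valid_node_def)
  show ?thesis
    unfolding Zdir_alt
    using vn(1) beta_ratio_pos[of \<Theta> A g j, OF vn(2)] regular_Phi_pos[OF r half_in_rects[OF A]]
    by (intro mult_nonneg_nonneg prod_nonneg) (auto simp: less_imp_le)
qed

text \<open>Some direction has positive prior probability, and for it every factor of
  \<open>Zdir\<close> is positive. This justifies dividing by \<open>Z\<close> in the posterior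
  direction probabilities.\<close>

lemma Z_pos:
  assumes v: "valid_params \<Theta>" and r: "regular_data \<Theta> \<mu> q\<^sub>0 n x" and A: "A \<in> rects" and g: "g \<in> {Divide, Merge}"
  shows "0 < Z \<Theta> \<mu> q\<^sub>0 n x A g"
proof -
  have vn: "\<And>j. 0 \<le> dirp \<Theta> A g j" "(\<Sum>j\<in>UNIV. dirp \<Theta> A g j) = 1" "\<And>t j i. 0 < pcount \<Theta> A g t j i"
    using valid_params_node[OF v A] g by (auto simp: valid_node_def)
  obtain j where j: "0 < dirp \<Theta> A g j"
    using vn(1,2) by (metis less_eq_real_def sum.neutral zero_neq_one)
  have "0 < Zdir \<Theta> \<mu> q\<^sub>0 n x A g j"
    unfolding Zdir_alt
    using j beta_ratio_pos[of \<Theta> A g j, OF vn(3)] regular_Phi_pos[OF r half_in_rects[OF A]]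
    by (intro mult_pos_pos prod_pos) auto
  then have "0 < (\<Sum>j\<in>UNIV. Zdir \<Theta> \<mu> q\<^sub>0 n x A g j)"
    using Zdir_nonneg[OF v r A g] by (intro sum_pos2[of UNIV j]) auto
  then show ?thesis using g by (auto simp: Z_def)
qed

text \<open>\<open>weighted_step\<close> for the event that always holds. Divided by its left side,
  it says that the posterior transition probabilities out of \<open>h\<close> sum to one.\<close>

lemma Phi_recursion:
  fixes \<Theta> :: "'p::finite dmmt_params"
  assumes v: "valid_params \<Theta>" and b: "valid_baseline \<mu> q\<^sub>0" and r: "regular_data \<Theta> \<mu> q\<^sub>0 n x" and A: "A \<in> rects"
  shows "Phi \<Theta> \<mu> q\<^sub>0 n x A h = (\<Sum>g\<in>UNIV. trprob \<Theta> A h g * Z \<Theta> \<mu> q\<^sub>0 n x A g)"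
proof -
  have q: "\<And>x. 0 \<le> q\<^sub>0 x" using b by (auto simp: valid_baseline_def)
  note vn = valid_params_node[OF v A]
  have tr: "0 \<le> trprob \<Theta> A h g" for g using vn by (auto simp: valid_node_def)
  have one: "(\<integral>\<^sup>+y. indicator (space (draw_space :: 'p draw measure)) (g, j, y) \<partial>draw_split (posterior_params \<Theta> \<mu> q\<^sub>0 n x) A g j) = 1"
    if "g \<in> {Divide, Merge}" for g j
  proof -
    have "prob_space (draw_split (posterior_params \<Theta> \<mu> q\<^sub>0 n x) A g j)"
      using that vn by (intro prob_space_draw_split)
        (auto simp: posterior_params_def valid_node_def intro!: add_pos_nonneg)
    then show ?thesis using prob_space.emeasure_space_1 by (fastforce simp: space_draw_space)
  qed
  have "ennreal (Phi \<Theta> \<mu> q\<^sub>0 n x A h) = (\<integral>\<^sup>+\<omega>. ennreal (lik \<mu> q\<^sub>0 n x A (h, \<omega>)) \<partial>draws \<Theta>)"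
    by (rule nn_integral_lik_Phi[OF v b r A, symmetric])
  also have "\<dots> = (\<integral>\<^sup>+\<omega>. indicator (space (draw_space :: 'p draw measure)) (\<omega> (A, h)) * (if fst (\<omega> (A, h)) = Stop then 1
        else \<Prod>i\<in>(UNIV :: side set). 1) * ennreal (lik \<mu> q\<^sub>0 n x A (h, \<omega>)) \<partial>draws \<Theta>)"
    by (simp add: space_draw_space cong: if_cong)
  also have "\<dots> = ennreal (trprob \<Theta> A h Stop * Z \<Theta> \<mu> q\<^sub>0 n x A Stop) * indicator (space (draw_space :: 'p draw measure)) (Stop, undefined, undefined) +
    (\<Sum>g\<in>{Divide, Merge}. \<Sum>j\<in>UNIV. ennreal (trprob \<Theta> A h g * Zdir \<Theta> \<mu> q\<^sub>0 n x A g j) *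
      (\<integral>\<^sup>+y. indicator (space (draw_space :: 'p draw measure)) (g, j, y) \<partial>draw_split (posterior_params \<Theta> \<mu> q\<^sub>0 n x) A g j) * (\<Prod>i\<in>(UNIV::side set). 1))"
    by (rule weighted_step[OF v b r A, where G="\<lambda>_ _ _ _. 1" and c="\<lambda>_ _ _. 1"])
      (auto simp: nn_integral_lik_Phi[OF v b r half_in_rects[OF A]])
  also have "\<dots> = ennreal (trprob \<Theta> A h Stop * Z \<Theta> \<mu> q\<^sub>0 n x A Stop) +
    (\<Sum>g\<in>{Divide, Merge}. \<Sum>j\<in>UNIV. ennreal (trprob \<Theta> A h g * Zdir \<Theta> \<mu> q\<^sub>0 n x A g j))"
    using one by (simp add: space_draw_space)
  also have "\<dots> = ennreal (trprob \<Theta> A h Stop * Z \<Theta> \<mu> q\<^sub>0 n x A Stop) +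
    (\<Sum>g\<in>{Divide, Merge}. ennreal (trprob \<Theta> A h g * Z \<Theta> \<mu> q\<^sub>0 n x A g))"
    using Zdir_nonneg[OF v r A] tr by (simp add: Z_def sum_distrib_left[symmetric] sum_ennreal)
  also have "\<dots> = ennreal (\<Sum>g\<in>UNIV. trprob \<Theta> A h g * Z \<Theta> \<mu> q\<^sub>0 n x A g)"
    using tr Z_nonneg_Stop[of q\<^sub>0 \<Theta> \<mu> n x A, OF q] Z_pos[OF v r A]
    by (simp add: UNIV_state ennreal_plus[symmetric] less_imp_le add_ac del: ennreal_plus)
  finally show ?thesis
    using tr Z_nonneg_Stop[of q\<^sub>0 \<Theta> \<mu> n x A, OF q] Z_pos[OF v r A] regular_Phi_pos[OF r A, of h]
    by (subst (asm) ennreal_inj) (auto simp: UNIV_state less_imp_le intro!: add_nonneg_nonneg)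
qed

lemma valid_posterior_params:
  assumes v: "valid_params \<Theta>" and b: "valid_baseline \<mu> q\<^sub>0" and r: "regular_data \<Theta> \<mu> q\<^sub>0 n x"
  shows "valid_params (posterior_params \<Theta> \<mu> q\<^sub>0 n x)"
  unfolding valid_params_def
proof (intro ballI conjI allI)
  fix A :: "'a rect" assume A: "A \<in> rects"
  let ?P = "posterior_params \<Theta> \<mu> q\<^sub>0 n x"
  have q: "\<And>x. 0 \<le> q\<^sub>0 x" using b by (auto simp: valid_baseline_def)
  have Zn: "0 \<le> Z \<Theta> \<mu> q\<^sub>0 n x A g" for g
    using Z_nonneg_Stop[of q\<^sub>0 \<Theta> \<mu> n x A, OF q] Z_pos[OF v r A, of g] by (cases g) auto
  note P = regular_Phi_pos[OF r A]
  have vA: "\<And>h g. 0 \<le> trprob \<Theta> A h g" "trprob \<Theta> A Stop Divide = 0" "trprob \<Theta> A Stop Merge = 0" "trprob \<Theta> A Stop Stop = 1"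
    "\<And>g j t i. g \<in> {Divide, Merge} \<Longrightarrow> 0 < pcount \<Theta> A g t j i"
    "\<And>j i. pcount \<Theta> A Merge Grp1 j i = pcount \<Theta> A Merge Grp2 j i"
    using v A by (auto simp: valid_params_def)
  show "0 \<le> trprob ?P A h g" for h g
    using vA(1) Zn P by (simp add: posterior_params_def less_imp_le)
  show "(\<Sum>g\<in>UNIV. trprob ?P A h g) = 1" for h
  proof -
    have "(\<Sum>g\<in>UNIV. trprob ?P A h g) = (\<Sum>g\<in>UNIV. trprob \<Theta> A h g * Z \<Theta> \<mu> q\<^sub>0 n x A g) / Phi \<Theta> \<mu> q\<^sub>0 n x A h"
      by (simp add: posterior_params_def sum_divide_distrib)
    then show ?thesis using P[of h] unfolding Phi_recursion[OF v b r A, symmetric] by simp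
  qed
  show "trprob ?P A Stop Divide = 0" "trprob ?P A Stop Merge = 0"
    using vA by (simp_all add: posterior_params_def)
  \<comment> \<open>From a stopped parent only the Stop term of the recursion survives, so Stop
    remains absorbing.\<close>
  have "Phi \<Theta> \<mu> q\<^sub>0 n x A Stop = Z \<Theta> \<mu> q\<^sub>0 n x A Stop"
    unfolding Phi_recursion[OF v b r A] using vA by (simp add: UNIV_state)
  then show "trprob ?P A Stop Stop = 1"
    using vA P[of Stop] by (simp add: posterior_params_def)
  show "0 \<le> dirp ?P A g j" if "g \<in> {Divide, Merge}" for g j
    using Zdir_nonneg[OF v r A that] Zn by (simp add: posterior_params_def)
  show "(\<Sum>j\<in>UNIV. dirp ?P A g j) = 1" if "g \<in> {Divide, Merge}" for g
    using Z_pos[OF v r A that] that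
    by (auto simp: posterior_params_def sum_divide_distrib[symmetric] Z_def)
  show "0 < pcount ?P A g t j i" if "g \<in> {Divide, Merge}" for g t j i
    using vA(5)[OF that] by (auto simp: posterior_params_def intro!: add_pos_nonneg)
  show "pcount ?P A Merge Grp1 j i = pcount ?P A Merge Grp2 j i" for j i
    using vA(6) by (simp add: posterior_params_def)
qed

section \<open>Events of a run and telescoping along the tree\<close>

definition run_in :: "('p::finite rect \<times> state \<Rightarrow> 'p draw set) \<Rightarrow> 'p rect \<Rightarrow> state \<Rightarrow>
    ('p rect \<times> state \<Rightarrow> 'p draw) \<Rightarrow> bool" where
  "run_in E A h \<omega> \<longleftrightarrow> (\<forall>B h' m. reaches (h, \<omega>) A B h' m \<longrightarrow> \<omega> (B, h') \<in> E (B, h'))"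

lemma run_in_step:
  "run_in E A h \<omega> \<longleftrightarrow> \<omega> (A, h) \<in> E (A, h) \<and> (fst (\<omega> (A, h)) \<noteq> Stop \<longrightarrow>
     (\<forall>i. run_in E (half A (fst (snd (\<omega> (A, h)))) i) (fst (\<omega> (A, h))) \<omega>))"
proof -
  obtain g j y where z: "\<omega> (A, h) = (g, j, y)" by (cases "\<omega> (A, h)") auto
  show ?thesis
    unfolding z fst_conv snd_conv
  proof (intro iffI conjI impI allI)
    assume r: "run_in E A h \<omega>"
    show "(g, j, y) \<in> E (A, h)"
      using r reaches.start[of "(h, \<omega>)" A] z unfolding run_in_def by fastforce
    fix i assume "g \<noteq> Stop"
    then show "run_in E (half A j i) g \<omega>"
      using r reaches_prepend[of "(g, \<omega>)" A j i _ _ _ g \<omega> h y] z unfolding run_in_def by fastforce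
  next
    assume r: "(g, j, y) \<in> E (A, h) \<and> (g \<noteq> Stop \<longrightarrow> (\<forall>i. run_in E (half A j i) g \<omega>))"
    show "run_in E A h \<omega>"
      unfolding run_in_def
    proof (intro allI impI)
      fix B h' m assume "reaches (h, \<omega>) A B h' m"
      then consider "B = A" "h' = h" | i m' where "g \<noteq> Stop" "reaches (g, \<omega>) (half A j i) B h' m'"
        using z unfolding reaches_first_step[of h \<omega> A] by auto
      then show "\<omega> (B, h') \<in> E (B, h')"
        using r z by cases (auto simp: run_in_def)
    qed
  qed
qed

lemma run_in_cong:
  assumes "A \<in> rects" and eq: "\<And>b. b \<in> nodes_in A \<Longrightarrow> \<omega> b = \<omega>' b"
  shows "run_in E A h \<omega> = run_in E A h \<omega>'"
proof -
  have "reaches (h, \<omega>) A = reaches (h, \<omega>') A"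
    by (rule same_run_reaches[OF same_run_nodes_in[OF assms]])
  moreover have "\<omega> (B, h') = \<omega>' (B, h')" if "reaches (h, \<omega>') A B h' m" for B h' m
    using eq[OF reaches_in_nodes_in[OF that assms(1)]] .
  ultimately show ?thesis unfolding run_in_def by metis
qed

text \<open>Brings the event into the shape of the first-step formula: a condition on the root draw
  times one factor for each half.\<close>

lemma of_bool_run_in_step:
  "(of_bool (run_in E A h \<omega>) :: ennreal) = indicator (E (A, h)) (\<omega> (A, h)) *
     (if fst (\<omega> (A, h)) = Stop then 1
      else \<Prod>i\<in>UNIV. of_bool (run_in E (half A (fst (snd (\<omega> (A, h)))) i) (fst (\<omega> (A, h))) \<omega>))"
proof -
  have all: "(\<forall>i. P i) \<longleftrightarrow> P Lft \<and> P Rgt" for P by (metis side.exhaust)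
  show ?thesis by (subst run_in_step) (auto simp: indicator_def all UNIV_side)
qed

text \<open>Volume never grows along a run, so a run that starts below the cutoff meets no
  constraint.\<close>

lemma run_in_trivial:
  assumes "\<And>b. vol (fst b) \<le> \<epsilon> \<Longrightarrow> E b = UNIV" "A \<in> rects" "vol A \<le> \<epsilon>"
  shows "run_in E A h \<omega>"
  unfolding run_in_def
proof (intro allI impI)
  fix B h' m assume "reaches (h, \<omega>) A B h' m"
  from reaches_vol[OF this assms(2)] assms(3) have "vol (fst (B, h')) \<le> \<epsilon>" by simp
  from assms(1)[OF this] show "\<omega> (B, h') \<in> E (B, h')" by simp
qed

lemma measurable_run_in:
  assumes E: "\<And>b. E b \<in> sets draw_space" and small: "\<And>b. vol (fst b) \<le> \<epsilon> \<Longrightarrow> E b = UNIV"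
    and A: "A \<in> rects" "vol A * (1/2) ^ d \<le> \<epsilon>"
  shows "(\<lambda>\<omega>. of_bool (run_in E A h \<omega>) :: ennreal) \<in> borel_measurable node_space"
  using A
proof (induction d arbitrary: A h)
  case 0
  have "run_in E A h \<omega>" for \<omega> using 0 by (intro run_in_trivial[OF small]) auto
  then show ?case by simp
next
  case (Suc d)
  have c: "(\<lambda>\<omega>. \<omega> (A, h)) \<in> node_space \<rightarrow>\<^sub>M draw_space"
    using Suc.prems by (intro measurable_node_coord) auto
  have IH: "(\<lambda>\<omega>. of_bool (run_in E (half A j i) g \<omega>) :: ennreal) \<in> borel_measurable node_space" for g j i
    using Suc.prems by (intro Suc.IH half_in_rects) (auto simp: vol_half)
  have "(\<lambda>\<omega>. (\<lambda>g j \<omega>. if g = Stop then 1 else \<Prod>i\<in>UNIV. of_bool (run_in E (half A j i) g \<omega>) :: ennreal)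
      (fst (\<omega> (A, h))) (fst (snd (\<omega> (A, h)))) \<omega>) \<in> borel_measurable node_space"
  proof (rule measurable_at_draw[OF c])
    fix g :: state and j :: 'a
    show "(\<lambda>\<omega>. if g = Stop then 1 else \<Prod>i\<in>UNIV. of_bool (run_in E (half A j i) g \<omega>) :: ennreal) \<in> borel_measurable node_space"
      using borel_measurable_prod_ennreal[of UNIV "\<lambda>i \<omega>. of_bool (run_in E (half A j i) g \<omega>)", OF IH]
      by (cases "g = Stop") simp_all
  qed
  moreover have "(\<lambda>\<omega>. indicator (E (A, h)) (\<omega> (A, h)) :: ennreal) \<in> borel_measurable node_space"
    by (rule measurable_compose[OF c borel_measurable_indicator[OF E]])
  ultimately show ?case
    by (subst of_bool_run_in_step) (rule borel_measurable_times_ennreal)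
qed

text \<open>Induction on a number \<open>d\<close> of halvings that brings the volume below the
  cutoff. At the bottom the event is trivial and the whole remaining likelihood, of unbounded depth,
  integrates to \<open>Phi\<close>. Above, the first-step formulas for prior and posterior have the
  same form, and their coefficients differ exactly by the factor \<open>Phi\<close> at
  \<open>A\<close>.\<close>

lemma nn_integral_run_in_lik:
  assumes v: "valid_params \<Theta>" and b: "valid_baseline \<mu> q\<^sub>0" and r: "regular_data \<Theta> \<mu> q\<^sub>0 n x"
    and E: "\<And>b. E b \<in> sets draw_space" and small: "\<And>b. vol (fst b) \<le> \<epsilon> \<Longrightarrow> E b = UNIV"
    and A: "A \<in> rects" "vol A * (1/2) ^ d \<le> \<epsilon>"
  shows "(\<integral>\<^sup>+\<omega>. of_bool (run_in E A h \<omega>) * ennreal (lik \<mu> q\<^sub>0 n x A (h, \<omega>)) \<partial>draws \<Theta>) =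
    ennreal (Phi \<Theta> \<mu> q\<^sub>0 n x A h) * (\<integral>\<^sup>+\<omega>. of_bool (run_in E A h \<omega>) \<partial>draws (posterior_params \<Theta> \<mu> q\<^sub>0 n x))"
  using A
proof (induction d arbitrary: A h)
  case 0
  let ?D = "draws (posterior_params \<Theta> \<mu> q\<^sub>0 n x)"
  have "run_in E A h \<omega>" for \<omega> using 0 by (intro run_in_trivial[OF small]) auto
  moreover have "emeasure ?D (space ?D) = 1"
    by (rule prob_space.emeasure_space_1[OF prob_space_draws[OF valid_posterior_params[OF v b r]]])
  ultimately show ?case using nn_integral_lik_Phi[OF v b r 0(1)] by simp
next
  case (Suc d)
  note A = Suc.prems(1)
  let ?P = "posterior_params \<Theta> \<mu> q\<^sub>0 n x"
  let ?G = "\<lambda>g j i \<omega>. of_bool (run_in E (half A j i) g \<omega>) :: ennreal"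
  let ?c = "\<lambda>g j i. \<integral>\<^sup>+\<omega>. ?G g j i \<omega> \<partial>draws ?P"
  note vP = valid_posterior_params[OF v b r]
  have q: "\<And>x. 0 \<le> q\<^sub>0 x" using b by (auto simp: valid_baseline_def)
  have small_half: "vol (half A j i) * (1/2) ^ d \<le> \<epsilon>" for j i using Suc.prems by (simp add: vol_half)
  have G: "?G g j i \<in> borel_measurable node_space" for g j i
    by (rule measurable_run_in[OF E small half_in_rects[OF A] small_half])
  have dep: "?G g j i \<omega> = ?G g j i \<omega>'" if "\<And>b. b \<in> nodes_in (half A j i) \<Longrightarrow> \<omega> b = \<omega>' b" for g j i \<omega> \<omega>'
    using run_in_cong[OF half_in_rects[OF A] that] by simp
  have c: "(\<integral>\<^sup>+\<omega>. ?G g j i \<omega> * ennreal (lik \<mu> q\<^sub>0 n x (half A j i) (g, \<omega>)) \<partial>draws \<Theta>) =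
      ennreal (Phi \<Theta> \<mu> q\<^sub>0 n x (half A j i) g) * ?c g j i" for g j i
    by (rule Suc.IH[OF half_in_rects[OF A] small_half])
  let ?I = "\<lambda>g j. \<integral>\<^sup>+y. indicator (E (A, h)) (g, j, y) \<partial>draw_split ?P A g j"
  have L: "(\<integral>\<^sup>+\<omega>. of_bool (run_in E A h \<omega>) * ennreal (lik \<mu> q\<^sub>0 n x A (h, \<omega>)) \<partial>draws \<Theta>) =
    ennreal (trprob \<Theta> A h Stop * Z \<Theta> \<mu> q\<^sub>0 n x A Stop) * indicator (E (A, h)) (Stop, undefined, undefined) +
    (\<Sum>g\<in>{Divide, Merge}. \<Sum>j\<in>UNIV. ennreal (trprob \<Theta> A h g * Zdir \<Theta> \<mu> q\<^sub>0 n x A g j) *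
      ?I g j * (\<Prod>i\<in>UNIV. ?c g j i))"
    unfolding of_bool_run_in_step[of E A h]
    by (rule weighted_step[OF v b r A E G dep c])
  have R: "(\<integral>\<^sup>+\<omega>. of_bool (run_in E A h \<omega>) \<partial>draws ?P) =
    ennreal (trprob ?P A h Stop) * indicator (E (A, h)) (Stop, undefined, undefined) +
    (\<Sum>g\<in>{Divide, Merge}. \<Sum>j\<in>UNIV. ennreal (trprob ?P A h g * dirp ?P A g j) *
      ?I g j * (\<Prod>i\<in>UNIV. ?c g j i))"
    unfolding of_bool_run_in_step[of E A h]
    by (rule nn_integral_draws_split[OF vP A borel_measurable_indicator[OF E] G dep])
  have Phi: "0 < Phi \<Theta> \<mu> q\<^sub>0 n x A h" by (rule regular_Phi_pos[OF r A])
  have tr: "0 \<le> trprob \<Theta> A h g" for g using valid_params_node[OF v A] by (auto simp: valid_node_def)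
  \<comment> \<open>\<open>Phi\<close> cancels against the denominator of the posterior transition
    probability; in the identity after this one \<open>Z\<close> cancels as well, between transition
    and direction.\<close>
  have s: "ennreal (Phi \<Theta> \<mu> q\<^sub>0 n x A h) * ennreal (trprob ?P A h Stop) = ennreal (trprob \<Theta> A h Stop * Z \<Theta> \<mu> q\<^sub>0 n x A Stop)"
    using Phi by (simp add: posterior_params_def ennreal_mult'[symmetric])
  have d: "ennreal (Phi \<Theta> \<mu> q\<^sub>0 n x A h) * ennreal (trprob ?P A h g * dirp ?P A g j) =
    ennreal (trprob \<Theta> A h g * Zdir \<Theta> \<mu> q\<^sub>0 n x A g j)" if "g \<in> {Divide, Merge}" for g j
    using Phi Z_pos[OF v r A that] by (simp add: posterior_params_def ennreal_mult'[symmetric])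
  show ?case
    unfolding L R distrib_left sum_distrib_left
    by (intro arg_cong2[where f="(+)"] sum.cong refl) (simp_all add: s d mult.assoc[symmetric])
qed

section \<open>The law of the run\<close>

lemma baseline_D:
  assumes "valid_baseline \<mu> q\<^sub>0"
  shows "sigma_finite_measure \<mu>" "sets \<mu> = sets borel" "space \<mu> = UNIV" "q\<^sub>0 \<in> borel_measurable borel"
    "\<And>x. 0 \<le> q\<^sub>0 x" "prob_space (baseline \<mu> q\<^sub>0)"
  using assms sets_eq_imp_space_eq[of \<mu> borel] by (auto simp: valid_baseline_def)

lemma sets_baseline [simp]: "sets (baseline \<mu> q\<^sub>0) = sets \<mu>"
  by (simp add: baseline_def)

lemma prob_space_density_iff:
  assumes "f \<in> borel_measurable M"
  shows "prob_space (density M f) \<longleftrightarrow> (\<integral>\<^sup>+x. f x \<partial>M) = 1"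
proof -
  have "emeasure (density M f) (space (density M f)) = (\<integral>\<^sup>+x. f x \<partial>M)"
    using assms by (subst emeasure_density) (auto intro!: nn_integral_cong simp: indicator_def)
  then show ?thesis using prob_space.emeasure_space_1 prob_spaceI by metis
qed

lemma dens_borel:
  assumes "A \<in> rects" "q\<^sub>0 \<in> borel_measurable borel" "\<omega> \<in> space node_space"
  shows "dens \<mu> q\<^sub>0 A (h, \<omega>) t \<in> borel_measurable borel"
  using measurable_Pair2[OF measurable_dens[OF assms(1,2), of \<mu> h t] assms(3)] by simp

lemma space_outcome: "w \<in> space outcome_space \<Longrightarrow> snd w \<in> space node_space"
  by (auto simp: space_pair_measure)

lemma dens_borel':
  assumes "A \<in> rects" "q\<^sub>0 \<in> borel_measurable borel" "w \<in> space outcome_space"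
  shows "dens \<mu> q\<^sub>0 A w t \<in> borel_measurable borel"
  using dens_borel[OF assms(1,2) space_outcome[OF assms(3)], of \<mu> "fst w" t] by simp

lemma measurable_stopped: 
  assumes "A \<in> rects"
  shows "Measurable.pred (node_space \<Otimes>\<^sub>M borel) (\<lambda>p. \<exists>B m. stops (h, fst p) A B m \<and> snd p \<in> cell B)"
  unfolding ex_stops_iff[OF assms] using measurable_stopped_by[OF assms] by measurable

lemma sets_stopped:
  assumes "A \<in> rects" "\<omega> \<in> space node_space"
  shows "{x. \<exists>B m. stops (h, \<omega>) A B m \<and> x \<in> cell B} \<in> sets borel"
  using measurable_Pair2[OF measurable_stopped[OF assms(1), of h] assms(2)]
  by (simp add: pred_def)

text \<open>Expresses an almost-everywhere claim and a normalisation by values of integrals over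
  \<open>x\<close>; their measurability in the outcome then follows from joint
  measurability.\<close>

lemma yields_pair_alt:
  fixes \<mu> :: "(real^'p::finite) measure"
  assumes b: "valid_baseline \<mu> q\<^sub>0" and w: "\<omega> \<in> space node_space"
  shows "yields_pair \<mu> q\<^sub>0 (h, \<omega>) \<longleftrightarrow>
    (\<integral>\<^sup>+x. of_bool (x \<in> cell unit_rect \<and> \<not> (\<exists>B m. stops (h, \<omega>) unit_rect B m \<and> x \<in> cell B)) \<partial>\<mu>) = 0 \<and>
    (\<forall>t. (\<integral>\<^sup>+x. ennreal (dens \<mu> q\<^sub>0 unit_rect (h, \<omega>) t x) \<partial>\<mu>) = 1)"
proof -
  note B = baseline_D[OF b]
  let ?S = "{x. \<exists>B m. stops (h, \<omega>) unit_rect B m \<and> x \<in> cell B}"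
  have S: "?S \<in> sets \<mu>" using sets_stopped[OF unit_rect_in_rects w, of h] B(2) by simp
  have C: "cell unit_rect \<in> sets \<mu>" using B(2) by simp
  have "{x \<in> space \<mu>. x \<in> cell unit_rect \<longrightarrow> (\<exists>B m. stops (h, \<omega>) unit_rect B m \<and> x \<in> cell B)} = (UNIV - cell unit_rect) \<union> ?S"
    using B(3) by auto
  also have "\<dots> \<in> sets \<mu>" using S C B(3) sets.top[of \<mu>] by auto
  finally have "(AE x in \<mu>. x \<in> cell unit_rect \<longrightarrow> (\<exists>B m. stops (h, \<omega>) unit_rect B m \<and> x \<in> cell B)) \<longleftrightarrow>
    (\<integral>\<^sup>+x. of_bool (x \<in> cell unit_rect \<and> \<not> (\<exists>B m. stops (h, \<omega>) unit_rect B m \<and> x \<in> cell B)) \<partial>\<mu>) = 0"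
    by (subst AE_iff_nn_integral) (auto simp: indicator_def of_bool_def intro!: arg_cong2[where f="(=)"] nn_integral_cong)
  moreover have "(\<lambda>x. ennreal (dens \<mu> q\<^sub>0 unit_rect (h, \<omega>) t x)) \<in> borel_measurable \<mu>" for t
    using measurable_compose[OF dens_borel[OF unit_rect_in_rects B(4) w, of \<mu> h t] measurable_ennreal]
    unfolding measurable_cong_sets[OF B(2) refl] by simp
  ultimately show ?thesis unfolding yields_pair_def by (simp add: prob_space_density_iff)
qed

lemma measurable_yields_pair:
  assumes b: "valid_baseline \<mu> q\<^sub>0"
  shows "Measurable.pred outcome_space (yields_pair \<mu> q\<^sub>0)"
proof (rule measurable_outcome)
  fix h
  note B = baseline_D[OF b]
  interpret sigma_finite_measure \<mu> by (rule B(1))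
  have eq: "sets (node_space \<Otimes>\<^sub>M \<mu>) = sets (node_space \<Otimes>\<^sub>M borel)"
    by (intro sets_pair_measure_cong refl B(2))
  have c: "Measurable.pred (node_space \<Otimes>\<^sub>M borel) (\<lambda>p. snd p \<in> cell unit_rect)" by measurable
  have 1: "(\<lambda>\<omega>. \<integral>\<^sup>+x. of_bool (x \<in> cell unit_rect \<and> \<not> (\<exists>B m. stops (h, \<omega>) unit_rect B m \<and> x \<in> cell B)) \<partial>\<mu>)
    \<in> borel_measurable node_space"
  proof (rule borel_measurable_nn_integral)
    have "Measurable.pred (node_space \<Otimes>\<^sub>M borel) (\<lambda>p. snd p \<in> cell unit_rect \<and>
       \<not> (\<exists>B m. stops (h, fst p) unit_rect B m \<and> snd p \<in> cell B))"
      using c measurable_stopped[OF unit_rect_in_rects, of h] by (rule pred_intros_logic(3)[OF _ pred_intros_logic(2)])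
    then show "(\<lambda>(\<omega>, x). of_bool (x \<in> cell unit_rect \<and> \<not> (\<exists>B m. stops (h, \<omega>) unit_rect B m \<and> x \<in> cell B)))
      \<in> borel_measurable (node_space \<Otimes>\<^sub>M \<mu>)"
      unfolding measurable_cong_sets[OF eq refl] case_prod_beta by (rule measurable_compose) simp
  qed
  have 2: "(\<lambda>\<omega>. \<integral>\<^sup>+x. ennreal (dens \<mu> q\<^sub>0 unit_rect (h, \<omega>) t x) \<partial>\<mu>) \<in> borel_measurable node_space" for t
  proof (rule borel_measurable_nn_integral)
    show "(\<lambda>(\<omega>, x). ennreal (dens \<mu> q\<^sub>0 unit_rect (h, \<omega>) t x)) \<in> borel_measurable (node_space \<Otimes>\<^sub>M \<mu>)"
      unfolding measurable_cong_sets[OF eq refl]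
      using measurable_compose[OF measurable_dens[OF unit_rect_in_rects B(4), of \<mu> h t] measurable_ennreal]
      by (simp add: case_prod_beta)
  qed
  note [measurable] = 1 2
  have "Measurable.pred node_space (\<lambda>\<omega>.
    (\<integral>\<^sup>+x. of_bool (x \<in> cell unit_rect \<and> \<not> (\<exists>B m. stops (h, \<omega>) unit_rect B m \<and> x \<in> cell B)) \<partial>\<mu>) = 0 \<and>
    (\<forall>t. (\<integral>\<^sup>+x. ennreal (dens \<mu> q\<^sub>0 unit_rect (h, \<omega>) t x) \<partial>\<mu>) = 1))"
    by measurable
  then show "Measurable.pred node_space (\<lambda>\<omega>. yields_pair \<mu> q\<^sub>0 (h, \<omega>))"
    by (subst measurable_cong[OF yields_pair_alt[OF b]])
qed

lemma dmmt_pair_component: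
  assumes b: "valid_baseline \<mu> q\<^sub>0"
  shows "prob_space (dmmt_pair \<mu> q\<^sub>0 w t)" "sets (dmmt_pair \<mu> q\<^sub>0 w t) = sets borel"
  using baseline_D[OF b] by (auto simp: dmmt_pair_def yields_pair_def)

text \<open>The sigma-algebra on probability measures is generated by evaluation at sets, so it
  suffices that the mass of each Borel set is measurable. That mass is the integral over
  \<open>x\<close> of a jointly measurable function, or a constant where the procedure
  fails.\<close>

lemma measurable_dmmt_pair:
  assumes b: "valid_baseline \<mu> q\<^sub>0"
  shows "dmmt_pair \<mu> q\<^sub>0 \<in> outcome_space \<rightarrow>\<^sub>M pair_space"
proof -
  note B = baseline_D[OF b]
  interpret sigma_finite_measure \<mu> by (rule B(1))
  have eq: "sets (node_space \<Otimes>\<^sub>M \<mu>) = sets (node_space \<Otimes>\<^sub>M borel)"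
    by (intro sets_pair_measure_cong refl B(2))
  have comp: "(\<lambda>w. dmmt_pair \<mu> q\<^sub>0 w t) \<in> outcome_space \<rightarrow>\<^sub>M prob_algebra borel" for t
  proof (rule measurable_prob_algebraI, rule dmmt_pair_component(1)[OF b], rule measurable_subprob_algebra)
    show "subprob_space (dmmt_pair \<mu> q\<^sub>0 w t)" for w
      by (rule prob_space_imp_subprob_space[OF dmmt_pair_component(1)[OF b]])
    show "sets (dmmt_pair \<mu> q\<^sub>0 w t) = sets borel" for w
      by (rule dmmt_pair_component(2)[OF b])
    fix S :: "(real^'a) set" assume S: "S \<in> sets borel"
    have m: "(\<lambda>w. \<integral>\<^sup>+x. ennreal (dens \<mu> q\<^sub>0 unit_rect w t x) * indicator S x \<partial>\<mu>) \<in> borel_measurable outcome_space"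
    proof (rule measurable_outcome, rule borel_measurable_nn_integral)
      fix h
      show "(\<lambda>(\<omega>, x). ennreal (dens \<mu> q\<^sub>0 unit_rect (h, \<omega>) t x) * indicator S x) \<in> borel_measurable (node_space \<Otimes>\<^sub>M \<mu>)"
        unfolding measurable_cong_sets[OF eq refl] case_prod_beta
        by (intro borel_measurable_times_ennreal measurable_compose[OF measurable_snd borel_measurable_indicator[OF S]]
          measurable_compose[OF measurable_dens[OF unit_rect_in_rects B(4)] measurable_ennreal])
    qed
    have "emeasure (dmmt_pair \<mu> q\<^sub>0 w t) S = (if yields_pair \<mu> q\<^sub>0 w
        then \<integral>\<^sup>+x. ennreal (dens \<mu> q\<^sub>0 unit_rect w t x) * indicator S x \<partial>\<mu> else emeasure (baseline \<mu> q\<^sub>0) S)"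
      if w: "w \<in> space outcome_space" for w
    proof -
      have "(\<lambda>x. ennreal (dens \<mu> q\<^sub>0 unit_rect w t x)) \<in> borel_measurable \<mu>"
        unfolding measurable_cong_sets[OF B(2) refl]
        using measurable_compose[OF dens_borel'[OF unit_rect_in_rects B(4) w, of \<mu> t] measurable_ennreal] by simp
      then show ?thesis using S B(2) by (simp add: dmmt_pair_def emeasure_density)
    qed
    then show "(\<lambda>w. emeasure (dmmt_pair \<mu> q\<^sub>0 w t) S) \<in> borel_measurable outcome_space"
      using measurable_If[OF m borel_measurable_const measurable_yields_pair[OF b, unfolded pred_def]]
      by (simp cong: measurable_cong)
  qed
  have "(\<lambda>w t. dmmt_pair \<mu> q\<^sub>0 w t) \<in> outcome_space \<rightarrow>\<^sub>M pair_space"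
    unfolding pair_space_def
    by (rule measurable_PiM_single'[OF comp]) (use measurable_space[OF comp] in auto)
  then show ?thesis by simp
qed

text \<open>
  Requiring membership only of the visited entries makes these sets closed under intersection and
  lets their probabilities factor along the tree.
\<close>

definition run_event :: "state set \<Rightarrow> ('p::finite rect \<times> state \<Rightarrow> 'p draw set) \<Rightarrow> 'p outcome set" where
  "run_event H E = {w. fst w \<in> H \<and> run_in E unit_rect (fst w) (snd w)}"

text \<open>The cutoff \<epsilon> leaves constraints on finitely many rectangles of
  \<open>rects\<close>, so that inductions on depth end.\<close>

definition run_events :: "'p::finite outcome set set" where
  "run_events = {run_event H E | H E. (\<forall>b. E b \<in> sets draw_space) \<and>
     (\<exists>\<epsilon>>0. \<forall>b. vol (fst b) \<le> \<epsilon> \<longrightarrow> E b = UNIV)}"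

text \<open>Coarser than \<open>outcome_space\<close>, as unvisited entries are invisible to it.
  This is where the reweighted prior and the posterior process can be equal.\<close>

definition run_space :: "'p::finite outcome measure" where
  "run_space = sigma UNIV run_events"

lemma sets_run_space: "sets run_space = sigma_sets UNIV run_events"
  by (simp add: run_space_def)

lemma space_run_space [simp]: "space run_space = UNIV"
  by (simp add: run_space_def)

lemma Int_stable_run_events: "Int_stable (run_events :: 'p::finite outcome set set)"
proof (rule Int_stableI)
  fix X Y :: "'p outcome set" assume "X \<in> run_events" "Y \<in> run_events"
  then obtain H E \<epsilon> H' E' \<epsilon>' where
    X: "X = run_event H E" "\<And>b. E b \<in> sets draw_space" "0 < \<epsilon>" "\<And>b. vol (fst b) \<le> \<epsilon> \<Longrightarrow> E b = UNIV" and
    Y: "Y = run_event H' E'" "\<And>b. E' b \<in> sets draw_space" "0 < \<epsilon>'" "\<And>b. vol (fst b) \<le> \<epsilon>' \<Longrightarrow> E' b = UNIV"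
    unfolding run_events_def by blast
  have "X \<inter> Y = run_event (H \<inter> H') (\<lambda>b. E b \<inter> E' b)"
    unfolding X(1) Y(1) run_event_def run_in_def by blast
  moreover have "\<forall>b. E b \<inter> E' b \<in> sets draw_space" using X(2) Y(2) by blast
  moreover have "\<exists>\<delta>>0. \<forall>b. vol (fst b) \<le> \<delta> \<longrightarrow> E b \<inter> E' b = UNIV"
    using X(3,4) Y(3,4) by (intro exI[of _ "min \<epsilon> \<epsilon>'"]) auto
  ultimately show "X \<inter> Y \<in> run_events" unfolding run_events_def by blast
qed

lemma run_events_I:
  "(\<And>b. E b \<in> sets draw_space) \<Longrightarrow> 0 < \<epsilon> \<Longrightarrow> (\<And>b. vol (fst b) \<le> \<epsilon> \<Longrightarrow> E b = UNIV) \<Longrightarrow> run_event H E \<in> run_events"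
  unfolding run_events_def by blast

lemma UNIV_in_sets_draw_space: "UNIV \<in> sets draw_space"
  using sets.top[of draw_space] by (simp add: space_draw_space)

lemma UNIV_run_events: "(UNIV :: 'p::finite outcome set) \<in> run_events"
proof -
  have "run_event UNIV (\<lambda>_. UNIV) = (UNIV :: 'p outcome set)" by (auto simp: run_event_def run_in_def)
  moreover have "run_event UNIV (\<lambda>_. UNIV) \<in> (run_events :: 'p outcome set set)"
    by (rule run_events_I[where \<epsilon>=1]) (simp_all add: UNIV_in_sets_draw_space)
  ultimately show ?thesis by simp
qed

lemma ex_halvings: "0 < \<epsilon> \<Longrightarrow> \<exists>d. v * (1/2) ^ d \<le> (\<epsilon> :: real)"
proof -
  assume "0 < \<epsilon>"
  have "(\<lambda>d. v * (1/2) ^ d) \<longlonglongrightarrow> v * 0" by (intro tendsto_intros LIMSEQ_realpow_zero) auto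
  then have "eventually (\<lambda>d. v * (1/2) ^ d < \<epsilon>) sequentially"
    using \<open>0 < \<epsilon>\<close> by (intro order_tendstoD) auto
  then show ?thesis unfolding eventually_sequentially by (meson less_imp_le order_refl)
qed

lemma measurable_run_event:
  assumes E: "\<And>b. E b \<in> sets draw_space" and "0 < \<epsilon>" and small: "\<And>b. vol (fst b) \<le> \<epsilon> \<Longrightarrow> E b = UNIV"
  shows "(indicator (run_event H E) :: _ \<Rightarrow> ennreal) \<in> borel_measurable outcome_space"
proof (rule measurable_outcome)
  fix h
  obtain d where "vol (unit_rect :: 'a rect) * (1/2) ^ d \<le> \<epsilon>" using ex_halvings[OF \<open>0 < \<epsilon>\<close>] by blast
  from measurable_run_in[of E \<epsilon>, OF E small unit_rect_in_rects this, of h]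
  have "(\<lambda>\<omega>. indicator H h * of_bool (run_in E unit_rect h \<omega>) :: ennreal) \<in> borel_measurable node_space"
    by (intro borel_measurable_times_ennreal borel_measurable_const)
  also have "(\<lambda>\<omega>. indicator H h * of_bool (run_in E unit_rect h \<omega>) :: ennreal) = (\<lambda>\<omega>. indicator (run_event H E) (h, \<omega>))"
    by (auto simp: run_event_def indicator_def)
  finally show "(\<lambda>\<omega>. indicator (run_event H E) (h, \<omega>) :: ennreal) \<in> borel_measurable node_space" .
qed

lemma measurable_id_run_space: "(\<lambda>w. w) \<in> outcome_space \<rightarrow>\<^sub>M run_space"
  unfolding run_space_def
proof (rule measurable_measure_of)
  fix X :: "'a outcome set" assume "X \<in> run_events"
  then obtain H E \<epsilon> where X: "X = run_event H E" "\<And>b. E b \<in> sets draw_space" "0 < \<epsilon>" "\<And>b. vol (fst b) \<le> \<epsilon> \<Longrightarrow> E b = UNIV"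
    unfolding run_events_def by blast
  from measurable_run_event[where E=E and \<epsilon>=\<epsilon> and H=H, OF X(2-4)] show "(\<lambda>w. w) -` X \<inter> space outcome_space \<in> sets outcome_space"
    unfolding X(1) borel_measurable_indicator_iff by simp
qed auto

text \<open>A canonical representative: overwriting the unvisited entries by a fixed value leaves a
  function of the run alone. Composition with it turns measurability on \<open>outcome_space\<close>
  of anything invariant under \<open>same_run\<close> into measurability on
  \<open>run_space\<close>.\<close>

definition prune :: "'p::finite outcome \<Rightarrow> 'p outcome" where
  "prune w = (fst w, \<lambda>b\<in>all_nodes. if \<exists>m. reaches w unit_rect (fst b) (snd b) m then snd w b else (Stop, undefined, undefined))"

lemma same_run_prune: "same_run unit_rect w (prune w)"
  unfolding same_run_def
proof (intro conjI allI impI)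
  fix B h m assume r: "reaches w unit_rect B h m"
  then have "B \<in> rects" by (rule reaches_in_rects[OF _ unit_rect_in_rects])
  then show "snd w (B, h) = snd (prune w) (B, h)" using r by (auto simp: prune_def)
qed (simp add: prune_def)

lemma measurable_prune: "(prune :: 'p::finite outcome \<Rightarrow> _) \<in> run_space \<rightarrow>\<^sub>M outcome_space"
proof -
  let ?c = "\<lambda>(b :: 'p rect \<times> state) w. if \<exists>m. reaches w unit_rect (fst b) (snd b) m then snd w b
    else (Stop, undefined, undefined :: grp \<Rightarrow> real)"
  have fst: "(fst :: 'p outcome \<Rightarrow> state) \<in> run_space \<rightarrow>\<^sub>M count_space UNIV"
  proof (rule measurableI)
    fix H :: "state set"
    have "(fst -` H :: 'p outcome set) = run_event H (\<lambda>_. UNIV)" by (auto simp: run_event_def run_in_def)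
    also have "\<dots> \<in> run_events" using run_events_I[of "\<lambda>_. UNIV" 1 H] UNIV_in_sets_draw_space by simp
    finally show "fst -` H \<inter> space (run_space :: 'p outcome measure) \<in> sets run_space" by (auto simp: sets_run_space)
  qed auto
  have vis: "{w. (\<exists>m. reaches w unit_rect (fst b) (snd b) m) \<longrightarrow> snd w b \<in> D} \<in> sets run_space"
    if b: "b \<in> all_nodes" and D: "D \<in> sets draw_space" for b :: "'p rect \<times> state" and D
  proof -
    have "run_in (\<lambda>b'. if b' = b then D else UNIV) unit_rect (fst w) (snd w) \<longleftrightarrow>
        ((\<exists>m. reaches w unit_rect (fst b) (snd b) m) \<longrightarrow> snd w b \<in> D)" for w
      unfolding run_in_def by (cases b) auto
    then have "{w. (\<exists>m. reaches w unit_rect (fst b) (snd b) m) \<longrightarrow> snd w b \<in> D} = run_event UNIV (\<lambda>b'. if b' = b then D else UNIV)"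
      by (simp add: run_event_def)
    also have "\<dots> \<in> run_events"
    proof (rule run_events_I)
      \<comment> \<open>Half the volume of the constrained rectangle serves as cutoff: it is
        positive, and the constrained entry itself stays above it.\<close>
      have "0 < vol (fst b)" using b vol_pos by auto
      then show "0 < vol (fst b) / 2" by simp
      show "(if b' = b then D else UNIV) = UNIV" if "vol (fst b') \<le> vol (fst b) / 2" for b'
        using that \<open>0 < vol (fst b)\<close> by auto
    qed (use D UNIV_in_sets_draw_space in auto)
    finally show ?thesis by (auto simp: sets_run_space)
  qed
  have coord: "?c b \<in> run_space \<rightarrow>\<^sub>M draw_space" if b: "b \<in> all_nodes" for b
  proof (rule measurableI)
    fix D :: "'p draw set" assume D: "D \<in> sets draw_space"
    let ?V = "\<lambda>D. {w. (\<exists>m. reaches w unit_rect (fst b) (snd b) m) \<longrightarrow> snd w b \<in> D}"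
    \<comment> \<open>\<open>?V {}\<close> is the event that \<open>b\<close> is not visited.
      Unvisited entries receive the placeholder, so they belong to the preimage exactly if the
      placeholder is in \<open>D\<close>.\<close>
    have "?c b -` D = (if (Stop, undefined, undefined) \<in> D then ?V D else ?V D - ?V {})"
    proof (rule set_eqI)
      fix w
      show "w \<in> ?c b -` D \<longleftrightarrow> w \<in> (if (Stop, undefined, undefined) \<in> D then ?V D else ?V D - ?V {})"
        by (cases "\<exists>m. reaches w unit_rect (fst b) (snd b) m") (simp_all, blast)
    qed
    also have "\<dots> \<in> sets run_space" using vis[OF b D] vis[OF b sets.empty_sets] by simp
    finally show "?c b -` D \<inter> space run_space \<in> sets run_space" by simp
  qed (simp add: space_draw_space)
  have "(\<lambda>w. \<lambda>b\<in>all_nodes. ?c b w) \<in> run_space \<rightarrow>\<^sub>M node_space"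
    by (rule measurable_restrict[OF coord])
  then show ?thesis unfolding prune_def[abs_def] by (rule measurable_Pair[OF fst])
qed

lemma measurable_run_space_dmmt_pair:
  assumes "valid_baseline \<mu> q\<^sub>0"
  shows "dmmt_pair \<mu> q\<^sub>0 \<in> run_space \<rightarrow>\<^sub>M pair_space"
  using measurable_compose[OF measurable_prune measurable_dmmt_pair[OF assms]]
  by (simp add: same_run_dmmt_pair[OF same_run_prune, symmetric])

lemma measurable_run_space_yields_pair:
  assumes "valid_baseline \<mu> q\<^sub>0"
  shows "Measurable.pred run_space (yields_pair \<mu> q\<^sub>0)"
  using measurable_compose[OF measurable_prune measurable_yields_pair[OF assms]]
  by (simp add: same_run_yields_pair[OF same_run_prune, symmetric])

section \<open>The posterior law of the run\<close>

definition evidence where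
  "evidence \<rho>\<^sub>0 \<Theta> \<mu> q\<^sub>0 n x = (\<Sum>g\<in>UNIV. \<rho>\<^sub>0 g * Phi \<Theta> \<mu> q\<^sub>0 n x unit_rect g)"

text \<open>Bayes' rule for the state of the fictitious parent, which provides the witness for the
  unspecified initial probabilities. The normaliser \<open>evidence\<close> is the marginal
  likelihood of the whole sample.\<close>

definition posterior_init where
  "posterior_init \<rho>\<^sub>0 \<Theta> \<mu> q\<^sub>0 n x g =
     \<rho>\<^sub>0 g * Phi \<Theta> \<mu> q\<^sub>0 n x unit_rect g / evidence \<rho>\<^sub>0 \<Theta> \<mu> q\<^sub>0 n x"

lemma evidence_pos:
  assumes i: "valid_init \<rho>\<^sub>0" and r: "regular_data \<Theta> \<mu> q\<^sub>0 n x"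
  shows "0 < evidence \<rho>\<^sub>0 \<Theta> \<mu> q\<^sub>0 n x"
proof -
  have nn: "0 \<le> \<rho>\<^sub>0 g" for g using i by (simp add: valid_init_def)
  obtain g where "0 < \<rho>\<^sub>0 g"
    using i unfolding valid_init_def by (metis less_eq_real_def sum.neutral zero_neq_one)
  then show ?thesis
    unfolding evidence_def using nn regular_Phi_pos[OF r unit_rect_in_rects]
    by (intro sum_pos2[of UNIV g]) (auto simp: less_imp_le)
qed

lemma valid_posterior_init:
  assumes i: "valid_init \<rho>\<^sub>0" and r: "regular_data \<Theta> \<mu> q\<^sub>0 n x"
  shows "valid_init (posterior_init \<rho>\<^sub>0 \<Theta> \<mu> q\<^sub>0 n x)"
  using i evidence_pos[OF assms] regular_Phi_pos[OF r unit_rect_in_rects]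
  by (auto simp: valid_init_def posterior_init_def sum_divide_distrib[symmetric] evidence_def[symmetric] less_imp_le)

lemma measurable_lik_outcome:
  assumes "A \<in> rects" "q\<^sub>0 \<in> borel_measurable borel"
  shows "lik \<mu> q\<^sub>0 n x A \<in> borel_measurable outcome_space"
  by (rule measurable_outcome) (rule measurable_lik_fixed[OF assms])

lemma integral_lik_evidence:
  assumes v: "valid_params \<Theta>" and b: "valid_baseline \<mu> q\<^sub>0" and i: "valid_init \<rho>\<^sub>0" and r: "regular_data \<Theta> \<mu> q\<^sub>0 n x"
  shows "(\<integral>w. lik \<mu> q\<^sub>0 n x unit_rect w \<partial>process \<rho>\<^sub>0 \<Theta>) = evidence \<rho>\<^sub>0 \<Theta> \<mu> q\<^sub>0 n x"
proof -
  note B = baseline_D[OF b]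
  let ?L = "lik \<mu> q\<^sub>0 n x unit_rect"
  note m = measurable_lik_outcome[OF unit_rect_in_rects B(4), of \<mu> n x]
  have nn: "0 \<le> ?L w" if "proper (snd w)" for w
    using lik_nonneg[of "snd w" unit_rect q\<^sub>0 \<mu> n x "fst w", OF that unit_rect_in_rects B(5)] by simp
  have "AE w in process \<rho>\<^sub>0 \<Theta>. 0 \<le> ?L w"
    using AE_process_draws[OF v AE_proper[OF v], of \<rho>\<^sub>0] by eventually_elim (rule nn)
  then have "(\<integral>w. ?L w \<partial>process \<rho>\<^sub>0 \<Theta>) = enn2real (\<integral>\<^sup>+w. ennreal (?L w) \<partial>process \<rho>\<^sub>0 \<Theta>)"
    using m by (intro integral_eq_nn_integral) (simp_all add: measurable_process_iff[OF v])
  also have "(\<integral>\<^sup>+w. ennreal (?L w) \<partial>process \<rho>\<^sub>0 \<Theta>) = (\<Sum>g\<in>UNIV. ennreal (\<rho>\<^sub>0 g) * ennreal (Phi \<Theta> \<mu> q\<^sub>0 n x unit_rect g))"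
    using nn_integral_process[OF v measurable_compose[OF m measurable_ennreal], of \<rho>\<^sub>0]
    by (simp add: nn_integral_lik_Phi[OF v b r unit_rect_in_rects])
  also have "\<dots> = ennreal (evidence \<rho>\<^sub>0 \<Theta> \<mu> q\<^sub>0 n x)"
    unfolding evidence_def using i regular_Phi_pos[OF r unit_rect_in_rects]
    by (simp add: valid_init_def ennreal_mult[symmetric] less_imp_le sum_ennreal)
  finally show ?thesis using evidence_pos[OF i r] by (simp add: less_imp_le)
qed

text \<open>Finite measures that agree on an intersection-stable generator coincide. For each
  initial state the telescoped identity produces \<open>Phi\<close> at the root, and this factor is
  what turns the prior initial probabilities into \<open>posterior_init\<close>.\<close>

lemma posterior_run_law:
  assumes v: "valid_params \<Theta>" and b: "valid_baseline \<mu> q\<^sub>0" and i: "valid_init \<rho>\<^sub>0" and r: "regular_data \<Theta> \<mu> q\<^sub>0 n x"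
  shows "distr (density (process \<rho>\<^sub>0 \<Theta>) (\<lambda>w. ennreal (lik \<mu> q\<^sub>0 n x unit_rect w / evidence \<rho>\<^sub>0 \<Theta> \<mu> q\<^sub>0 n x))) run_space (\<lambda>w. w) =
    distr (process (posterior_init \<rho>\<^sub>0 \<Theta> \<mu> q\<^sub>0 n x) (posterior_params \<Theta> \<mu> q\<^sub>0 n x)) run_space (\<lambda>w. w)"
    (is "distr ?M _ _ = distr ?N _ _")
proof -
  note B = baseline_D[OF b]
  let ?P = "posterior_params \<Theta> \<mu> q\<^sub>0 n x" and ?e = "evidence \<rho>\<^sub>0 \<Theta> \<mu> q\<^sub>0 n x"
  note vP = valid_posterior_params[OF v b r]
  note e = evidence_pos[OF i r]
  have f: "(\<lambda>w. ennreal (lik \<mu> q\<^sub>0 n x unit_rect w / ?e)) \<in> borel_measurable outcome_space"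
    using measurable_lik_outcome[OF unit_rect_in_rects B(4), of \<mu> n x] by measurable
  have idM: "(\<lambda>w. w) \<in> ?M \<rightarrow>\<^sub>M run_space" "(\<lambda>w. w) \<in> ?N \<rightarrow>\<^sub>M run_space"
    using measurable_id_run_space by (simp_all add: measurable_process_iff[OF v] measurable_process_iff[OF vP])
  show ?thesis
  \<comment> \<open>The order is reversed because the uniqueness theorem asks for finiteness of the
    first measure; the posterior process is known to be a probability.\<close>
  proof (rule sym, rule measure_eqI_generator_eq[OF Int_stable_run_events, of UNIV _ _ "\<lambda>_. UNIV"])
    fix X :: "'a outcome set" assume "X \<in> run_events"
    then obtain H E \<epsilon> where X: "X = run_event H E" "\<And>b. E b \<in> sets draw_space" "0 < \<epsilon>" "\<And>b. vol (fst b) \<le> \<epsilon> \<Longrightarrow> E b = UNIV"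
      unfolding run_events_def by blast
    obtain d where d: "vol (unit_rect :: 'a rect) * (1/2) ^ d \<le> \<epsilon>" using ex_halvings[OF X(3)] by blast
    note ind = measurable_run_event[where E=E and \<epsilon>=\<epsilon> and H=H, OF X(2-4)]
    have Xs: "X \<in> sets run_space" using \<open>X \<in> run_events\<close> by (auto simp: sets_run_space)
    \<comment> \<open>Elements of \<open>outcome_space\<close> have a fixed value off
      \<open>all_nodes\<close>, while a run event is a set of arbitrary outcomes; hence the
      intersection.\<close>
    have s: "X \<inter> space outcome_space \<in> sets outcome_space"
      using ind unfolding X(1) borel_measurable_indicator_iff .
    have sp: "space (process \<rho>\<^sub>0 \<Theta>) = space outcome_space" "space ?N = space outcome_space"
      using sets_eq_imp_space_eq[OF sets_process[OF v]] sets_eq_imp_space_eq[OF sets_process[OF vP]] by auto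
    have Xi: "indicator (X \<inter> space outcome_space) w = (indicator X w :: ennreal)" if "w \<in> space outcome_space" for w
      using that by (simp add: indicator_def)
    let ?J = "\<lambda>g. \<integral>\<^sup>+\<omega>. of_bool (run_in E unit_rect g \<omega>) \<partial>draws ?P"
    have "emeasure (distr ?M run_space (\<lambda>w. w)) X = emeasure ?M (X \<inter> space outcome_space)"
      using Xs idM by (simp add: emeasure_distr sp)
    also have "\<dots> = (\<integral>\<^sup>+w. ennreal (lik \<mu> q\<^sub>0 n x unit_rect w / ?e) * indicator (X \<inter> space outcome_space) w \<partial>process \<rho>\<^sub>0 \<Theta>)"
      using f s by (intro emeasure_density) (simp_all add: measurable_process_iff[OF v] sets_process[OF v])
    also have "\<dots> = (\<integral>\<^sup>+w. ennreal (lik \<mu> q\<^sub>0 n x unit_rect w / ?e) * indicator (run_event H E) w \<partial>process \<rho>\<^sub>0 \<Theta>)"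
      by (intro nn_integral_cong) (simp add: Xi sp X(1)[symmetric])
    also have "\<dots> = (\<Sum>g\<in>UNIV. ennreal (\<rho>\<^sub>0 g) * (\<integral>\<^sup>+\<omega>. ennreal (lik \<mu> q\<^sub>0 n x unit_rect (g, \<omega>) / ?e) * indicator (run_event H E) (g, \<omega>) \<partial>draws \<Theta>))"
      using f ind by (intro nn_integral_process[OF v] borel_measurable_times_ennreal)
    also have "\<dots> = (\<Sum>g\<in>UNIV. ennreal (posterior_init \<rho>\<^sub>0 \<Theta> \<mu> q\<^sub>0 n x g) * (indicator H g * ?J g))"
    proof (rule sum.cong[OF refl])
      fix g
      have R: "(\<lambda>\<omega>. of_bool (run_in E unit_rect g \<omega>) :: ennreal) \<in> borel_measurable node_space"
        by (rule measurable_run_in[of E \<epsilon>, OF X(2,4) unit_rect_in_rects d])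
      have Lm: "(\<lambda>\<omega>. ennreal (lik \<mu> q\<^sub>0 n x unit_rect (g, \<omega>))) \<in> borel_measurable node_space"
        by (rule measurable_compose[OF measurable_lik_fixed[OF unit_rect_in_rects B(4)] measurable_ennreal])
      have "(\<integral>\<^sup>+\<omega>. ennreal (lik \<mu> q\<^sub>0 n x unit_rect (g, \<omega>) / ?e) * indicator (run_event H E) (g, \<omega>) \<partial>draws \<Theta>) =
        (\<integral>\<^sup>+\<omega>. (ennreal (1 / ?e) * indicator H g) * (of_bool (run_in E unit_rect g \<omega>) * ennreal (lik \<mu> q\<^sub>0 n x unit_rect (g, \<omega>))) \<partial>draws \<Theta>)"
      proof (rule nn_integral_cong)
        fix \<omega>
        have "ennreal (lik \<mu> q\<^sub>0 n x unit_rect (g, \<omega>) / ?e) = ennreal (lik \<mu> q\<^sub>0 n x unit_rect (g, \<omega>)) * ennreal (1 / ?e)"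
          using e by (subst ennreal_mult''[symmetric]) auto
        then show "ennreal (lik \<mu> q\<^sub>0 n x unit_rect (g, \<omega>) / ?e) * indicator (run_event H E) (g, \<omega>) =
          (ennreal (1 / ?e) * indicator H g) * (of_bool (run_in E unit_rect g \<omega>) * ennreal (lik \<mu> q\<^sub>0 n x unit_rect (g, \<omega>)))"
          by (auto simp: run_event_def indicator_def mult_ac)
      qed
      also have "\<dots> = (ennreal (1 / ?e) * indicator H g) * (ennreal (Phi \<Theta> \<mu> q\<^sub>0 n x unit_rect g) * ?J g)"
      proof -
        have "(\<integral>\<^sup>+\<omega>. of_bool (run_in E unit_rect g \<omega>) * ennreal (lik \<mu> q\<^sub>0 n x unit_rect (g, \<omega>)) \<partial>draws \<Theta>) =
            ennreal (Phi \<Theta> \<mu> q\<^sub>0 n x unit_rect g) * ?J g"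
          by (rule nn_integral_run_in_lik[where E=E and \<epsilon>=\<epsilon>, OF v b r X(2,4) unit_rect_in_rects d])
        then show ?thesis
          using R Lm by (subst nn_integral_cmult) (simp_all add: measurable_draws_iff[OF v] borel_measurable_times_ennreal)
      qed
      finally show "ennreal (\<rho>\<^sub>0 g) * (\<integral>\<^sup>+\<omega>. ennreal (lik \<mu> q\<^sub>0 n x unit_rect (g, \<omega>) / ?e) * indicator (run_event H E) (g, \<omega>) \<partial>draws \<Theta>) =
        ennreal (posterior_init \<rho>\<^sub>0 \<Theta> \<mu> q\<^sub>0 n x g) * (indicator H g * ?J g)"
        using i e regular_Phi_pos[OF r unit_rect_in_rects, of g]
        by (simp add: posterior_init_def valid_init_def divide_inverse ennreal_mult less_imp_le mult_ac)
    qed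
    also have "\<dots> = (\<Sum>g\<in>UNIV. ennreal (posterior_init \<rho>\<^sub>0 \<Theta> \<mu> q\<^sub>0 n x g) * (\<integral>\<^sup>+\<omega>. indicator (run_event H E) (g, \<omega>) \<partial>draws ?P))"
    proof (rule sum.cong[OF refl])
      fix g
      have "(\<integral>\<^sup>+\<omega>. indicator (run_event H E) (g, \<omega>) \<partial>draws ?P) = (\<integral>\<^sup>+\<omega>. indicator H g * of_bool (run_in E unit_rect g \<omega>) \<partial>draws ?P)"
        by (intro nn_integral_cong) (auto simp: run_event_def indicator_def)
      also have "\<dots> = indicator H g * ?J g"
        using measurable_run_in[of E \<epsilon>, OF X(2,4) unit_rect_in_rects d] by (intro nn_integral_cmult) (simp add: measurable_draws_iff[OF vP])
      finally show "ennreal (posterior_init \<rho>\<^sub>0 \<Theta> \<mu> q\<^sub>0 n x g) * (indicator H g * ?J g) =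
        ennreal (posterior_init \<rho>\<^sub>0 \<Theta> \<mu> q\<^sub>0 n x g) * (\<integral>\<^sup>+\<omega>. indicator (run_event H E) (g, \<omega>) \<partial>draws ?P)" by simp
    qed
    also have "\<dots> = (\<integral>\<^sup>+w. indicator (run_event H E) w \<partial>?N)"
      by (rule nn_integral_process[OF vP ind, symmetric])
    also have "\<dots> = (\<integral>\<^sup>+w. indicator (X \<inter> space outcome_space) w \<partial>?N)"
      by (intro nn_integral_cong) (simp add: Xi sp X(1)[symmetric])
    also have "\<dots> = emeasure ?N (X \<inter> space outcome_space)"
      using s by (intro nn_integral_indicator) (simp add: sets_process[OF vP])
    also have "\<dots> = emeasure (distr ?N run_space (\<lambda>w. w)) X"
      using Xs idM by (simp add: emeasure_distr sp)
    finally show "emeasure (distr ?N run_space (\<lambda>w. w)) X = emeasure (distr ?M run_space (\<lambda>w. w)) X" ..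
  next
    have "prob_space (distr ?N run_space (\<lambda>w. w))"
      by (rule prob_space.prob_space_distr[OF prob_space_process[OF vP valid_posterior_init[OF i r]] idM(2)])
    from prob_space.emeasure_space_1[OF this]
    show "emeasure (distr ?N run_space (\<lambda>w. w)) UNIV \<noteq> \<infinity>" by simp
  qed (use UNIV_run_events in \<open>auto simp: sets_run_space\<close>)
qed

section \<open>Stopping and conservation of mass\<close>

text \<open>The deficit \<open>1 - F\<close> has integral zero.\<close>

lemma AE_eq_1_of_nn_integral:
  fixes F :: "'a \<Rightarrow> ennreal"
  assumes "prob_space M" and F: "F \<in> borel_measurable M" and le: "AE x in M. F x \<le> 1" and ge: "1 \<le> (\<integral>\<^sup>+x. F x \<partial>M)"
  shows "AE x in M. F x = 1"
proof -
  interpret prob_space M by fact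
  have "(\<integral>\<^sup>+x. F x \<partial>M) \<le> (\<integral>\<^sup>+x. 1 \<partial>M)" by (rule nn_integral_mono_AE[OF le])
  then have I: "(\<integral>\<^sup>+x. F x \<partial>M) = 1" using ge by (simp add: emeasure_space_1)
  have "(\<integral>\<^sup>+x. 1 - F x \<partial>M) = (\<integral>\<^sup>+x. 1 \<partial>M) - (\<integral>\<^sup>+x. F x \<partial>M)"
    using F le I by (intro nn_integral_diff) auto
  then have "(\<integral>\<^sup>+x. 1 - F x \<partial>M) = 0" using I by (simp add: emeasure_space_1)
  then have z: "AE x in M. 1 - F x = 0" using F by (subst (asm) nn_integral_0_iff_AE) auto
  have y: "y = 1" if "1 - y = 0" "y \<le> 1" for y :: ennreal
    using that diff_eq_0_iff_ennreal[of 1 y] by (intro antisym) auto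
  show ?thesis using z le by eventually_elim (rule y)
qed

abbreviation shares_ok :: "'p::finite draw \<Rightarrow> bool" where
  "shares_ok z \<equiv> fst z \<noteq> Stop \<longrightarrow> (\<forall>t. 0 \<le> snd (snd z) t \<and> snd (snd z) t \<le> 1)"

lemma proper_shares_ok: "proper \<omega> \<Longrightarrow> A \<in> rects \<Longrightarrow> shares_ok (\<omega> (A, h))"
  unfolding proper_def by blast

text \<open>
  The common core of two facts: almost every point lies in a stopped node (the weights \<open>c\<close> select the
  half containing the point), and no mass is lost (the weights are the Beta shares).
\<close>

lemma branching_lower_bound:
  fixes T :: "nat \<Rightarrow> 'p::finite rect \<Rightarrow> state \<Rightarrow> ('p rect \<times> state \<Rightarrow> 'p draw) \<Rightarrow> ennreal"
  assumes v: "valid_params \<Theta>" and \<delta>: "0 < \<delta>" "\<And>A h. A \<in> rects \<Longrightarrow> \<delta> < trprob \<Theta> A h Stop"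
    and T: "\<And>k A h. A \<in> rects \<Longrightarrow> T k A h \<in> borel_measurable node_space"
    and dep: "\<And>k A h \<omega> \<omega>'. A \<in> rects \<Longrightarrow> (\<And>b. b \<in> nodes_in A \<Longrightarrow> \<omega> b = \<omega>' b) \<Longrightarrow> T k A h \<omega> = T k A h \<omega>'"
    and c: "\<And>A i. c A i \<in> borel_measurable draw_space"
    and c1: "\<And>A z. A \<in> rects \<Longrightarrow> shares_ok z \<Longrightarrow> (\<Sum>i\<in>UNIV. c A i z) = 1"
    and step: "\<And>k A h \<omega>. A \<in> rects \<Longrightarrow> proper \<omega> \<Longrightarrow> \<omega> \<in> space node_space \<Longrightarrow> T (Suc k) A h \<omega> =
      (\<Sum>i\<in>(UNIV::side set). c A i (\<omega> (A, h)) * (if fst (\<omega> (A, h)) = Stop then 1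
        else T k (half A (fst (snd (\<omega> (A, h)))) i) (fst (\<omega> (A, h))) \<omega>))"
    and A: "A \<in> rects"
  shows "ennreal (1 - (1 - \<delta>) ^ k) \<le> (\<integral>\<^sup>+\<omega>. T k A h \<omega> \<partial>draws \<Theta>)"
  using A
proof (induction k arbitrary: A h)
  case 0
  then show ?case by simp
next
  case (Suc k)
  note A = Suc.prems
  note vn = valid_params_node[OF v A]
  have tr: "0 \<le> trprob \<Theta> A h g" for g using vn by (auto simp: valid_node_def)
  have trsum: "trprob \<Theta> A h Divide + trprob \<Theta> A h Merge = 1 - trprob \<Theta> A h Stop"
  proof -
    have "(\<Sum>g\<in>UNIV. trprob \<Theta> A h g) = 1" using vn by (auto simp: valid_node_def)
    then show ?thesis by (simp add: UNIV_state)
  qed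
  define s where "s = 1 - (1 - \<delta>) ^ k"
  have \<delta>1: "\<delta> < 1" using \<delta>(2)[OF A, of h] trsum tr[of Divide] tr[of Merge] by linarith
  have s: "0 \<le> s" using \<delta>(1) \<delta>1 by (simp add: s_def power_le_one)
  \<comment> \<open>Only the half selected by \<open>i\<close> carries a factor, so the product over
    both halves in the first-step formula reduces to a single \<open>T\<close>.\<close>
  let ?G = "\<lambda>i g j i' \<omega>. if i' = i then T k (half A j i) g \<omega> else 1"
  have prodG: "(\<Prod>i'\<in>UNIV. ?G i g j i' \<omega>) = T k (half A j i) g \<omega>" for i g j \<omega>
    by (cases i) (simp_all add: UNIV_side)
  have Gm: "?G i g j i' \<in> borel_measurable node_space" for i g j i'
    using T[OF half_in_rects[OF A], of k j i g] by (cases "i' = i") simp_all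
  have Gd: "?G i g j i' \<omega> = ?G i g j i' \<omega>'" if "\<And>b. b \<in> nodes_in (half A j i') \<Longrightarrow> \<omega> b = \<omega>' b" for i g j i' \<omega> \<omega>'
    using dep[OF half_in_rects[OF A], of j i \<omega> \<omega>' k g] that by auto
  have prob: "emeasure (draws \<Theta>) (space (draws \<Theta>)) = 1"
    by (rule prob_space.emeasure_space_1[OF prob_space_draws[OF v]])
  have one: "(\<integral>\<^sup>+\<omega>. T k (half A j i) g \<omega> \<partial>draws \<Theta>) \<ge> ennreal s" for i j g
    unfolding s_def by (rule Suc.IH[OF half_in_rects[OF A]])
  have branch: "(\<integral>\<^sup>+\<omega>. c A i (\<omega> (A, h)) * (if fst (\<omega> (A, h)) = Stop then 1
        else T k (half A (fst (snd (\<omega> (A, h)))) i) (fst (\<omega> (A, h))) \<omega>) \<partial>draws \<Theta>) \<ge>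
      ennreal (trprob \<Theta> A h Stop) * c A i (Stop, undefined, undefined) +
      (\<Sum>g\<in>{Divide, Merge}. \<Sum>j\<in>UNIV. ennreal (trprob \<Theta> A h g * dirp \<Theta> A g j) *
        (\<integral>\<^sup>+y. c A i (g, j, y) \<partial>draw_split \<Theta> A g j) * ennreal s)" for i
  proof -
    have "(\<integral>\<^sup>+\<omega>. c A i (\<omega> (A, h)) * (if fst (\<omega> (A, h)) = Stop then 1
        else T k (half A (fst (snd (\<omega> (A, h)))) i) (fst (\<omega> (A, h))) \<omega>) \<partial>draws \<Theta>) =
      ennreal (trprob \<Theta> A h Stop) * c A i (Stop, undefined, undefined) +
      (\<Sum>g\<in>{Divide, Merge}. \<Sum>j\<in>UNIV. ennreal (trprob \<Theta> A h g * dirp \<Theta> A g j) *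
        (\<integral>\<^sup>+y. c A i (g, j, y) \<partial>draw_split \<Theta> A g j) * (\<Prod>i'\<in>UNIV. \<integral>\<^sup>+\<omega>. ?G i g j i' \<omega> \<partial>draws \<Theta>))"
      using nn_integral_draws_split[OF v A c[of A i], of "?G i" h, OF Gm Gd] unfolding prodG .
    moreover have "(\<Prod>i'\<in>UNIV. \<integral>\<^sup>+\<omega>. ?G i g j i' \<omega> \<partial>draws \<Theta>) \<ge> ennreal s" for g j
      using one[of j i g] prob by (cases i) (simp_all add: UNIV_side)
    ultimately show ?thesis
      by (simp only:) (intro add_mono order_refl sum_mono mult_left_mono; simp)
  qed
  have cy: "(\<Sum>i\<in>UNIV. \<integral>\<^sup>+y. c A i (g, j, y) \<partial>draw_split \<Theta> A g j) = 1" if g: "g \<in> {Divide, Merge}" for g j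
  proof -
    have pos: "g \<noteq> Stop" "\<And>t i. 0 < pcount \<Theta> A g t j i" using vn g by (auto simp: valid_node_def)
    have m: "(\<lambda>y. c A i (g, j, y)) \<in> borel_measurable (draw_split \<Theta> A g j)" for i
      unfolding measurable_cong_sets[OF sets_draw_split refl] by (rule measurable_compose[OF measurable_draw_Pair c])
    have "(\<Sum>i\<in>UNIV. \<integral>\<^sup>+y. c A i (g, j, y) \<partial>draw_split \<Theta> A g j) = (\<integral>\<^sup>+y. (\<Sum>i\<in>UNIV. c A i (g, j, y)) \<partial>draw_split \<Theta> A g j)"
      using m by (intro nn_integral_sum[symmetric]) auto
    also have "\<dots> = (\<integral>\<^sup>+y. 1 \<partial>draw_split \<Theta> A g j)"
    proof (rule nn_integral_cong_AE)
      show "AE y in draw_split \<Theta> A g j. (\<Sum>i\<in>UNIV. c A i (g, j, y)) = 1"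
        using AE_draw_split[of g \<Theta> A j, OF pos] by eventually_elim (intro c1[OF A], simp add: less_imp_le)
    qed
    also have "\<dots> = 1" using prob_space.emeasure_space_1[OF prob_space_draw_split[of g \<Theta> A j, OF pos]] by simp
    finally show ?thesis .
  qed
  have cS: "(\<Sum>i\<in>UNIV. c A i (Stop, undefined, undefined)) = 1" by (rule c1[OF A]) simp
  \<comment> \<open>The right side increases with the stopping probability because \<open>s\<close>
    is at most one; with \<delta> in its place it is exactly the geometric bound for
    \<open>Suc k\<close>.\<close>
  have "ennreal (1 - (1 - \<delta>) ^ Suc k) \<le> ennreal (trprob \<Theta> A h Stop + (1 - trprob \<Theta> A h Stop) * s)"
  proof (rule ennreal_leI)
    have "0 \<le> (trprob \<Theta> A h Stop - \<delta>) * (1 - s)"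
      using \<delta>(2)[OF A, of h] \<delta>1 by (intro mult_nonneg_nonneg) (auto simp: s_def)
    then show "1 - (1 - \<delta>) ^ Suc k \<le> trprob \<Theta> A h Stop + (1 - trprob \<Theta> A h Stop) * s"
      by (simp add: s_def algebra_simps)
  qed
  also have "\<dots> = ennreal (trprob \<Theta> A h Stop) * 1 +
      (\<Sum>g\<in>{Divide, Merge}. \<Sum>j\<in>UNIV. ennreal (trprob \<Theta> A h g * dirp \<Theta> A g j) * 1 * ennreal s)"
  proof -
    have d: "0 \<le> dirp \<Theta> A g j" "(\<Sum>j\<in>UNIV. dirp \<Theta> A g j) = 1" if "g \<in> {Divide, Merge}" for g j
      using vn that by (auto simp: valid_node_def)
    have "(\<Sum>j\<in>UNIV. ennreal (trprob \<Theta> A h g * dirp \<Theta> A g j) * 1 * ennreal s) = ennreal (trprob \<Theta> A h g * s)"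
      if g: "g \<in> {Divide, Merge}" for g
    proof -
      have "(\<Sum>j\<in>UNIV. ennreal (trprob \<Theta> A h g * dirp \<Theta> A g j) * 1 * ennreal s) =
          (\<Sum>j\<in>UNIV. ennreal (trprob \<Theta> A h g * s * dirp \<Theta> A g j))"
        using d[OF g] tr s by (intro sum.cong) (simp_all add: ennreal_mult[symmetric] mult_ac)
      also have "\<dots> = ennreal (\<Sum>j\<in>UNIV. trprob \<Theta> A h g * s * dirp \<Theta> A g j)"
        using d[OF g] tr s by (intro sum_ennreal) auto
      also have "\<dots> = ennreal (trprob \<Theta> A h g * s)" by (simp add: sum_distrib_left[symmetric] d(2)[OF g])
      finally show ?thesis .
    qed
    moreover have "trprob \<Theta> A h Stop + (1 - trprob \<Theta> A h Stop) * s =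
      trprob \<Theta> A h Stop + (trprob \<Theta> A h Divide * s + trprob \<Theta> A h Merge * s)"
      unfolding trsum[symmetric] by (simp add: algebra_simps)
    ultimately show ?thesis using tr s by (simp add: ennreal_plus[symmetric] del: ennreal_plus)
  qed
  \<comment> \<open>At each split the expected weights of the two sides sum to one, so summing over
    the sides restores the full coefficients.\<close>
  also have "\<dots> = (\<Sum>i\<in>UNIV. ennreal (trprob \<Theta> A h Stop) * c A i (Stop, undefined, undefined) +
      (\<Sum>g\<in>{Divide, Merge}. \<Sum>j\<in>UNIV. ennreal (trprob \<Theta> A h g * dirp \<Theta> A g j) *
        (\<integral>\<^sup>+y. c A i (g, j, y) \<partial>draw_split \<Theta> A g j) * ennreal s))"
  proof -
    have "(\<Sum>i\<in>UNIV. \<Sum>g\<in>{Divide, Merge}. \<Sum>j\<in>UNIV. ennreal (trprob \<Theta> A h g * dirp \<Theta> A g j) *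
        (\<integral>\<^sup>+y. c A i (g, j, y) \<partial>draw_split \<Theta> A g j) * ennreal s) =
      (\<Sum>g\<in>{Divide, Merge}. \<Sum>j\<in>UNIV. \<Sum>i\<in>UNIV. ennreal (trprob \<Theta> A h g * dirp \<Theta> A g j) *
        (\<integral>\<^sup>+y. c A i (g, j, y) \<partial>draw_split \<Theta> A g j) * ennreal s)"
      by (subst sum.swap, intro sum.cong refl, rule sum.swap)
    also have "\<dots> = (\<Sum>g\<in>{Divide, Merge}. \<Sum>j\<in>UNIV. ennreal (trprob \<Theta> A h g * dirp \<Theta> A g j) *
        (\<Sum>i\<in>UNIV. \<integral>\<^sup>+y. c A i (g, j, y) \<partial>draw_split \<Theta> A g j) * ennreal s)"
      by (simp only: sum_distrib_left sum_distrib_right)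
    also have "\<dots> = (\<Sum>g\<in>{Divide, Merge}. \<Sum>j\<in>UNIV. ennreal (trprob \<Theta> A h g * dirp \<Theta> A g j) * 1 * ennreal s)"
      by (intro sum.cong refl) (simp only: cy)
    finally show ?thesis
      unfolding sum.distrib sum_distrib_left[symmetric] cS by simp
  qed
  also have "\<dots> \<le> (\<Sum>i\<in>UNIV. \<integral>\<^sup>+\<omega>. c A i (\<omega> (A, h)) * (if fst (\<omega> (A, h)) = Stop then 1
        else T k (half A (fst (snd (\<omega> (A, h)))) i) (fst (\<omega> (A, h))) \<omega>) \<partial>draws \<Theta>)"
    by (intro sum_mono branch)
  also have "\<dots> = (\<integral>\<^sup>+\<omega>. (\<Sum>i\<in>UNIV. c A i (\<omega> (A, h)) * (if fst (\<omega> (A, h)) = Stop then 1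
        else T k (half A (fst (snd (\<omega> (A, h)))) i) (fst (\<omega> (A, h))) \<omega>)) \<partial>draws \<Theta>)"
  proof (rule nn_integral_sum[symmetric])
    fix i :: side
    have crd: "(\<lambda>\<omega>. \<omega> (A, h)) \<in> node_space \<rightarrow>\<^sub>M draw_space" using A by (intro measurable_node_coord) auto
    have "(\<lambda>\<omega>. (\<lambda>g j \<omega>. if g = Stop then 1 else T k (half A j i) g \<omega>) (fst (\<omega> (A, h))) (fst (snd (\<omega> (A, h)))) \<omega>)
        \<in> borel_measurable node_space"
    proof (rule measurable_at_draw[OF crd])
      fix g :: state and j
      show "(\<lambda>\<omega>. if g = Stop then 1 else T k (half A j i) g \<omega>) \<in> borel_measurable node_space"
        using T[OF half_in_rects[OF A], of k j i g] by (cases "g = Stop") simp_all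
    qed
    then show "(\<lambda>\<omega>. c A i (\<omega> (A, h)) * (if fst (\<omega> (A, h)) = Stop then 1
        else T k (half A (fst (snd (\<omega> (A, h)))) i) (fst (\<omega> (A, h))) \<omega>)) \<in> borel_measurable (draws \<Theta>)"
      unfolding measurable_draws_iff[OF v]
      by (intro borel_measurable_times_ennreal measurable_compose[OF crd c])
  qed
  also have "\<dots> = (\<integral>\<^sup>+\<omega>. T (Suc k) A h \<omega> \<partial>draws \<Theta>)"
    by (rule nn_integral_cong_AE, rule AE_mp[OF AE_proper[OF v]], rule AE_I2)
      (simp add: step[OF A] space_draws[OF v])
  finally show ?case .
qed

lemma nodes_in_half_subset: "A \<in> rects \<Longrightarrow> nodes_in (half A j i) \<subseteq> nodes_in A"
  using cell_half_subset[of A j i] unfolding nodes_in_def by blast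

lemma root_in_nodes_in: "A \<in> rects \<Longrightarrow> (A, h) \<in> nodes_in A"
  by (auto simp: nodes_in_def)

lemma stopped_by_cong:
  assumes "A \<in> rects" "\<And>b. b \<in> nodes_in A \<Longrightarrow> \<omega> b = \<omega>' b"
  shows "stopped_by k A h \<omega> x = stopped_by k A h \<omega>' x"
  using assms
proof (induction k arbitrary: A h)
  case (Suc k)
  have "\<omega> (A, h) = \<omega>' (A, h)" using Suc.prems root_in_nodes_in by blast
  moreover have "stopped_by k (half A j i) g \<omega> x = stopped_by k (half A j i) g \<omega>' x" for j i g
  proof (rule Suc.IH[OF half_in_rects[OF Suc.prems(1)]])
    fix b assume "b \<in> nodes_in (half A j i)"
    then show "\<omega> b = \<omega>' b" using nodes_in_half_subset[OF Suc.prems(1)] by (intro Suc.prems(2)) blast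
  qed
  ultimately show ?case by simp
qed simp

lemma tdens_cong:
  assumes "A \<in> rects" "\<And>b. b \<in> nodes_in A \<Longrightarrow> \<omega> b = \<omega>' b"
  shows "tdens \<mu> q\<^sub>0 k A h \<omega> t x = tdens \<mu> q\<^sub>0 k A h \<omega>' t x"
  unfolding tdens_def
  by (simp only: stopped_by_cong[of A \<omega> \<omega>', OF assms] same_run_dens[OF same_run_nodes_in[of A \<omega> \<omega>', OF assms]])

lemma ge_1_of_geometric_bounds:
  assumes "0 < \<delta>" "\<delta> < (1::real)" "\<And>k. ennreal (1 - (1 - \<delta>) ^ k) \<le> I"
  shows "1 \<le> I"
proof -
  have "(\<lambda>k. ennreal (1 - (1 - \<delta>) ^ k)) \<longlonglongrightarrow> ennreal (1 - 0)"
    using assms by (intro tendsto_ennrealI tendsto_intros LIMSEQ_realpow_zero) auto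
  then show ?thesis using assms(3) by (intro LIMSEQ_le_const2[of _ "1"]) auto
qed

lemma stop_bound_less_1:
  assumes v: "valid_params (\<Theta> :: 'p::finite dmmt_params)" and "\<And>A h. A \<in> rects \<Longrightarrow> \<delta> < trprob \<Theta> A h Stop"
  shows "\<delta> < 1"
proof -
  have vn: "valid_node \<Theta> unit_rect" by (rule valid_params_node[OF v unit_rect_in_rects])
  have "(\<Sum>g\<in>UNIV. trprob \<Theta> unit_rect Stop g) = 1" "\<And>g. 0 \<le> trprob \<Theta> unit_rect Stop g"
    using vn unfolding valid_node_def by blast+
  then have "trprob \<Theta> unit_rect Stop Stop \<le> 1"
    using member_le_sum[of Stop UNIV "trprob \<Theta> unit_rect Stop"] by simp
  then show ?thesis using assms(2)[OF unit_rect_in_rects, of Stop] by linarith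
qed

text \<open>Each node on the path that follows \<open>x\<close> stops with probability above
  \<delta>, whatever happened before, so the chance of not being stopped decays
  geometrically.\<close>

lemma AE_point_stopped:
  fixes \<Theta> :: "'p::finite dmmt_params"
  assumes v: "valid_params \<Theta>" and \<delta>: "0 < \<delta>" "\<And>A h. A \<in> rects \<Longrightarrow> \<delta> < trprob \<Theta> A h Stop"
    and A: "A \<in> rects" and x: "x \<in> cell A"
  shows "AE \<omega> in draws \<Theta>. \<exists>k. stopped_by k A h \<omega> x"
proof -
  \<comment> \<open>\<open>?T\<close> is 1 when \<open>x\<close> lies outside \<open>A\<close>,
    where any weights summing to one will do; inside \<open>A\<close> the weights \<open>?c\<close>
    select the half containing \<open>x\<close>.\<close>
  let ?T = "\<lambda>k A h \<omega>. of_bool (x \<in> cell A \<longrightarrow> stopped_by k A h \<omega> x) :: ennreal"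
  let ?c = "\<lambda>A i z. (if x \<in> cell A then of_bool (x \<in> cell (half A (fst (snd z)) i)) else case i of Lft \<Rightarrow> 1 | Rgt \<Rightarrow> 0) :: ennreal"
  have m: "Measurable.pred node_space (\<lambda>\<omega>. stopped_by k A h \<omega> x)" if "A \<in> rects" for k A h
    using measurable_Pair1[OF measurable_stopped_by[OF that, of k h], of x] by simp
  have sum1: "(\<Sum>i\<in>UNIV. ?c A i z) = 1" if A: "A \<in> rects" for A z
  proof (cases "x \<in> cell A")
    case True
    obtain i where i: "x \<in> cell (half A (fst (snd z)) i)" using cell_half_cases[OF A True] .
    have "x \<in> cell (half A (fst (snd z)) i') \<longleftrightarrow> i' = i" for i'
      using cell_half_unique[OF A] i by blast
    then show ?thesis using True by simp
  qed (simp add: UNIV_side)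
  have "ennreal (1 - (1 - \<delta>) ^ k) \<le> (\<integral>\<^sup>+\<omega>. ?T k A h \<omega> \<partial>draws \<Theta>)" for k
  proof (rule branching_lower_bound[OF v \<delta>, where c="?c", OF _ _ _ _ _ _ A])
    show "?T k A h \<in> borel_measurable node_space" if "A \<in> rects" for k A h
      using measurable_compose[OF m[OF that, of k h], of of_bool borel] by (cases "x \<in> cell A") simp_all
    show "?T k A h \<omega> = ?T k A h \<omega>'" if "A \<in> rects" "\<And>b. b \<in> nodes_in A \<Longrightarrow> \<omega> b = \<omega>' b" for k A h \<omega> \<omega>'
      using stopped_by_cong[OF that] by simp
    show "?c A i \<in> borel_measurable draw_space" for A i
    proof -
      have "(\<lambda>z. of_bool (x \<in> cell (half A (fst (snd z)) i)) :: ennreal) \<in> borel_measurable draw_space"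
        by (rule measurable_compose[OF measurable_draw_dir]) simp
      then show ?thesis by (cases "x \<in> cell A") simp_all
    qed
    show "(\<Sum>i\<in>UNIV. ?c A i z) = 1" if "A \<in> rects" for A z by (rule sum1[OF that])
    fix k and h :: state and A :: "'p rect" and \<omega> :: "'p rect \<times> state \<Rightarrow> 'p draw" assume A: "A \<in> rects"
    obtain g j y where z: "\<omega> (A, h) = (g, j, y)" by (cases "\<omega> (A, h)") auto
    show "?T (Suc k) A h \<omega> = (\<Sum>i\<in>UNIV. ?c A i (\<omega> (A, h)) * (if fst (\<omega> (A, h)) = Stop then 1
        else ?T k (half A (fst (snd (\<omega> (A, h)))) i) (fst (\<omega> (A, h))) \<omega>))"
    proof (cases "x \<in> cell A")
      case False
      then have "x \<notin> cell (half A j i)" for i using cell_half_subset[OF A] by blast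
      then show ?thesis using False z by (simp add: UNIV_side)
    next
      case True
      obtain i where i: "x \<in> cell (half A j i)" using cell_half_cases[OF A True] .
      have i': "x \<in> cell (half A j i') \<longleftrightarrow> i' = i" for i' using cell_half_unique[OF A] i by blast
      have ex: "(\<exists>i'. stopped_by k (half A j i') g \<omega> x) \<longleftrightarrow> stopped_by k (half A j i) g \<omega> x"
        using i' stopped_by_subset by metis
      show ?thesis
      proof (cases "g = Stop")
        case True
        then show ?thesis using \<open>x \<in> cell A\<close> z by (simp add: i')
      next
        case False
        have "(\<Sum>i'\<in>UNIV. of_bool (i' = i) * (of_bool (i' = i \<longrightarrow> stopped_by k (half A j i') g \<omega> x) :: ennreal)) =
          (\<Sum>i'\<in>UNIV. if i' = i then of_bool (stopped_by k (half A j i) g \<omega> x) else 0)"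
          by (intro sum.cong) auto
        then show ?thesis using False \<open>x \<in> cell A\<close> z by (simp add: i' ex)
      qed
    qed
  qed
  moreover have "(\<integral>\<^sup>+\<omega>. ?T k A h \<omega> \<partial>draws \<Theta>) \<le> (\<integral>\<^sup>+\<omega>. of_bool (\<exists>k. stopped_by k A h \<omega> x) \<partial>draws \<Theta>)" for k
    using x by (intro nn_integral_mono) auto
  ultimately have le: "ennreal (1 - (1 - \<delta>) ^ k) \<le> (\<integral>\<^sup>+\<omega>. of_bool (\<exists>k. stopped_by k A h \<omega> x) \<partial>draws \<Theta>)" for k
    by (rule order_trans)
  have "1 \<le> (\<integral>\<^sup>+\<omega>. of_bool (\<exists>k. stopped_by k A h \<omega> x) \<partial>draws \<Theta>)"
    by (rule ge_1_of_geometric_bounds[OF \<delta>(1) stop_bound_less_1[OF v \<delta>(2)] le])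
  moreover have "Measurable.pred node_space (\<lambda>\<omega>. \<exists>k. stopped_by k A h \<omega> x)"
    by (rule pred_intros_countable(2)) (rule m[OF A])
  then have "(\<lambda>\<omega>. of_bool (\<exists>k. stopped_by k A h \<omega> x) :: ennreal) \<in> borel_measurable (draws \<Theta>)"
    unfolding measurable_draws_iff[OF v] by (rule measurable_compose) simp
  ultimately have "AE \<omega> in draws \<Theta>. (of_bool (\<exists>k. stopped_by k A h \<omega> x) :: ennreal) = 1"
    by (intro AE_eq_1_of_nn_integral prob_space_draws[OF v]) auto
  then show ?thesis by eventually_elim (simp split: if_splits)
qed

section \<open>Conservation of mass\<close>

lemma tdens_le_dens:
  assumes "proper \<omega>" "A \<in> rects" "\<And>x. 0 \<le> q\<^sub>0 x"
  shows "tdens \<mu> q\<^sub>0 k A h \<omega> t x \<le> dens \<mu> q\<^sub>0 A (h, \<omega>) t x"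
  using dens_nonneg[of \<omega> A q\<^sub>0, OF assms] by (simp add: tdens_def)

lemma tdens_borel:
  assumes "A \<in> rects" "q\<^sub>0 \<in> borel_measurable borel" "\<omega> \<in> space node_space"
  shows "tdens \<mu> q\<^sub>0 k A h \<omega> t \<in> borel_measurable borel"
  using measurable_Pair2[OF measurable_tdens[OF assms(1,2), of \<mu> k h t] assms(3)] by simp

lemma nn_integral_base_cond:
  assumes b: "valid_baseline \<mu> q\<^sub>0" and A: "A \<in> rects"
  shows "(\<integral>\<^sup>+x. ennreal (indicator (cell A) x * base_cond \<mu> q\<^sub>0 A x) \<partial>\<mu>) = 1"
proof -
  note B = baseline_D[OF b]
  interpret Q: prob_space "baseline \<mu> q\<^sub>0" by (rule B(6))
  let ?c = "measure (baseline \<mu> q\<^sub>0) (cell A)"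
  have c: "0 < ?c" using b A by (simp add: valid_baseline_def)
  have q [measurable]: "q\<^sub>0 \<in> borel_measurable \<mu>" using B(4) by (simp add: measurable_cong_sets[OF B(2) refl])
  have cm [measurable]: "cell A \<in> sets \<mu>" using B(2) by simp
  have "(\<integral>\<^sup>+x. ennreal (indicator (cell A) x * base_cond \<mu> q\<^sub>0 A x) \<partial>\<mu>) =
      (\<integral>\<^sup>+x. ennreal (1 / ?c) * (ennreal (q\<^sub>0 x) * indicator (cell A) x) \<partial>\<mu>)"
    using c B(5) by (intro nn_integral_cong) (auto simp: base_cond_def indicator_def ennreal_mult[symmetric])
  also have "\<dots> = ennreal (1 / ?c) * emeasure (baseline \<mu> q\<^sub>0) (cell A)"
    by (subst nn_integral_cmult) (auto simp: baseline_def emeasure_density)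
  also have "\<dots> = 1" using c by (simp add: Q.emeasure_eq_measure ennreal_mult[symmetric])
  finally show ?thesis .
qed

definition tmass where
  "tmass \<mu> q\<^sub>0 t k A h \<omega> = (\<integral>\<^sup>+x. ennreal (tdens \<mu> q\<^sub>0 k A h \<omega> t x) \<partial>\<mu>)"

lemma measurable_tmass:
  assumes b: "valid_baseline \<mu> q\<^sub>0" and A: "A \<in> rects"
  shows "tmass \<mu> q\<^sub>0 t k A h \<in> borel_measurable node_space"
proof -
  note B = baseline_D[OF b]
  interpret sigma_finite_measure \<mu> by (rule B(1))
  have eq: "sets (node_space \<Otimes>\<^sub>M \<mu>) = sets (node_space \<Otimes>\<^sub>M borel)"
    by (intro sets_pair_measure_cong refl B(2))
  have "(\<lambda>\<omega>. \<integral>\<^sup>+x. ennreal (tdens \<mu> q\<^sub>0 k A h \<omega> t x) \<partial>\<mu>) \<in> borel_measurable node_space"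
  proof (rule borel_measurable_nn_integral)
    show "(\<lambda>(\<omega>, x). ennreal (tdens \<mu> q\<^sub>0 k A h \<omega> t x)) \<in> borel_measurable (node_space \<Otimes>\<^sub>M \<mu>)"
      unfolding measurable_cong_sets[OF eq refl] case_prod_beta
      by (rule measurable_compose[OF measurable_tdens[OF A B(4)] measurable_ennreal])
  qed
  then show ?thesis by (simp add: tmass_def[abs_def])
qed

text \<open>At a stopped node the whole mass is one; the weights 1 and 0 assign it to the left term,
  so that stopped and split nodes both fit the branching bound.\<close>

lemma tmass_Suc:
  assumes b: "valid_baseline \<mu> q\<^sub>0" and A: "A \<in> rects" and p: "proper \<omega>" and \<omega>: "\<omega> \<in> space node_space"
  shows "tmass \<mu> q\<^sub>0 t (Suc k) A h \<omega> =
    (\<Sum>i\<in>UNIV. (if fst (\<omega> (A, h)) = Stop then case i of Lft \<Rightarrow> 1 | Rgt \<Rightarrow> 0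
        else ennreal (share (snd (snd (\<omega> (A, h)))) i t)) * (if fst (\<omega> (A, h)) = Stop then 1
        else tmass \<mu> q\<^sub>0 t k (half A (fst (snd (\<omega> (A, h)))) i) (fst (\<omega> (A, h))) \<omega>))"
proof -
  note B = baseline_D[OF b]
  obtain g j y where z: "\<omega> (A, h) = (g, j, y)" by (cases "\<omega> (A, h)") auto
  show ?thesis
  proof (cases "g = Stop")
    case True
    then show ?thesis
      using z nn_integral_base_cond[OF b A] by (simp add: tmass_def tdens_Suc[OF A] UNIV_side)
  next
    case False
    have m: "(\<lambda>x. ennreal (tdens \<mu> q\<^sub>0 k (half A j i) g \<omega> t x)) \<in> borel_measurable \<mu>" for i
      unfolding measurable_cong_sets[OF B(2) refl]
      by (rule measurable_compose[OF tdens_borel[OF half_in_rects[OF A] B(4) \<omega>] measurable_ennreal])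
    have sh: "0 \<le> share y i t" for i using share_bounds[OF p A z False] by simp
    have td: "0 \<le> tdens \<mu> q\<^sub>0 k (half A j i) g \<omega> t x" for i x
      by (rule tdens_nonneg[of \<omega> "half A j i" q\<^sub>0, OF p half_in_rects[OF A] B(5)])
    have "tmass \<mu> q\<^sub>0 t (Suc k) A h \<omega> =
      (\<integral>\<^sup>+x. (\<Sum>i\<in>UNIV. ennreal (share y i t) * ennreal (tdens \<mu> q\<^sub>0 k (half A j i) g \<omega> t x)) \<partial>\<mu>)"
      unfolding tmass_def using False z sh td
      by (intro nn_integral_cong) (simp add: tdens_Suc[OF A] sum_ennreal[symmetric] ennreal_mult)
    also have "\<dots> = (\<Sum>i\<in>UNIV. ennreal (share y i t) * tmass \<mu> q\<^sub>0 t k (half A j i) g \<omega>)"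
      using m by (simp add: nn_integral_sum nn_integral_cmult tmass_def)
    finally show ?thesis using z False by simp
  qed
qed

lemma share_sum: "shares_ok z \<Longrightarrow> fst z \<noteq> Stop \<Longrightarrow> (\<Sum>i\<in>UNIV. ennreal (share (snd (snd z)) i t)) = 1"
  by (simp add: UNIV_side ennreal_plus[symmetric] del: ennreal_plus)

lemma tmass_le_1:
  assumes b: "valid_baseline \<mu> q\<^sub>0" and A: "A \<in> rects" and p: "proper \<omega>" and \<omega>: "\<omega> \<in> space node_space"
  shows "tmass \<mu> q\<^sub>0 t k A h \<omega> \<le> 1"
  using A
proof (induction k arbitrary: A h)
  case 0
  then show ?case by (simp add: tmass_def tdens_0)
next
  case (Suc k)
  let ?z = "\<omega> (A, h)"
  let ?w = "\<lambda>i. if fst ?z = Stop then case i of Lft \<Rightarrow> 1 | Rgt \<Rightarrow> 0 else ennreal (share (snd (snd ?z)) i t)"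
  have "tmass \<mu> q\<^sub>0 t (Suc k) A h \<omega> \<le> (\<Sum>i\<in>UNIV. ?w i * 1)"
    unfolding tmass_Suc[OF b Suc.prems p \<omega>]
    using Suc.IH[OF half_in_rects[OF Suc.prems]] by (intro sum_mono mult_left_mono) auto
  also have "\<dots> = 1"
    using share_sum[OF proper_shares_ok[OF p Suc.prems, of h]] by (cases "fst ?z = Stop") (simp_all add: UNIV_side)
  finally show ?case .
qed

text \<open>Fatou along the truncations, each of mass at most one. The bound is pathwise: it holds
  for every proper outcome, whether or not its run stops almost everywhere.\<close>

lemma nn_integral_dens_le_1:
  assumes b: "valid_baseline \<mu> q\<^sub>0" and A: "A \<in> rects" and p: "proper \<omega>" and \<omega>: "\<omega> \<in> space node_space"
  shows "(\<integral>\<^sup>+x. ennreal (dens \<mu> q\<^sub>0 A (h, \<omega>) t x) \<partial>\<mu>) \<le> 1"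
proof -
  note B = baseline_D[OF b]
  have m: "(\<lambda>x. ennreal (tdens \<mu> q\<^sub>0 k A h \<omega> t x)) \<in> borel_measurable \<mu>" for k
    unfolding measurable_cong_sets[OF B(2) refl]
    by (rule measurable_compose[OF tdens_borel[OF A B(4) \<omega>] measurable_ennreal])
  have lim: "(\<lambda>k. ennreal (tdens \<mu> q\<^sub>0 k A h \<omega> t x)) \<longlonglongrightarrow> ennreal (dens \<mu> q\<^sub>0 A (h, \<omega>) t x)" for x
    by (intro tendsto_ennrealI tdens_tendsto[OF A])
  have "(\<integral>\<^sup>+x. ennreal (dens \<mu> q\<^sub>0 A (h, \<omega>) t x) \<partial>\<mu>) = (\<integral>\<^sup>+x. liminf (\<lambda>k. ennreal (tdens \<mu> q\<^sub>0 k A h \<omega> t x)) \<partial>\<mu>)"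
    by (intro nn_integral_cong) (metis lim_imp_Liminf lim sequentially_bot)
  also have "\<dots> \<le> liminf (\<lambda>k. tmass \<mu> q\<^sub>0 t k A h \<omega>)"
    unfolding tmass_def by (rule nn_integral_liminf[OF m])
  also have "\<dots> \<le> 1"
  proof -
    have "liminf (\<lambda>k. tmass \<mu> q\<^sub>0 t k A h \<omega>) \<le> liminf (\<lambda>k. 1)"
      by (rule Liminf_mono) (simp add: tmass_le_1[OF b A p \<omega>])
    then show ?thesis by (simp add: Liminf_const)
  qed
  finally show ?thesis .
qed

text \<open>The mass is at most one on almost every outcome, while its expectation dominates that of
  every truncation and so is at least one.\<close>

lemma AE_mass_1:
  fixes \<Theta> :: "'p::finite dmmt_params"
  assumes v: "valid_params \<Theta>" and \<delta>: "0 < \<delta>" "\<And>A h. A \<in> rects \<Longrightarrow> \<delta> < trprob \<Theta> A h Stop"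
    and b: "valid_baseline \<mu> q\<^sub>0" and A: "A \<in> rects"
  shows "AE \<omega> in draws \<Theta>. (\<integral>\<^sup>+x. ennreal (dens \<mu> q\<^sub>0 A (h, \<omega>) t x) \<partial>\<mu>) = 1"
proof -
  note B = baseline_D[OF b]
  interpret sigma_finite_measure \<mu> by (rule B(1))
  let ?c = "\<lambda>(A::'p rect) i (z::'p draw). (if fst z = Stop then case i of Lft \<Rightarrow> 1 | Rgt \<Rightarrow> 0
        else ennreal (share (snd (snd z)) i t))"
  let ?F = "\<lambda>\<omega>. \<integral>\<^sup>+x. ennreal (dens \<mu> q\<^sub>0 A (h, \<omega>) t x) \<partial>\<mu>"
  have "ennreal (1 - (1 - \<delta>) ^ k) \<le> (\<integral>\<^sup>+\<omega>. tmass \<mu> q\<^sub>0 t k A h \<omega> \<partial>draws \<Theta>)" for k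
  proof (rule branching_lower_bound[OF v \<delta>, where c="?c", OF _ _ _ _ _ _ A])
    show "tmass \<mu> q\<^sub>0 t k A h \<in> borel_measurable node_space" if "A \<in> rects" for k A h
      by (rule measurable_tmass[OF b that])
    show "tmass \<mu> q\<^sub>0 t k A h \<omega> = tmass \<mu> q\<^sub>0 t k A h \<omega>'"
      if "A \<in> rects" "\<And>b. b \<in> nodes_in A \<Longrightarrow> \<omega> b = \<omega>' b" for k A h \<omega> \<omega>'
      unfolding tmass_def by (simp only: tdens_cong[of A \<omega> \<omega>', OF that])
    show "?c A i \<in> borel_measurable draw_space" for A i
    proof -
      have "(\<lambda>z. share (snd (snd z)) i t) \<in> borel_measurable draw_space"
        using measurable_draw_value[of t] borel_measurable_diff[OF borel_measurable_const measurable_draw_value[of t], of 1]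
        by (cases i) simp_all
      then have m: "(\<lambda>z. ennreal (share (snd (snd z)) i t)) \<in> borel_measurable draw_space"
        by (rule measurable_compose) simp
      show ?thesis
      proof (rule measurable_If[OF borel_measurable_const m])
        have "Measurable.pred draw_space (\<lambda>z. fst z = Stop)"
          by (rule measurable_compose[OF measurable_draw_fst]) simp
        then show "{z \<in> space draw_space. fst z = Stop} \<in> sets draw_space" by (simp add: pred_def)
      qed
    qed
    show "(\<Sum>i\<in>UNIV. ?c A i z) = 1" if "A \<in> rects" "shares_ok z" for A z
      using share_sum[OF that(2)] by (cases "fst z = Stop") (simp_all add: UNIV_side)
    show "tmass \<mu> q\<^sub>0 t (Suc k) A h \<omega> = (\<Sum>i\<in>UNIV. ?c A i (\<omega> (A, h)) * (if fst (\<omega> (A, h)) = Stop then 1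
        else tmass \<mu> q\<^sub>0 t k (half A (fst (snd (\<omega> (A, h)))) i) (fst (\<omega> (A, h))) \<omega>))"
      if "A \<in> rects" "proper \<omega>" "\<omega> \<in> space node_space" for k h \<omega> and A :: "'p rect"
      by (rule tmass_Suc[OF b that])
  qed
  moreover have "(\<integral>\<^sup>+\<omega>. tmass \<mu> q\<^sub>0 t k A h \<omega> \<partial>draws \<Theta>) \<le> (\<integral>\<^sup>+\<omega>. ?F \<omega> \<partial>draws \<Theta>)" for k
  proof (rule nn_integral_mono_AE, rule AE_mp[OF AE_proper[OF v]], rule AE_I2, rule impI)
    fix \<omega> assume p: "proper (\<omega> :: 'p rect \<times> state \<Rightarrow> 'p draw)"
    show "tmass \<mu> q\<^sub>0 t k A h \<omega> \<le> ?F \<omega>"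
      unfolding tmass_def
      by (intro nn_integral_mono ennreal_leI tdens_le_dens[of \<omega> A q\<^sub>0, OF p A B(5)])
  qed
  ultimately have le: "ennreal (1 - (1 - \<delta>) ^ k) \<le> (\<integral>\<^sup>+\<omega>. ?F \<omega> \<partial>draws \<Theta>)" for k
    by (rule order_trans)
  show ?thesis
  proof (rule AE_eq_1_of_nn_integral[OF prob_space_draws[OF v] _ _ ge_1_of_geometric_bounds[OF \<delta>(1) stop_bound_less_1[OF v \<delta>(2)] le]])
    have eq: "sets (node_space \<Otimes>\<^sub>M \<mu>) = sets (node_space \<Otimes>\<^sub>M borel)"
      by (intro sets_pair_measure_cong refl B(2))
    have "?F \<in> borel_measurable node_space"
    proof (rule borel_measurable_nn_integral)
      show "(\<lambda>(\<omega>, x). ennreal (dens \<mu> q\<^sub>0 A (h, \<omega>) t x)) \<in> borel_measurable (node_space \<Otimes>\<^sub>M \<mu>)"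
        unfolding measurable_cong_sets[OF eq refl] case_prod_beta
        by (rule measurable_compose[OF measurable_dens[OF A B(4)] measurable_ennreal])
    qed
    then show "?F \<in> borel_measurable (draws \<Theta>)" by (simp add: measurable_draws_iff[OF v])
    show "AE \<omega> in draws \<Theta>. ?F \<omega> \<le> 1"
      by (rule AE_mp[OF AE_proper[OF v]], rule AE_I2) (simp add: nn_integral_dens_le_1[OF b A] space_draws[OF v])
  qed
qed

text \<open>Almost sure stopping is known for each fixed point; Fubini turns it into stopping at
  almost every point for almost every outcome. The normalisation comes from
  \<open>AE_mass_1\<close>.\<close>

lemma AE_yields_pair:
  fixes \<Theta> :: "'p::finite dmmt_params"
  assumes v: "valid_params \<Theta>" and \<delta>: "0 < \<delta>" "\<And>A h. A \<in> rects \<Longrightarrow> \<delta> < trprob \<Theta> A h Stop"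
    and b: "valid_baseline \<mu> q\<^sub>0"
  shows "AE w in process \<rho>\<^sub>0 \<Theta>. yields_pair \<mu> q\<^sub>0 w"
proof -
  note B = baseline_D[OF b]
  interpret D: prob_space "draws \<Theta>" by (rule prob_space_draws[OF v])
  interpret pair_sigma_finite "draws \<Theta>" \<mu>
    by (intro pair_sigma_finite.intro prob_space_imp_sigma_finite prob_space_draws[OF v] B(1))
  have eq: "sets (draws \<Theta> \<Otimes>\<^sub>M \<mu>) = sets (node_space \<Otimes>\<^sub>M borel)"
    by (intro sets_pair_measure_cong sets_draws[OF v] B(2))
  have "AE \<omega> in draws \<Theta>. yields_pair \<mu> q\<^sub>0 (h, \<omega>)" for h
  proof -
    let ?P = "\<lambda>\<omega> x. x \<in> cell unit_rect \<longrightarrow> (\<exists>k. stopped_by k unit_rect h \<omega> x)"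
    have "AE \<omega> in draws \<Theta>. ?P \<omega> x" for x
    proof (cases "x \<in> cell unit_rect")
      case True
      have "AE \<omega> in draws \<Theta>. \<exists>k. stopped_by k unit_rect h \<omega> x"
        by (rule AE_point_stopped[where \<Theta>=\<Theta> and \<delta>=\<delta>]) (use v \<delta> unit_rect_in_rects True in auto)
      then show ?thesis by eventually_elim simp
    qed simp
    then have "AE x in \<mu>. AE \<omega> in draws \<Theta>. ?P \<omega> x" by simp
    moreover have "Measurable.pred (node_space \<Otimes>\<^sub>M borel) (\<lambda>p. ?P (fst p) (snd p))"
    proof (rule pred_intros_logic(4))
      show "Measurable.pred (node_space \<Otimes>\<^sub>M borel) (\<lambda>p. snd p \<in> cell unit_rect)" by measurable
      show "Measurable.pred (node_space \<Otimes>\<^sub>M borel) (\<lambda>p. \<exists>k. stopped_by k unit_rect h (fst p) (snd p))"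
        by (rule pred_intros_countable(2)) (rule measurable_stopped_by[OF unit_rect_in_rects])
    qed
    then have "{p \<in> space (draws \<Theta> \<Otimes>\<^sub>M \<mu>). ?P (fst p) (snd p)} \<in> sets (draws \<Theta> \<Otimes>\<^sub>M \<mu>)"
      unfolding pred_def eq sets_eq_imp_space_eq[OF eq] .
    ultimately have "AE \<omega> in draws \<Theta>. AE x in \<mu>. ?P \<omega> x"
      by (subst AE_commute)
    moreover have "AE \<omega> in draws \<Theta>. \<forall>t. (\<integral>\<^sup>+x. ennreal (dens \<mu> q\<^sub>0 unit_rect (h, \<omega>) t x) \<partial>\<mu>) = 1"
    proof (subst AE_all_countable, rule allI)
      show "AE \<omega> in draws \<Theta>. (\<integral>\<^sup>+x. ennreal (dens \<mu> q\<^sub>0 unit_rect (h, \<omega>) t x) \<partial>\<mu>) = 1" for t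
        by (rule AE_mass_1[where \<Theta>=\<Theta> and \<delta>=\<delta>]) (use v \<delta> b unit_rect_in_rects in auto)
    qed
    ultimately show ?thesis
      using AE_space
    proof eventually_elim
      case (elim \<omega>)
      then have \<omega>: "\<omega> \<in> space node_space" by (simp add: space_draws[OF v])
      have "(\<lambda>x. ennreal (dens \<mu> q\<^sub>0 unit_rect (h, \<omega>) t x)) \<in> borel_measurable \<mu>" for t
        unfolding measurable_cong_sets[OF B(2) refl]
        by (rule measurable_compose[OF dens_borel[OF unit_rect_in_rects B(4) \<omega>] measurable_ennreal])
      then show ?case
        unfolding yields_pair_def ex_stops_iff[OF unit_rect_in_rects] using elim by (simp add: prob_space_density_iff)
    qed
  qed
  then have "AE \<omega> in draws \<Theta>. \<forall>h. yields_pair \<mu> q\<^sub>0 (h, \<omega>)"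
    by (subst AE_all_countable) blast
  from AE_process_draws[OF v this, of \<rho>\<^sub>0] show ?thesis
    by eventually_elim (metis prod.collapse)
qed

section \<open>Regular data\<close>

lemma nn_integral_process_dirac:
  assumes v: "valid_params \<Theta>" and f: "f \<in> borel_measurable outcome_space"
  shows "(\<integral>\<^sup>+w. f w \<partial>process (\<lambda>h. of_bool (h = g)) \<Theta>) = (\<integral>\<^sup>+\<omega>. f (g, \<omega>) \<partial>draws \<Theta>)"
proof -
  have "(\<integral>\<^sup>+w. f w \<partial>process (\<lambda>h. of_bool (h = g)) \<Theta>) =
      (\<Sum>h\<in>UNIV. if h = g then (\<integral>\<^sup>+\<omega>. f (h, \<omega>) \<partial>draws \<Theta>) else 0)"
    unfolding nn_integral_process[OF v f] by (intro sum.cong) auto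
  then show ?thesis by simp
qed

text \<open>The outcomes that stop at \<open>A\<close> alone already contribute a positive amount,
  since \<open>q\<^sub>0\<close> is positive at the data.\<close>

lemma nn_integral_lik_pos:
  assumes v: "valid_params \<Theta>" and b: "valid_baseline \<mu> q\<^sub>0" and A: "A \<in> rects"
    and s: "0 < trprob \<Theta> A h Stop" and x: "\<And>t i. i < n t \<Longrightarrow> 0 < q\<^sub>0 (x t i)"
  shows "0 < (\<integral>\<^sup>+\<omega>. ennreal (lik \<mu> q\<^sub>0 n x A (h, \<omega>)) \<partial>draws \<Theta>)"
proof -
  note B = baseline_D[OF b]
  let ?z = "Z \<Theta> \<mu> q\<^sub>0 n x A Stop"
  have c: "0 < measure (baseline \<mu> q\<^sub>0) (cell A)" using b A by (simp add: valid_baseline_def)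
  have z: "0 < ?z"
    using c x by (auto simp: Z_def base_cond_def intro!: prod_pos)
  have f: "(\<lambda>z. ennreal ?z * indicator {Stop} (fst z)) \<in> borel_measurable draw_space"
    by (intro borel_measurable_times_ennreal borel_measurable_const measurable_compose[OF measurable_draw_fst]) simp
  have "0 < ennreal (trprob \<Theta> A h Stop) * ennreal ?z"
    using s z by (simp add: ennreal_zero_less_mult_iff)
  also have "\<dots> = (\<integral>\<^sup>+z. ennreal ?z * indicator {Stop} (fst z) \<partial>node_law \<Theta> A h)"
    unfolding nn_integral_node_law[OF valid_params_node[OF v A] f] by simp
  also have "\<dots> = (\<integral>\<^sup>+\<omega>. ennreal ?z * indicator {Stop} (fst (\<omega> (A, h))) \<partial>draws \<Theta>)"
    unfolding distr_draws_coord[OF v A, symmetric] using A f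
    by (subst nn_integral_distr) (simp_all add: measurable_draws_iff[OF v] measurable_node_coord)
  also have "\<dots> \<le> (\<integral>\<^sup>+\<omega>. ennreal (lik \<mu> q\<^sub>0 n x A (h, \<omega>)) \<partial>draws \<Theta>)"
    using lik_stop[OF A, of _ h \<mu> q\<^sub>0 n x \<Theta>]
    by (intro nn_integral_mono) (simp add: indicator_def)
  finally show ?thesis .
qed

lemma regular_dataI:
  assumes v: "valid_params \<Theta>" and b: "valid_baseline \<mu> q\<^sub>0"
    and s: "\<And>A h. A \<in> rects \<Longrightarrow> 0 < trprob \<Theta> A h Stop"
    and x: "\<And>t i. i < n t \<Longrightarrow> 0 < q\<^sub>0 (x t i) \<and> x t i \<in> cell unit_rect"
    and fin: "\<And>A h. A \<in> rects \<Longrightarrow> (\<integral>\<^sup>+\<omega>. ennreal (lik \<mu> q\<^sub>0 n x A (h, \<omega>)) \<partial>draws \<Theta>) \<noteq> \<infinity>"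
  shows "regular_data \<Theta> \<mu> q\<^sub>0 n x"
  unfolding regular_data_def
proof (intro conjI allI impI ballI)
  show "x t i \<in> cell unit_rect" if "i < n t" for t i using x[OF that] by simp
  fix A :: "'a rect" and g assume A: "A \<in> rects"
  note B = baseline_D[OF b]
  let ?P = "process (\<lambda>h. of_bool (h = g)) \<Theta>"
  let ?I = "\<integral>\<^sup>+\<omega>. ennreal (lik \<mu> q\<^sub>0 n x A (g, \<omega>)) \<partial>draws \<Theta>"
  have m: "lik \<mu> q\<^sub>0 n x A \<in> borel_measurable outcome_space" by (rule measurable_lik_outcome[OF A B(4)])
  have I: "(\<integral>\<^sup>+w. ennreal (lik \<mu> q\<^sub>0 n x A w) \<partial>?P) = ?I"
    by (rule nn_integral_process_dirac[OF v measurable_compose[OF m measurable_ennreal]])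
  have nn: "0 \<le> lik \<mu> q\<^sub>0 n x A w" if "proper (snd w)" for w
    using lik_nonneg[of "snd w" A q\<^sub>0 \<mu> n x "fst w", OF that A B(5)] by simp
  have ae: "AE w in ?P. 0 \<le> lik \<mu> q\<^sub>0 n x A w"
    using AE_process_draws[OF v AE_proper[OF v], of "\<lambda>h. of_bool (h = g)"] by eventually_elim (rule nn)
  have m': "lik \<mu> q\<^sub>0 n x A \<in> borel_measurable ?P" using m by (simp add: measurable_process_iff[OF v])
  show "integrable ?P (lik \<mu> q\<^sub>0 n x A)"
    using fin[OF A, of g] by (intro integrableI_nonneg m' ae) (simp add: I top.not_eq_extremum)
  have "Phi \<Theta> \<mu> q\<^sub>0 n x A g = enn2real ?I"
    unfolding Phi_def I[symmetric] by (rule integral_eq_nn_integral[OF m' ae])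
  moreover have "0 < ?I" by (rule nn_integral_lik_pos[OF v b A s[OF A]]) (use x in auto)
  ultimately show "0 < Phi \<Theta> \<mu> q\<^sub>0 n x A g"
    using fin[OF A, of g] by (simp add: enn2real_positive_iff top.not_eq_extremum)
qed

section \<open>Samples and their joint density\<close>

abbreviation data_measure :: "(grp \<Rightarrow> nat) \<Rightarrow> (real^'p::finite) measure \<Rightarrow> (grp \<Rightarrow> nat \<Rightarrow> real^'p) measure" where
  "data_measure n \<mu> \<equiv> \<Pi>\<^sub>M t\<in>UNIV. \<Pi>\<^sub>M i\<in>{..<n t}. \<mu>"

lemma sets_data_measure: "sets \<mu> = sets borel \<Longrightarrow> sets (data_measure n \<mu>) = sets (data_space n)"
  by (intro sets_PiM_cong refl) simp

lemma sigma_finite_PiM_const: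
  assumes "sigma_finite_measure \<mu>" "finite I"
  shows "sigma_finite_measure (\<Pi>\<^sub>M i\<in>I. \<mu>)"
proof -
  interpret product_sigma_finite "\<lambda>_. \<mu>" by (rule product_sigma_finite.intro) (rule assms(1))
  show ?thesis by (rule sigma_finite[OF assms(2)])
qed

lemma sigma_finite_data_measure:
  assumes "sigma_finite_measure \<mu>"
  shows "sigma_finite_measure (data_measure n \<mu>)"
proof -
  interpret product_sigma_finite "\<lambda>t::grp. \<Pi>\<^sub>M i\<in>{..<n t}. \<mu>"
    by (rule product_sigma_finite.intro) (rule sigma_finite_PiM_const[OF assms finite_lessThan])
  show ?thesis by (rule sigma_finite) simp
qed

lemma measurable_PiM_coord:
  "i \<in> I \<Longrightarrow> f \<in> M \<rightarrow>\<^sub>M N \<Longrightarrow> (\<lambda>x. f (x i)) \<in> PiM I (\<lambda>_. M) \<rightarrow>\<^sub>M N"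
  by (rule measurable_compose[OF measurable_component_singleton[of i I "\<lambda>_. M"]])

text \<open>The product formula for densities applied twice, inside each group and then across the
  groups.\<close>

lemma sample_law_density:
  assumes \<mu>: "sigma_finite_measure \<mu>" and f: "\<And>t. f t \<in> borel_measurable \<mu>"
    and P: "\<And>t. prob_space (density \<mu> (f t))"
  shows "sample_law n (\<lambda>t. density \<mu> (f t)) = density (data_measure n \<mu>) (\<lambda>x. \<Prod>t\<in>UNIV. \<Prod>i<n t. f t (x t i))"
proof -
  have D: "sigma_finite_measure (density \<mu> (f t))" for t by (rule prob_space_imp_sigma_finite[OF P])
  have inner: "(\<Pi>\<^sub>M i\<in>{..<n t}. density \<mu> (f t)) = density (\<Pi>\<^sub>M i\<in>{..<n t}. \<mu>) (\<lambda>x. \<Prod>i<n t. f t (x i))" for t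
    by (rule PiM_density[of "{..<n t}" "\<lambda>_. \<mu>" "\<lambda>_. f t"]) (simp_all add: \<mu> D f)
  have PP: "prob_space (\<Pi>\<^sub>M i\<in>{..<n t}. density \<mu> (f t))" for t by (rule prob_space_PiM) (rule P)
  show ?thesis
    unfolding sample_law_def inner
  proof (rule PiM_density[of UNIV "\<lambda>t. \<Pi>\<^sub>M i\<in>{..<n t}. \<mu>" "\<lambda>t x. \<Prod>i<n t. f t (x i)"])
    show "sigma_finite_measure (\<Pi>\<^sub>M i\<in>{..<n t}. \<mu>)" for t by (rule sigma_finite_PiM_const[OF \<mu>]) simp
    show "sigma_finite_measure (density (\<Pi>\<^sub>M i\<in>{..<n t}. \<mu>) (\<lambda>x. \<Prod>i<n t. f t (x i)))" for t
      using prob_space_imp_sigma_finite[OF PP[of t]] by (simp only: inner)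
    show "(\<lambda>x. \<Prod>i<n t. f t (x i)) \<in> borel_measurable (\<Pi>\<^sub>M i\<in>{..<n t}. \<mu>)" for t
      by (rule borel_measurable_prod_ennreal) (rule measurable_PiM_coord[OF _ f])
  qed simp
qed

lemma AE_sample_law_coords:
  assumes P: "\<And>t. prob_space (Q t)" and ae: "\<And>t. AE y in Q t. R y"
  shows "AE x in sample_law n Q. \<forall>t. \<forall>i<n t. R (x t i)"
proof -
  have 1: "AE x in (\<Pi>\<^sub>M i\<in>{..<n t}. Q t). \<forall>i<n t. R (x i)" for t
  proof -
    have "AE x in (\<Pi>\<^sub>M i\<in>{..<n t}. Q t). R (x i)" if "i < n t" for i
      by (rule AE_PiM_component[where P=R]) (use that P ae in auto)
    then have "AE x in (\<Pi>\<^sub>M i\<in>{..<n t}. Q t). \<forall>i\<in>{..<n t}. R (x i)"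
      by (intro AE_finite_allI) auto
    then show ?thesis by eventually_elim auto
  qed
  have "AE x in sample_law n Q. \<forall>i<n t. R (x t i)" for t
    unfolding sample_law_def
    by (rule AE_PiM_component[where P="\<lambda>y. \<forall>i<n t. R (y i)" and M="\<lambda>t. \<Pi>\<^sub>M i\<in>{..<n t}. Q t"])
      (use 1 P in \<open>auto intro: prob_space_PiM\<close>)
  then show ?thesis by (subst AE_all_countable) blast
qed

text \<open>
  Observations outside \<open>A\<close> do not enter the likelihood on \<open>A\<close>, and \<open>\<mu>\<close> may be infinite there; an
  everywhere positive integrable weight \<open>v\<close> in their coordinates makes Tonelli's theorem conclusive.
\<close>

lemma AE_nn_integral_lik_finite:
  fixes \<mu> :: "(real^'p::finite) measure"
  assumes v: "valid_params \<Theta>" and b: "valid_baseline \<mu> q\<^sub>0" and A: "A \<in> rects"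
  shows "AE x in data_measure n \<mu>. (\<integral>\<^sup>+\<omega>. ennreal (lik \<mu> q\<^sub>0 n x A (h, \<omega>)) \<partial>draws \<Theta>) \<noteq> \<infinity>"
proof -
  note B = baseline_D[OF b]
  interpret mu: sigma_finite_measure \<mu> by (rule B(1))
  interpret D: prob_space "draws \<Theta>" by (rule prob_space_draws[OF v])
  interpret X: sigma_finite_measure "data_measure n \<mu>" by (rule sigma_finite_data_measure[OF B(1)])
  interpret pair_sigma_finite "draws \<Theta>" "data_measure n \<mu>" ..
  \<comment> \<open>Sigma-finiteness provides an everywhere positive integrable function; it stands
    in for a density at coordinates outside \<open>A\<close>.\<close>
  obtain u where u: "u \<in> borel_measurable \<mu>" "(\<integral>\<^sup>+y. u y \<partial>\<mu>) \<noteq> \<infinity>" "\<And>y. 0 < u y" "\<And>y. u y < \<infinity>"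
    using mu.Ex_finite_integrable_function B(3) by auto
  have u': "u \<in> borel_measurable borel" using u(1) by (simp add: measurable_cong_sets[OF B(2) refl])
  define w where "w = (\<lambda>t \<omega> y. if y \<in> cell A then ennreal (dens \<mu> q\<^sub>0 A (h, \<omega>) t y) else u y)"
  define W where "W = (\<lambda>\<omega> x. \<Prod>t\<in>UNIV. \<Prod>i<n t. w t \<omega> (x t i))"
  define V where "V = (\<lambda>x. \<Prod>t\<in>UNIV. \<Prod>i<n t. if x t i \<in> cell A then 1 else u (x t i))"
  have eq: "sets (draws \<Theta> \<Otimes>\<^sub>M data_measure n \<mu>) = sets (node_space \<Otimes>\<^sub>M data_space n)"
    by (intro sets_pair_measure_cong sets_draws[OF v] sets_data_measure B(2))
  have w_joint: "(\<lambda>p. w t (fst p) (snd p)) \<in> borel_measurable (node_space \<Otimes>\<^sub>M borel)" for t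
  proof -
    have "{p \<in> space (node_space \<Otimes>\<^sub>M borel). snd p \<in> cell A} \<in> sets (node_space \<Otimes>\<^sub>M borel)" by measurable
    then show ?thesis
      unfolding w_def using measurable_compose[OF measurable_dens[OF A B(4), of \<mu> h t] measurable_ennreal]
        measurable_compose[OF measurable_snd u'] by (intro measurable_If)
  qed
  have w_borel: "w t \<omega> \<in> borel_measurable \<mu>" if "\<omega> \<in> space node_space" for t \<omega>
    using measurable_Pair2[OF w_joint[of t] that] by (simp add: measurable_cong_sets[OF B(2) refl])
  have W_joint: "(\<lambda>p. W (fst p) (snd p)) \<in> borel_measurable (draws \<Theta> \<Otimes>\<^sub>M data_measure n \<mu>)"
    unfolding measurable_cong_sets[OF eq refl] W_def
  proof (intro borel_measurable_prod_ennreal)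
    fix t i assume "i \<in> {..<n t}"
    then have "(\<lambda>p. snd p t i) \<in> node_space \<Otimes>\<^sub>M data_space n \<rightarrow>\<^sub>M borel"
      by (intro measurable_compose[OF measurable_snd measurable_datum]) auto
    then have "(\<lambda>p. (fst p, snd p t i)) \<in> node_space \<Otimes>\<^sub>M data_space n \<rightarrow>\<^sub>M node_space \<Otimes>\<^sub>M borel"
      by (intro measurable_Pair measurable_fst)
    from measurable_compose[OF this w_joint[of t]]
    show "(\<lambda>p. w t (fst p) (snd p t i)) \<in> borel_measurable (node_space \<Otimes>\<^sub>M data_space n)" by simp
  qed
  \<comment> \<open>The summand 1 bounds the density on \<open>A\<close> and the other the weight
    off \<open>A\<close>; adding both avoids splitting the integral.\<close>
  let ?C = "1 + (\<integral>\<^sup>+y. u y \<partial>\<mu>)"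
  have w_le: "(\<integral>\<^sup>+y. w t \<omega> y \<partial>\<mu>) \<le> ?C" if p: "proper \<omega>" and \<omega>: "\<omega> \<in> space node_space" for t \<omega>
  proof -
    have d: "(\<lambda>y. ennreal (dens \<mu> q\<^sub>0 A (h, \<omega>) t y)) \<in> borel_measurable \<mu>"
      unfolding measurable_cong_sets[OF B(2) refl]
      by (rule measurable_compose[OF dens_borel[OF A B(4) \<omega>] measurable_ennreal])
    have "(\<integral>\<^sup>+y. w t \<omega> y \<partial>\<mu>) \<le> (\<integral>\<^sup>+y. ennreal (dens \<mu> q\<^sub>0 A (h, \<omega>) t y) + u y \<partial>\<mu>)"
      by (intro nn_integral_mono) (simp add: w_def)
    also have "\<dots> = (\<integral>\<^sup>+y. ennreal (dens \<mu> q\<^sub>0 A (h, \<omega>) t y) \<partial>\<mu>) + (\<integral>\<^sup>+y. u y \<partial>\<mu>)"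
      by (rule nn_integral_add[OF d u(1)])
    also have "\<dots> \<le> ?C" by (intro add_mono nn_integral_dens_le_1[OF b A p \<omega>] order_refl)
    finally show ?thesis .
  qed
  have W_int: "(\<integral>\<^sup>+x. W \<omega> x \<partial>data_measure n \<mu>) \<le> (\<Prod>t\<in>UNIV. \<Prod>i<n t. ?C)"
    if p: "proper \<omega>" and \<omega>: "\<omega> \<in> space node_space" for \<omega>
  proof -
    interpret I: product_sigma_finite "\<lambda>_::nat. \<mu>" by (rule product_sigma_finite.intro) (rule B(1))
    interpret O: product_sigma_finite "\<lambda>t::grp. \<Pi>\<^sub>M i\<in>{..<n t}. \<mu>"
      by (rule product_sigma_finite.intro) (rule sigma_finite_PiM_const[OF B(1) finite_lessThan])
    have m: "(\<lambda>x. \<Prod>i<n t. w t \<omega> (x i)) \<in> borel_measurable (\<Pi>\<^sub>M i\<in>{..<n t}. \<mu>)" for t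
      by (rule borel_measurable_prod_ennreal) (rule measurable_PiM_coord[OF _ w_borel[OF \<omega>]])
    have "(\<integral>\<^sup>+x. W \<omega> x \<partial>data_measure n \<mu>) = (\<Prod>t\<in>UNIV. \<integral>\<^sup>+x. (\<Prod>i<n t. w t \<omega> (x i)) \<partial>(\<Pi>\<^sub>M i\<in>{..<n t}. \<mu>))"
      unfolding W_def by (rule O.product_nn_integral_prod[of UNIV "\<lambda>t x. \<Prod>i<n t. w t \<omega> (x i)"]) (simp_all add: m)
    also have "\<dots> = (\<Prod>t\<in>UNIV. \<Prod>i<n t. \<integral>\<^sup>+y. w t \<omega> y \<partial>\<mu>)"
    proof (rule prod.cong[OF refl])
      show "(\<integral>\<^sup>+x. (\<Prod>i<n t. w t \<omega> (x i)) \<partial>(\<Pi>\<^sub>M i\<in>{..<n t}. \<mu>)) = (\<Prod>i<n t. \<integral>\<^sup>+y. w t \<omega> y \<partial>\<mu>)" for t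
        by (rule I.product_nn_integral_prod[of "{..<n t}" "\<lambda>_. w t \<omega>"]) (simp_all add: w_borel[OF \<omega>])
    qed
    also have "\<dots> \<le> (\<Prod>t\<in>UNIV. \<Prod>i<n t. ?C)"
      by (intro prod_mono_ennreal w_le[OF p \<omega>])
    finally show ?thesis .
  qed
  \<comment> \<open>Integrating the data first gives a bound uniform over proper outcomes, so the
    double integral is finite, and hence the integral over the draws is finite for almost all
    data.\<close>
  have "(\<integral>\<^sup>+x. \<integral>\<^sup>+\<omega>. W \<omega> x \<partial>draws \<Theta> \<partial>data_measure n \<mu>) = (\<integral>\<^sup>+\<omega>. \<integral>\<^sup>+x. W \<omega> x \<partial>data_measure n \<mu> \<partial>draws \<Theta>)"
    using nn_integral_snd[OF W_joint] X.nn_integral_fst[OF W_joint] by simp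
  also have "\<dots> \<le> (\<integral>\<^sup>+\<omega>. (\<Prod>t\<in>UNIV. \<Prod>i<n t. ?C) \<partial>draws \<Theta>)"
    by (rule nn_integral_mono_AE, rule AE_mp[OF AE_proper[OF v]], rule AE_I2) (simp add: W_int space_draws[OF v] del: prod_constant)
  also have "\<dots> = (\<Prod>t\<in>UNIV. \<Prod>i<n t. ?C)" by (simp add: D.emeasure_space_1 del: prod_constant)
  also have "\<dots> < \<infinity>" using u(2) by (simp add: UNIV_grp power_less_top_ennreal ennreal_mult_less_top top.not_eq_extremum)
  finally have finite: "(\<integral>\<^sup>+x. \<integral>\<^sup>+\<omega>. W \<omega> x \<partial>draws \<Theta> \<partial>data_measure n \<mu>) \<noteq> \<infinity>" by simp
  have "(\<lambda>x. \<integral>\<^sup>+\<omega>. W \<omega> x \<partial>draws \<Theta>) \<in> borel_measurable (data_measure n \<mu>)"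
  proof (rule D.borel_measurable_nn_integral)
    show "(\<lambda>(x, \<omega>). W \<omega> x) \<in> borel_measurable (data_measure n \<mu> \<Otimes>\<^sub>M draws \<Theta>)"
      using measurable_compose[OF measurable_pair_swap' W_joint] by (simp add: case_prod_beta)
  qed
  then have "AE x in data_measure n \<mu>. (\<integral>\<^sup>+\<omega>. W \<omega> x \<partial>draws \<Theta>) \<noteq> \<infinity>"
    using finite by (rule nn_integral_noteq_infinite)
  then show ?thesis
  proof eventually_elim
    case (elim x)
    \<comment> \<open>\<open>V x\<close> is the part of the weight that is free of the draws; as it
      is nonzero, finiteness of the weighted integral passes to the likelihood.\<close>
    have V0: "V x \<noteq> 0" using u(3) by (auto simp: V_def prod_zero_iff split: if_splits) (metis less_irrefl)+
    have "(\<integral>\<^sup>+\<omega>. W \<omega> x \<partial>draws \<Theta>) = (\<integral>\<^sup>+\<omega>. ennreal (lik \<mu> q\<^sub>0 n x A (h, \<omega>)) * V x \<partial>draws \<Theta>)"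
    proof (rule nn_integral_cong_AE, rule AE_mp[OF AE_proper[OF v]], rule AE_I2, rule impI)
      fix \<omega> assume p: "proper (\<omega> :: 'p rect \<times> state \<Rightarrow> 'p draw)"
      have dn: "0 \<le> dens \<mu> q\<^sub>0 A (h, \<omega>) t y" for t y by (rule dens_nonneg[of \<omega> A q\<^sub>0, OF p A B(5)])
      have "ennreal (lik \<mu> q\<^sub>0 n x A (h, \<omega>)) =
          (\<Prod>t\<in>UNIV. \<Prod>i<n t. ennreal (if x t i \<in> cell A then dens \<mu> q\<^sub>0 A (h, \<omega>) t (x t i) else 1))"
        unfolding lik_alt using dn by (simp add: prod_ennreal prod_nonneg)
      then show "W \<omega> x = ennreal (lik \<mu> q\<^sub>0 n x A (h, \<omega>)) * V x"
        by (simp only: W_def V_def prod.distrib[symmetric]) (intro prod.cong refl, simp add: w_def)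
    qed
    also have "\<dots> = (\<integral>\<^sup>+\<omega>. ennreal (lik \<mu> q\<^sub>0 n x A (h, \<omega>)) \<partial>draws \<Theta>) * V x"
      by (intro nn_integral_multc) (simp add: measurable_draws_iff[OF v] measurable_compose[OF measurable_lik_fixed[OF A B(4)] measurable_ennreal])
    finally show ?case using elim V0 by (auto simp: ennreal_mult_eq_top_iff)
  qed
qed

text \<open>The sampling law is absolutely continuous with respect to a product of copies of \<mu>,
  so finiteness for almost all data transfers to it, at all countably many nodes simultaneously.
  Positivity of \<open>q\<^sub>0\<close> and the location of the data come from the support of the
  densities instead, since they may fail on sets of positive \<mu>-measure.\<close>

lemma AE_regular_data:
  fixes \<mu> :: "(real^'p::finite) measure"
  assumes v: "valid_params \<Theta>" and b: "valid_baseline \<mu> q\<^sub>0"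
    and s: "\<And>A h. A \<in> rects \<Longrightarrow> 0 < trprob \<Theta> A h Stop"
    and f: "\<And>t. f t \<in> borel_measurable \<mu>" and P: "\<And>t. prob_space (density \<mu> (f t))"
    and supp: "\<And>t. AE y in density \<mu> (f t). 0 < q\<^sub>0 y \<and> y \<in> cell unit_rect"
  shows "AE x in sample_law n (\<lambda>t. density \<mu> (f t)). regular_data \<Theta> \<mu> q\<^sub>0 n x"
proof -
  note B = baseline_D[OF b]
  have m: "(\<lambda>x. \<Prod>t\<in>UNIV. \<Prod>i<n t. f t (x t i)) \<in> borel_measurable (data_measure n \<mu>)"
  proof (intro borel_measurable_prod_ennreal)
    fix t i assume "i \<in> {..<n t}"
    then have "(\<lambda>x. x t i) \<in> data_measure n \<mu> \<rightarrow>\<^sub>M \<mu>"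
      by (intro measurable_compose[OF measurable_component_singleton[of t UNIV] measurable_component_singleton]) auto
    from measurable_compose[OF this f[of t]]
    show "(\<lambda>x. f t (x t i)) \<in> borel_measurable (data_measure n \<mu>)" .
  qed
  have "AE x in data_measure n \<mu>. \<forall>b\<in>all_nodes. (\<integral>\<^sup>+\<omega>. ennreal (lik \<mu> q\<^sub>0 n x (fst b) (snd b, \<omega>)) \<partial>draws \<Theta>) \<noteq> \<infinity>"
  proof (subst AE_ball_countable)
    show "countable (all_nodes :: ('p rect \<times> state) set)"
      using countable_rects by (auto intro: countable_finite)
    show "\<forall>b\<in>all_nodes. AE x in data_measure n \<mu>. (\<integral>\<^sup>+\<omega>. ennreal (lik \<mu> q\<^sub>0 n x (fst b) (snd b, \<omega>)) \<partial>draws \<Theta>) \<noteq> \<infinity>"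
      using AE_nn_integral_lik_finite[OF v b] by (intro ballI) (auto simp only: fst_conv snd_conv SigmaE)
  qed
  then have "AE x in sample_law n (\<lambda>t. density \<mu> (f t)). \<forall>b\<in>all_nodes. (\<integral>\<^sup>+\<omega>. ennreal (lik \<mu> q\<^sub>0 n x (fst b) (snd b, \<omega>)) \<partial>draws \<Theta>) \<noteq> \<infinity>"
    unfolding sample_law_density[where f=f, OF B(1) f P]
    by (subst AE_density[OF m]) (auto elim: eventually_mono)
  moreover have "AE x in sample_law n (\<lambda>t. density \<mu> (f t)). \<forall>t. \<forall>i<n t. 0 < q\<^sub>0 (x t i) \<and> x t i \<in> cell unit_rect"
    by (rule AE_sample_law_coords[where R="\<lambda>y. 0 < q\<^sub>0 y \<and> y \<in> cell unit_rect"]) (rule P, rule supp)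
  ultimately show ?thesis
  proof eventually_elim
    case (elim x)
    show ?case
    proof (rule regular_dataI[OF v b])
      show "0 < trprob \<Theta> A h Stop" if "A \<in> rects" for A h by (rule s[OF that])
      show "0 < q\<^sub>0 (x t i) \<and> x t i \<in> cell unit_rect" if "i < n t" for t i using elim(2) that by blast
      show "(\<integral>\<^sup>+\<omega>. ennreal (lik \<mu> q\<^sub>0 n x A (h, \<omega>)) \<partial>draws \<Theta>) \<noteq> \<infinity>" if "A \<in> rects" for A h
        using bspec[OF elim(1), of "(A, h)"] that by simp
    qed
  qed
qed

lemma dens_support:
  assumes "A \<in> rects" "dens \<mu> q\<^sub>0 A w t x \<noteq> 0"
  shows "q\<^sub>0 x \<noteq> 0 \<and> x \<in> cell A"
proof -
  have w: "w = (fst w, snd w)" by simp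
  obtain B m where B: "stops_from (snd w) A (fst w) B m" "x \<in> cell B"
    using dens_eq_0[of "snd w" A "fst w" x \<mu> q\<^sub>0 t] assms(2) by auto
  have "dens \<mu> q\<^sub>0 A (fst w, snd w) t x = m t * base_cond \<mu> q\<^sub>0 B x"
    by (rule dens_eq[OF B(1) assms(1) B(2)])
  then show ?thesis using assms(2) stops_from_subset[OF B(1) assms(1)] B(2) by (auto simp: base_cond_def)
qed

text \<open>Treats successful and failing outcomes alike, as the fallback to the baseline also has a
  density with the required support. Almost every sample is thus regular for each outcome in the
  space, with no exceptional outcomes.\<close>

lemma dmmt_pair_density:
  assumes b: "valid_baseline \<mu> q\<^sub>0" and w: "w \<in> space outcome_space"
  obtains f where "dmmt_pair \<mu> q\<^sub>0 w = (\<lambda>t. density \<mu> (f t))" "\<And>t. f t \<in> borel_measurable \<mu>"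
    "\<And>t. prob_space (density \<mu> (f t))" "\<And>t. AE y in density \<mu> (f t). 0 < q\<^sub>0 y \<and> y \<in> cell unit_rect"
proof (cases "yields_pair \<mu> q\<^sub>0 w")
  case True
  note B = baseline_D[OF b]
  let ?f = "\<lambda>t x. ennreal (dens \<mu> q\<^sub>0 unit_rect w t x)"
  have m: "?f t \<in> borel_measurable \<mu>" for t
    unfolding measurable_cong_sets[OF B(2) refl]
    by (rule measurable_compose[OF dens_borel'[OF unit_rect_in_rects B(4) w] measurable_ennreal])
  have s: "AE y in density \<mu> (?f t). 0 < q\<^sub>0 y \<and> y \<in> cell unit_rect" for t
  proof (subst AE_density[OF m], rule AE_I2, rule impI)
    fix y assume "0 < ?f t y"
    then have "dens \<mu> q\<^sub>0 unit_rect w t y \<noteq> 0" by auto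
    from dens_support[OF unit_rect_in_rects this] show "0 < q\<^sub>0 y \<and> y \<in> cell unit_rect"
      using B(5)[of y] by auto
  qed
  show ?thesis
    by (rule that[of ?f, OF _ m _ s]) (use True in \<open>simp_all add: dmmt_pair_def yields_pair_def\<close>)
next
  case False
  note B = baseline_D[OF b]
  interpret Q: prob_space "baseline \<mu> q\<^sub>0" by (rule B(6))
  let ?f = "\<lambda>(t::grp) x. ennreal (q\<^sub>0 x)"
  have m: "?f t \<in> borel_measurable \<mu>" for t
    unfolding measurable_cong_sets[OF B(2) refl] by (rule measurable_compose[OF B(4) measurable_ennreal])
  have pos: "AE y in density \<mu> (?f t). 0 < q\<^sub>0 y" for t
    by (subst AE_density[OF m]) simp
  have unit: "AE y in density \<mu> (?f t). y \<in> cell unit_rect" for t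
  proof -
    have "measure (baseline \<mu> q\<^sub>0) (cell unit_rect) = 1" using b by (simp add: valid_baseline_def)
    from Q.AE_prob_1[OF this] show ?thesis by (simp only: baseline_def)
  qed
  show ?thesis
  proof (rule that[of ?f, OF _ m])
    show "dmmt_pair \<mu> q\<^sub>0 w = (\<lambda>t. density \<mu> (?f t))" using False by (simp add: dmmt_pair_def baseline_def)
    show "prob_space (density \<mu> (?f t))" for t using B(6) by (simp add: baseline_def)
    show "AE y in density \<mu> (?f t). 0 < q\<^sub>0 y \<and> y \<in> cell unit_rect" for t
      using pos unit by eventually_elim simp
  qed
qed

section \<open>Conjugacy\<close>

text \<open>The event is visible to \<open>run_space\<close>, so it can be carried from the
  reweighted prior, which is absolutely continuous with respect to the prior, over to the posterior
  process.\<close>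

lemma AE_posterior_yields_pair:
  assumes v: "valid_params \<Theta>" and b: "valid_baseline \<mu> q\<^sub>0" and i: "valid_init \<rho>\<^sub>0" and r: "regular_data \<Theta> \<mu> q\<^sub>0 n x"
    and ae: "AE w in process \<rho>\<^sub>0 \<Theta>. yields_pair \<mu> q\<^sub>0 w"
  shows "AE w in process (posterior_init \<rho>\<^sub>0 \<Theta> \<mu> q\<^sub>0 n x) (posterior_params \<Theta> \<mu> q\<^sub>0 n x). yields_pair \<mu> q\<^sub>0 w"
proof -
  note B = baseline_D[OF b]
  let ?f = "\<lambda>w. ennreal (lik \<mu> q\<^sub>0 n x unit_rect w / evidence \<rho>\<^sub>0 \<Theta> \<mu> q\<^sub>0 n x)"
  let ?M = "density (process \<rho>\<^sub>0 \<Theta>) ?f"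
  let ?N = "process (posterior_init \<rho>\<^sub>0 \<Theta> \<mu> q\<^sub>0 n x) (posterior_params \<Theta> \<mu> q\<^sub>0 n x)"
  have f: "?f \<in> borel_measurable (process \<rho>\<^sub>0 \<Theta>)"
    unfolding measurable_process_iff[OF v]
    using measurable_lik_outcome[OF unit_rect_in_rects B(4), of \<mu> n x] by measurable
  have M: "(\<lambda>w. w) \<in> ?M \<rightarrow>\<^sub>M run_space" and N: "(\<lambda>w. w) \<in> ?N \<rightarrow>\<^sub>M run_space"
    using measurable_id_run_space
    by (simp_all add: measurable_process_iff[OF v] measurable_process_iff[OF valid_posterior_params[OF v b r]])
  have Y: "{w \<in> space run_space. yields_pair \<mu> q\<^sub>0 w} \<in> sets run_space"
    using measurable_run_space_yields_pair[OF b] by (simp add: pred_def)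
  have "AE w in ?M. yields_pair \<mu> q\<^sub>0 w"
    using ae by (subst AE_density[OF f]) (auto elim: eventually_mono)
  then have "AE w in distr ?M run_space (\<lambda>w. w). yields_pair \<mu> q\<^sub>0 w"
    using AE_distr_iff[OF M Y] by simp
  then show ?thesis
    unfolding posterior_run_law[OF v b i r] using AE_distr_iff[OF N Y] by simp
qed

lemma posterior_eq_DMMT:
  assumes v: "valid_params \<Theta>" and b: "valid_baseline \<mu> q\<^sub>0" and i: "valid_init \<rho>\<^sub>0" and r: "regular_data \<Theta> \<mu> q\<^sub>0 n x"
  shows "posterior \<rho>\<^sub>0 \<Theta> \<mu> q\<^sub>0 n x =
    DMMT (posterior_init \<rho>\<^sub>0 \<Theta> \<mu> q\<^sub>0 n x) (posterior_params \<Theta> \<mu> q\<^sub>0 n x) \<mu> q\<^sub>0"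
proof -
  \<comment> \<open>The pair depends only on the run, so both laws factor through
    \<open>run_space\<close>, where \<open>posterior_run_law\<close> equates them.\<close>
  have d: "distr M pair_space (dmmt_pair \<mu> q\<^sub>0) = distr (distr M run_space (\<lambda>w. w)) pair_space (dmmt_pair \<mu> q\<^sub>0)"
    if "(\<lambda>w. w) \<in> M \<rightarrow>\<^sub>M run_space" for M
    by (subst distr_distr[OF measurable_run_space_dmmt_pair[OF b] that]) (simp add: comp_def)
  have M: "(\<lambda>w. w) \<in> density (process \<rho>\<^sub>0 \<Theta>) f \<rightarrow>\<^sub>M run_space" for f
    using measurable_id_run_space by (simp add: measurable_process_iff[OF v])
  have N: "(\<lambda>w. w) \<in> process \<rho> (posterior_params \<Theta> \<mu> q\<^sub>0 n x) \<rightarrow>\<^sub>M run_space" for \<rho>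
    using measurable_id_run_space by (simp add: measurable_process_iff[OF valid_posterior_params[OF v b r]])
  show ?thesis
    unfolding posterior_def DMMT_def integral_lik_evidence[OF v b i r]
    unfolding d[OF M] d[OF N] posterior_run_law[OF v b i r] ..
qed

theorem theorem2:
  fixes \<rho>\<^sub>0 :: "state \<Rightarrow> real"
    and \<Theta> :: "'p::finite dmmt_params"
    and \<mu> :: "(real^'p) measure"
    and q\<^sub>0 :: "real^'p \<Rightarrow> real"
    and n :: "grp \<Rightarrow> nat"
  assumes "valid_baseline \<mu> q\<^sub>0"
    and "valid_init \<rho>\<^sub>0"
    and "valid_params \<Theta>"
    and "\<exists>\<delta>>0. \<forall>A\<in>rects. \<forall>g. trprob \<Theta> A g Stop > \<delta>"
  shows
    "(AE \<omega> in process \<rho>\<^sub>0 \<Theta>. AE x in sample_law n (dmmt_pair \<mu> q\<^sub>0 \<omega>). regular_data \<Theta> \<mu> q\<^sub>0 n x) \<and>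
     (\<forall>x. regular_data \<Theta> \<mu> q\<^sub>0 n x \<longrightarrow>
       (\<exists>\<rho>\<^sub>0' \<Theta>'.
          valid_init \<rho>\<^sub>0' \<and> valid_params \<Theta>' \<and>
          (\<forall>A\<in>rects. \<forall>g h.
             trprob \<Theta>' A g h = trprob \<Theta> A g h * (Z \<Theta> \<mu> q\<^sub>0 n x A h / Phi \<Theta> \<mu> q\<^sub>0 n x A g)) \<and>
          (\<forall>A\<in>rects. \<forall>g\<in>{Divide, Merge}. \<forall>j.
             dirp \<Theta>' A g j = Zdir \<Theta> \<mu> q\<^sub>0 n x A g j / Z \<Theta> \<mu> q\<^sub>0 n x A g) \<and>
          (\<forall>A\<in>rects. \<forall>j i t.
             pcount \<Theta>' A Divide t j i =
               pcount \<Theta> A Divide t j i + real (ncount n x t (half A j i)) \<and>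
             pcount \<Theta>' A Merge t j i =
               pcount \<Theta> A Merge t j i
                 + real (ncount n x Grp1 (half A j i)) + real (ncount n x Grp2 (half A j i))) \<and>
          (AE \<omega> in process \<rho>\<^sub>0' \<Theta>'. yields_pair \<mu> q\<^sub>0 \<omega>) \<and>
          posterior \<rho>\<^sub>0 \<Theta> \<mu> q\<^sub>0 n x = DMMT \<rho>\<^sub>0' \<Theta>' \<mu> q\<^sub>0))"
proof (intro conjI allI impI)
  obtain \<delta> where \<delta>: "0 < \<delta>" "\<And>A h. A \<in> rects \<Longrightarrow> \<delta> < trprob \<Theta> A h Stop"
    using assms(4) by blast
  have s: "0 < trprob \<Theta> A h Stop" if "A \<in> rects" for A h
    using \<delta>(2)[OF that, of h] \<delta>(1) by linarith
  show "AE \<omega> in process \<rho>\<^sub>0 \<Theta>. AE x in sample_law n (dmmt_pair \<mu> q\<^sub>0 \<omega>). regular_data \<Theta> \<mu> q\<^sub>0 n x"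
  proof (rule AE_I2)
    fix w assume "w \<in> space (process \<rho>\<^sub>0 \<Theta>)"
    then have "w \<in> space outcome_space" using sets_eq_imp_space_eq[OF sets_process[OF assms(3)]] by blast
    from dmmt_pair_density[OF assms(1) this] obtain f where f: "dmmt_pair \<mu> q\<^sub>0 w = (\<lambda>t. density \<mu> (f t))"
      "\<And>t. f t \<in> borel_measurable \<mu>" "\<And>t. prob_space (density \<mu> (f t))"
      "\<And>t. AE y in density \<mu> (f t). 0 < q\<^sub>0 y \<and> y \<in> cell unit_rect" by blast
    show "AE x in sample_law n (dmmt_pair \<mu> q\<^sub>0 w). regular_data \<Theta> \<mu> q\<^sub>0 n x"
      unfolding f(1) by (rule AE_regular_data[OF assms(3,1) s f(2-4)])
  qed
  fix x assume r: "regular_data \<Theta> \<mu> q\<^sub>0 n x"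
  let ?\<rho> = "posterior_init \<rho>\<^sub>0 \<Theta> \<mu> q\<^sub>0 n x" and ?P = "posterior_params \<Theta> \<mu> q\<^sub>0 n x"
  have "AE w in process \<rho>\<^sub>0 \<Theta>. yields_pair \<mu> q\<^sub>0 w"
    by (rule AE_yields_pair[where \<delta>=\<delta>]) (use assms \<delta> in auto)
  then have Y: "AE w in process ?\<rho> ?P. yields_pair \<mu> q\<^sub>0 w"
    by (rule AE_posterior_yields_pair[OF assms(3,1,2) r])
  show "\<exists>\<rho>\<^sub>0' \<Theta>'.
      valid_init \<rho>\<^sub>0' \<and> valid_params \<Theta>' \<and>
      (\<forall>A\<in>rects. \<forall>g h.
         trprob \<Theta>' A g h = trprob \<Theta> A g h * (Z \<Theta> \<mu> q\<^sub>0 n x A h / Phi \<Theta> \<mu> q\<^sub>0 n x A g)) \<and>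
      (\<forall>A\<in>rects. \<forall>g\<in>{Divide, Merge}. \<forall>j.
         dirp \<Theta>' A g j = Zdir \<Theta> \<mu> q\<^sub>0 n x A g j / Z \<Theta> \<mu> q\<^sub>0 n x A g) \<and>
      (\<forall>A\<in>rects. \<forall>j i t.
         pcount \<Theta>' A Divide t j i =
           pcount \<Theta> A Divide t j i + real (ncount n x t (half A j i)) \<and>
         pcount \<Theta>' A Merge t j i =
           pcount \<Theta> A Merge t j i
             + real (ncount n x Grp1 (half A j i)) + real (ncount n x Grp2 (half A j i))) \<and>
      (AE \<omega> in process \<rho>\<^sub>0' \<Theta>'. yields_pair \<mu> q\<^sub>0 \<omega>) \<and>
      posterior \<rho>\<^sub>0 \<Theta> \<mu> q\<^sub>0 n x = DMMT \<rho>\<^sub>0' \<Theta>' \<mu> q\<^sub>0"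
    by (rule exI[of _ ?\<rho>], rule exI[of _ ?P], intro conjI valid_posterior_init[OF assms(2) r]
        valid_posterior_params[OF assms(3,1) r] Y posterior_eq_DMMT[OF assms(3,1,2) r])
      (simp_all add: posterior_params_def)
qed

end
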